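(* The tuple $\vec{s}=(s_{\mathbb{Q}},\,s_{\mathbb{F}_2}-s_{\mathbb{Q}},\,s_{\mathbb{F}_3}-s_{\mathbb{Q}},\,s_{\mathbb{F}_5}-s_{\mathbb{Q}},\dots)$ (indexed by $\mathbb{Q}$ and all the primes) defines a surjective group homomorphism $\widetilde{\mathcal{C}}_{LEO}\to(2\mathbb{Z})^\infty=\bigoplus_{n\in\mathbb{N}}2\mathbb{Z}$.
   Context: All complexes are bigraded cochain complexes ($i$ homological, $q$ quantum grading) with differential of bidegree $(1,0)$; "finitely generated free" means free on finitely many homogeneous generators. $h$ has bidegree $(0,-2)$; $h^{-1}D=D\otimes_{\mathbb{Z}[h]}\mathbb{Z}[h,h^{-1}]$. $H^{i,q}(M;A)$ is the cohomology of $M\otimes_{\mathbb{Z}}A$ in bigrading $(i,q)$. $\mathbb{F}_p=\mathbb{Z}/p$. A reduced LEO triple $(C,D,f)$ consists of finitely generated free bigraded complexes $C$ over $\mathbb{Z}$ and $D$ over $\mathbb{Z}[h]$, and a bigraded homotopy equivalence $f\colon C\otimes_{\mathbb{Z}}\mathbb{Z}/(2)\to D\otimes_{\mathbb{Z}[h]}\mathbb{Z}[h]/(2,h)$, such that $h^{-1}D$ is homotopy equivalent to a free graded module of rank 1 over $\mathbb{Z}[h,h^{-1}]$, supported in homological grading $0$ and even quantum gradings. A local map $(C,D,f)\to(C',D',f')$ is a pair of bigrading-preserving chain maps $\alpha\colon C\to C'$ over $\mathbb{Z}$, $\beta\colon D\to D'$ over $\mathbb{Z}[h]$ such that $\beta\colon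 h^{-1}D\to h^{-1}D'$ is a homotopy equivalence and $f'\circ\alpha$ and $\beta\circ f$ are chain homotopic as maps $C\otimes\mathbb{F}_2\to D'\otimes_{\mathbb{Z}[h]}\mathbb{Z}[h]/(2,h)$. Two triples are locally equivalent if there are local maps in both directions. $\widetilde{\mathcal{C}}_{LEO}$ is the abelian group of local equivalence classes, with addition $(C\otimes_{\mathbb{Z}}C',D\otimes_{\mathbb{Z}[h]}D',f\otimes f')$ and identity the class of $(\mathbb{Z},\mathbb{Z}[h],\mathrm{id})$ (generators in bigrading $(0,0)$). For a field $\mathbb{F}$ and a reduced LEO triple, $s_{\mathbb{F}}(C,D,f)=\max\{q\mid H^{0,q}(D;\mathbb{F})\to H^{0,q}(h^{-1}D;\mathbb{F})\text{ is non-zero}\}$, which depends only on $\mathbb{F}$ and the local equivalence class. *)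

theory Defs
  imports
    "HOL-Library.Poly_Mapping"
    "HOL-Library.Z2"
    "HOL-Library.Infinite_Set"
    "HOL-Computational_Algebra.Polynomial"
    "HOL-Computational_Algebra.Primes"
    "HOL-Number_Theory.Residues"
    "HOL-Algebra.Product_Groups"
    "HOL-Algebra.Algebraic_Closure_Type"
    "Jordan_Normal_Form.Matrix"
begin

text \<open>
  Free modules on finitely many homogeneous generators are given by the list of bidegrees
  \<open>(i, q)\<close> of the generators (\<open>i\<close> homological, \<open>q\<close> quantum), and linear maps between them by
  matrices acting on column vectors: the entry \<open>(l, j)\<close> is the coefficient of the \<open>l\<close>-th target
  generator in the image of the \<open>j\<close>-th source generator.

  A grading of the ground ring is given by the sets of its homogeneous elements of each quantum
  degree; the homological degree of every scalar is 0.
\<close>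

type_synonym 'r grading = "int \<Rightarrow> 'r set"

definition trivial_grading :: "'r::zero grading" where
  "trivial_grading q = (if q = 0 then UNIV else {0})"

text \<open>The variable \<open>h\<close> has quantum degree \<open>-2\<close>. The ring \<open>A[h, h\<inverse>]\<close> is the group ring of the
  integers, that is, finitely supported functions \<open>\<int> \<rightarrow> A\<close> with the convolution product.\<close>

definition poly_grading :: "'a::zero poly grading" where
  "poly_grading q = {p. \<forall>k. poly.coeff p k \<noteq> 0 \<longrightarrow> q = - 2 * int k}"

type_synonym 'a laurent = "int \<Rightarrow>\<^sub>0 'a"

definition laurent_grading :: "'a::zero laurent grading" where
  "laurent_grading q = {u. \<forall>k. Poly_Mapping.lookup u k \<noteq> 0 \<longrightarrow> q = - 2 * k}"

definition poly_to_laurent :: "'a::comm_monoid_add poly \<Rightarrow> 'a laurent" where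
  "poly_to_laurent p = (\<Sum>k\<le>Polynomial.degree p. Poly_Mapping.single (int k) (poly.coeff p k))"

lemma lookup_poly_to_laurent:
  "Poly_Mapping.lookup (poly_to_laurent p) m = (if m < 0 then 0 else poly.coeff p (nat m))"
proof -
  have "Poly_Mapping.lookup (poly_to_laurent p) m =
      (\<Sum>k\<le>Polynomial.degree p. poly.coeff p k when int k = m)"
    by (simp add: poly_to_laurent_def lookup_sum lookup_single)
  also have "\<dots> = (\<Sum>k\<le>Polynomial.degree p. if k = nat m \<and> 0 \<le> m then poly.coeff p k else 0)"
    by (rule sum.cong) (auto simp: when_def)
  also have "\<dots> = (if m < 0 then 0 else poly.coeff p (nat m))"
    by (auto simp: sum.delta not_less intro: coeff_eq_0)
  finally show ?thesis .
qed


subsection \<open>Finitely generated free bigraded complexes\<close>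

record 'r cplx =
  gens :: "(int \<times> int) list"
  diff :: "'r mat"

abbreviation rk :: "'r cplx \<Rightarrow> nat" where
  "rk M \<equiv> length (gens M)"

definition graded_map ::
    "'r::zero grading \<Rightarrow> int \<times> int \<Rightarrow> 'r cplx \<Rightarrow> 'r cplx \<Rightarrow> 'r mat \<Rightarrow> bool" where
  "graded_map G b M N \<phi> \<longleftrightarrow>
     \<phi> \<in> carrier_mat (rk N) (rk M) \<and>
     (\<forall>l < rk N. \<forall>j < rk M. \<phi> $$ (l, j) \<noteq> 0 \<longrightarrow>
        fst (gens N ! l) = fst (gens M ! j) + fst b \<and>
        \<phi> $$ (l, j) \<in> G (snd (gens M ! j) + snd b - snd (gens N ! l)))"

definition is_cplx :: "'r::comm_ring_1 grading \<Rightarrow> 'r cplx \<Rightarrow> bool" where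
  "is_cplx G M \<longleftrightarrow> graded_map G (1, 0) M M (diff M) \<and> diff M * diff M = 0\<^sub>m (rk M) (rk M)"

definition chain_map :: "'r::comm_ring_1 grading \<Rightarrow> 'r cplx \<Rightarrow> 'r cplx \<Rightarrow> 'r mat \<Rightarrow> bool" where
  "chain_map G M N \<phi> \<longleftrightarrow> graded_map G (0, 0) M N \<phi> \<and> diff N * \<phi> = \<phi> * diff M"

definition homotopic ::
    "'r::comm_ring_1 grading \<Rightarrow> 'r cplx \<Rightarrow> 'r cplx \<Rightarrow> 'r mat \<Rightarrow> 'r mat \<Rightarrow> bool" where
  "homotopic G M N \<phi> \<psi> \<longleftrightarrow>
     (\<exists>H. graded_map G (- 1, 0) M N H \<and> \<phi> - \<psi> = diff N * H + H * diff M)"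

definition homotopy_equivalence ::
    "'r::comm_ring_1 grading \<Rightarrow> 'r cplx \<Rightarrow> 'r cplx \<Rightarrow> 'r mat \<Rightarrow> bool" where
  "homotopy_equivalence G M N \<phi> \<longleftrightarrow> chain_map G M N \<phi> \<and>
     (\<exists>\<psi>. chain_map G N M \<psi> \<and>
        homotopic G M M (\<psi> * \<phi>) (1\<^sub>m (rk M)) \<and> homotopic G N N (\<phi> * \<psi>) (1\<^sub>m (rk N)))"

text \<open>The free module on one generator, with zero differential.\<close>

definition rank_one :: "int \<times> int \<Rightarrow> 'r::comm_ring_1 cplx" where
  "rank_one b = \<lparr>gens = [b], diff = 0\<^sub>m 1 1\<rparr>"

definition base_change :: "('r \<Rightarrow> 's) \<Rightarrow> 'r cplx \<Rightarrow> 's cplx" where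
  "base_change \<rho> M = \<lparr>gens = gens M, diff = map_mat \<rho> (diff M)\<rparr>"

definition int_mod2 :: "int \<Rightarrow> bit" where
  "int_mod2 = of_int"

text \<open>The quotient \<open>\<int>[h] \<rightarrow> \<int>[h]/(2, h)\<close>, the target being identified with \<open>\<int>/2\<close>.\<close>

definition poly_mod2h :: "int poly \<Rightarrow> bit" where
  "poly_mod2h p = of_int (poly.coeff p 0)"

abbreviation localize :: "int poly cplx \<Rightarrow> int laurent cplx" where
  "localize \<equiv> base_change poly_to_laurent"


subsection \<open>Tensor products\<close>

text \<open>The generator \<open>e\<^sub>j \<otimes> e'\<^sub>k\<close> has index \<open>j * n' + k\<close>, where \<open>n'\<close> is the rank of the second factor;
  this is the order of \<^const>\<open>List.product\<close>.\<close>

definition kron :: "'r::semiring_0 mat \<Rightarrow> 'r mat \<Rightarrow> 'r mat" where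
  "kron A B = mat (dim_row A * dim_row B) (dim_col A * dim_col B)
     (\<lambda>(l, j). A $$ (l div dim_row B, j div dim_col B) * B $$ (l mod dim_row B, j mod dim_col B))"

text \<open>The map \<open>x \<mapsto> (-1)\<^sup>i x\<close> for \<open>x\<close> of homological degree \<open>i\<close>, as in the Koszul sign rule
  \<open>d (x \<otimes> y) = d x \<otimes> y + (-1)\<^sup>i x \<otimes> d y\<close>.\<close>

definition sign_mat :: "'r::comm_ring_1 cplx \<Rightarrow> 'r mat" where
  "sign_mat M = mat (rk M) (rk M)
     (\<lambda>(l, j). if l = j then (if even (fst (gens M ! j)) then 1 else - 1) else 0)"

definition tensor :: "'r::comm_ring_1 cplx \<Rightarrow> 'r cplx \<Rightarrow> 'r cplx" where
  "tensor M N =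
     \<lparr>gens = map (\<lambda>(a, b). (fst a + fst b, snd a + snd b)) (List.product (gens M) (gens N)),
      diff = kron (diff M) (1\<^sub>m (rk N)) + kron (sign_mat M) (diff N)\<rparr>"


subsection \<open>Reduced LEO triples\<close>

type_synonym triple = "int cplx \<times> int poly cplx \<times> bit mat"

definition is_LEO :: "triple \<Rightarrow> bool" where
  "is_LEO = (\<lambda>(C, D, f).
     is_cplx trivial_grading C \<and> is_cplx poly_grading D \<and>
     homotopy_equivalence trivial_grading (base_change int_mod2 C) (base_change poly_mod2h D) f \<and>
     (\<exists>q \<phi>. even q \<and> homotopy_equivalence laurent_grading (localize D) (rank_one (0, q)) \<phi>))"

definition local_map :: "triple \<Rightarrow> triple \<Rightarrow> int mat \<Rightarrow> int poly mat \<Rightarrow> bool" where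
  "local_map = (\<lambda>(C, D, f) (C', D', f') \<alpha> \<beta>.
     chain_map trivial_grading C C' \<alpha> \<and> chain_map poly_grading D D' \<beta> \<and>
     homotopy_equivalence laurent_grading (localize D) (localize D') (map_mat poly_to_laurent \<beta>) \<and>
     homotopic trivial_grading (base_change int_mod2 C) (base_change poly_mod2h D')
       (f' * map_mat int_mod2 \<alpha>) (map_mat poly_mod2h \<beta> * f))"

definition local_equiv :: "(triple \<times> triple) set" where
  "local_equiv = {(T, T'). is_LEO T \<and> is_LEO T' \<and>
     (\<exists>\<alpha> \<beta>. local_map T T' \<alpha> \<beta>) \<and> (\<exists>\<alpha> \<beta>. local_map T' T \<alpha> \<beta>)}"

definition tensor_triple :: "triple \<Rightarrow> triple \<Rightarrow> triple" where
  "tensor_triple = (\<lambda>(C, D, f) (C', D', f'). (tensor C C', tensor D D', kron f f'))"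

definition unit_triple :: triple where
  "unit_triple = (rank_one (0, 0), rank_one (0, 0), 1\<^sub>m 1)"

definition LEO_group :: "triple set monoid" where
  "LEO_group =
     \<lparr>carrier = {T. is_LEO T} // local_equiv,
      monoid.mult = (\<lambda>U V. \<Union>T\<in>U. \<Union>T'\<in>V. local_equiv `` {tensor_triple T T'}),
      one = local_equiv `` {unit_triple}\<rparr>"


subsection \<open>Cohomology with coefficients\<close>

text \<open>
  A bigraded complex of free abelian groups on a possibly infinite homogeneous basis. The value
  \<open>zcoef b b'\<close> is the coefficient of \<open>b'\<close> in \<open>d b\<close>.
\<close>

record 'b zcplx =
  zbasis :: "'b set"
  zdeg :: "'b \<Rightarrow> int \<times> int"
  zcoef :: "'b \<Rightarrow> 'b \<Rightarrow> int"

definition zbasis_at :: "'b zcplx \<Rightarrow> int \<Rightarrow> int \<Rightarrow> 'b set" where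
  "zbasis_at M i q = {b \<in> zbasis M. zdeg M b = (i, q)}"

text \<open>\<open>M \<otimes>\<^sub>\<int> A\<close> in bidegree \<open>(i, q)\<close>; only the additive group of \<open>A\<close> matters.\<close>

definition cochains :: "'b zcplx \<Rightarrow> 'a ring \<Rightarrow> int \<Rightarrow> int \<Rightarrow> ('b \<Rightarrow> 'a) monoid" where
  "cochains M A i q = sum_group (zbasis_at M i q) (\<lambda>_. add_monoid A)"

definition codiff :: "'b zcplx \<Rightarrow> 'a ring \<Rightarrow> int \<Rightarrow> int \<Rightarrow> ('b \<Rightarrow> 'a) \<Rightarrow> 'b \<Rightarrow> 'a" where
  "codiff M A i q v = (\<lambda>b'\<in>zbasis_at M (i + 1) q.
     finsum A (\<lambda>b. add_pow A (zcoef M b b') (v b)) {b \<in> zbasis_at M i q. v b \<noteq> \<zero>\<^bsub>A\<^esub>})"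

definition cocycles :: "'b zcplx \<Rightarrow> 'a ring \<Rightarrow> int \<Rightarrow> int \<Rightarrow> ('b \<Rightarrow> 'a) monoid" where
  "cocycles M A i q = (cochains M A i q)
     \<lparr>carrier := kernel (cochains M A i q) (cochains M A (i + 1) q) (codiff M A i q)\<rparr>"

definition coboundaries :: "'b zcplx \<Rightarrow> 'a ring \<Rightarrow> int \<Rightarrow> int \<Rightarrow> ('b \<Rightarrow> 'a) set" where
  "coboundaries M A i q = codiff M A (i - 1) q ` carrier (cochains M A (i - 1) q)"

definition cohomology :: "'b zcplx \<Rightarrow> 'a ring \<Rightarrow> int \<Rightarrow> int \<Rightarrow> ('b \<Rightarrow> 'a) set monoid" where
  "cohomology M A i q = cocycles M A i q Mod coboundaries M A i q"

text \<open>The map induced on cohomology by a cochain map \<open>\<phi>\<close> into the complex \<open>N\<close>.\<close>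

definition cohomology_map ::
    "'c zcplx \<Rightarrow> 'a ring \<Rightarrow> int \<Rightarrow> int \<Rightarrow> (('b \<Rightarrow> 'a) \<Rightarrow> 'c \<Rightarrow> 'a) \<Rightarrow>
     ('b \<Rightarrow> 'a) set \<Rightarrow> ('c \<Rightarrow> 'a) set" where
  "cohomology_map N A i q \<phi> U =
     (\<Union>x\<in>U. coboundaries N A i q #>\<^bsub>cocycles N A i q\<^esub> \<phi> x)"

text \<open>
  The complexes of abelian groups underlying \<open>D\<close> and \<open>h\<inverse>D\<close>. The pair \<open>(j, k)\<close> stands for
  \<open>h\<^sup>k e\<^sub>j\<close>, with \<open>k \<ge> 0\<close> in the case of \<open>D\<close>; the coefficient of \<open>h\<^sup>m e\<^sub>l\<close> in \<open>d (h\<^sup>k e\<^sub>j)\<close> is that of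
  \<open>h\<^bsup>m - k\<^esup>\<close> in the matrix entry \<open>(l, j)\<close>.
\<close>

definition laurent_to_zcplx :: "int laurent cplx \<Rightarrow> (nat \<times> int) zcplx" where
  "laurent_to_zcplx E =
     \<lparr>zbasis = {..<rk E} \<times> UNIV,
      zdeg = (\<lambda>(j, k). (fst (gens E ! j), snd (gens E ! j) - 2 * k)),
      zcoef = (\<lambda>(j, k) (l, m). Poly_Mapping.lookup (diff E $$ (l, j)) (m - k))\<rparr>"

definition poly_to_zcplx :: "int poly cplx \<Rightarrow> (nat \<times> int) zcplx" where
  "poly_to_zcplx D =
     \<lparr>zbasis = {..<rk D} \<times> {0..},
      zdeg = (\<lambda>(j, k). (fst (gens D ! j), snd (gens D ! j) - 2 * k)),
      zcoef = (\<lambda>(j, k) (l, m). if m < k then 0 else poly.coeff (diff D $$ (l, j)) (nat (m - k)))\<rparr>"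

text \<open>The map \<open>H\<^bsup>i,q\<^esup>(D; A) \<rightarrow> H\<^bsup>i,q\<^esup>(h\<inverse>D; A)\<close> induced by the canonical map \<open>D \<rightarrow> h\<inverse>D\<close>, which on
  cochains is extension by zero to the basis elements \<open>h\<^sup>k e\<^sub>j\<close> with \<open>k < 0\<close>.\<close>

definition localization_map ::
    "int poly cplx \<Rightarrow> 'a ring \<Rightarrow> int \<Rightarrow> int \<Rightarrow> (nat \<times> int \<Rightarrow> 'a) set \<Rightarrow> (nat \<times> int \<Rightarrow> 'a) set" where
  "localization_map D A i q =
     cohomology_map (laurent_to_zcplx (localize D)) A i q
       (\<lambda>v. \<lambda>b\<in>zbasis_at (laurent_to_zcplx (localize D)) i q.
          if b \<in> zbasis_at (poly_to_zcplx D) i q then v b else \<zero>\<^bsub>A\<^esub>)"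

definition s_triple :: "'a ring \<Rightarrow> triple \<Rightarrow> int" where
  "s_triple F = (\<lambda>(C, D, f). GREATEST q.
     \<exists>U \<in> carrier (cohomology (poly_to_zcplx D) F 0 q).
       localization_map D F 0 q U \<noteq> \<one>\<^bsub>cohomology (laurent_to_zcplx (localize D)) F 0 q\<^esub>)"

text \<open>The value on a local equivalence class is the common value on its representatives.\<close>

definition s_inv :: "'a ring \<Rightarrow> triple set \<Rightarrow> int" where
  "s_inv F U = the_elem (s_triple F ` U)"


subsection \<open>The tuple of invariants\<close>

abbreviation rat_field :: "rat ring" where
  "rat_field \<equiv> ring_of_type_algebra"

text \<open>The \<open>0\<close>-th entry is \<open>s\<^sub>\<rat>\<close>; entry \<open>n + 1\<close> belongs to the \<open>n\<close>-th prime, counting from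
  \<open>n = 0\<close> for the prime 2.\<close>

definition s_vec :: "triple set \<Rightarrow> nat \<Rightarrow> int" where
  "s_vec U n = (case n of
     0 \<Rightarrow> s_inv rat_field U
   | Suc m \<Rightarrow> s_inv (residue_ring (int (enumerate {p::nat. normalization_semidom_class.prime p} m))) U - s_inv rat_field U)"

definition even_integers :: "int monoid" where
  "even_integers = integer_group\<lparr>carrier := {n. even n}\<rparr>"

end

theory Submission
  imports Defs
begin


text \<open>
  Everything takes place at \<open>h = 1\<close>. The entries of the matrices over \<open>\<int>[h]\<close> are homogeneous, hence
  integers times powers of \<open>h\<close> that can be read off from the degrees of the generators. So a complex
  \<open>D\<close> is the same thing as an integral complex \<open>M\<close> with a filtration by quantum degree: a cochain of
  \<open>D\<close> of quantum degree \<open>q\<close> is a vector supported on generators of degree at least \<open>q\<close> and of the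
  parity of \<open>q\<close>, while for \<open>h\<inverse>D\<close> the lower bound disappears. The homotopy equivalence of \<open>h\<inverse>D\<close> with
  a module of rank one becomes an integral row \<open>\<phi>\<close>, a column \<open>\<psi>\<close> and a homotopy \<open>H\<close> with
  \<open>\<phi>\<psi> = 1\<close> and \<open>\<psi>\<phi> - 1 = dH + Hd\<close>; over every field, a cocycle of homological degree \<open>0\<close> is a
  coboundary in \<open>h\<inverse>D\<close> exactly if \<open>\<phi>\<close> vanishes on it.

  Let \<open>p\<close> be \<open>0\<close> (for \<open>\<rat>\<close>) or a prime (for \<open>\<int>/p\<close>). After clearing denominators, the value of \<open>s\<close> over
  that field is the largest \<open>q\<close> with an integral vector \<open>z\<close> in filtration \<open>q\<close> such that \<open>d z = 0\<close> and
  \<open>\<phi> z \<noteq> 0\<close> modulo \<open>p\<close>. By linear duality this maximum has a certificate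
  (\<open>certificate_exists\<close>): the value is \<open>s\<close> if there are a cocycle \<open>z\<close> in filtration \<open>s\<close> and a functional \<open>l\<close>
  that kills coboundaries and everything of filtration above \<open>s\<close>, with \<open>l z \<noteq> 0\<close>, all modulo \<open>p\<close>.
  The functional bounds the value from above and the cocycle from below. All parts of the theorem are read off from
  certificates:

  \<^item> Tensor products of cocycles and of functionals are again a certificate, so \<open>s\<close> is additive
    (\<open>certificate_tensor\<close>).
  \<^item> A certificate over \<open>\<rat>\<close> is one over \<open>\<int>/p\<close> for every \<open>p\<close> that does not divide the integer \<open>l z\<close>, so
    almost all entries of the tuple vanish (\<open>certificate_zero_imp_finite_exceptions\<close>).
  \<^item> A local map carries cocycles to cocycles of at least the same filtration and preserves the
    condition \<open>\<phi> z \<noteq> 0\<close> modulo \<open>p\<close>, so \<open>s\<close> is monotone (\<open>local_map_certificate_le\<close>).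
  \<^item> \<open>\<phi>\<close> lives in even quantum degrees, so \<open>s\<close> is even.

  For surjectivity, every \<open>D\<close> is completed to a triple by \<open>C = D/h\<close> and \<open>f = id\<close>. The complexes with
  differential \<open>a \<mapsto> n c, b \<mapsto> h\<^sup>k c\<close> and \<open>x \<mapsto> n y + h\<^sup>k z\<close> have \<open>s = 0\<close> if \<open>p\<close> divides \<open>n\<close>, and
  \<open>s = -2 k\<close>, respectively \<open>s = 2 k\<close>, otherwise. With \<open>n\<close> prime, only one of the differences
  to \<open>s\<^sub>\<rat>\<close> is nonzero for them, and it can have either sign; tensor products of such complexes with a
  shifted unit realize every tuple.
\<close>


section \<open>Graded ground rings\<close>

locale graded_ring =
  fixes G :: "'r::comm_ring_1 grading"
  assumes zero_mem: "0 \<in> G q"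
    and one_mem: "1 \<in> G 0"
    and add_mem: "a \<in> G q \<Longrightarrow> b \<in> G q \<Longrightarrow> a + b \<in> G q"
    and uminus_mem: "a \<in> G q \<Longrightarrow> - a \<in> G q"
    and mult_mem: "a \<in> G q \<Longrightarrow> b \<in> G q' \<Longrightarrow> a * b \<in> G (q + q')"

lemma graded_ring_trivial: "graded_ring (trivial_grading :: 'r::comm_ring_1 grading)"
  by unfold_locales (auto simp: trivial_grading_def split: if_splits)

lemma graded_ring_poly: "graded_ring (poly_grading :: 'r::comm_ring_1 poly grading)"
proof unfold_locales
  fix a b :: "'r poly" and q q' :: int
  assume a: "a \<in> poly_grading q" and b: "b \<in> poly_grading q'"
  show "a * b \<in> poly_grading (q + q')"
    unfolding poly_grading_def
  proof (intro CollectI allI impI)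
    fix k assume "poly.coeff (a * b) k \<noteq> 0"
    then have "(\<Sum>i\<le>k. poly.coeff a i * poly.coeff b (k - i)) \<noteq> 0"
      by (simp add: coeff_mult)
    then obtain i where "i \<le> k" "poly.coeff a i * poly.coeff b (k - i) \<noteq> 0"
      by (meson atMost_iff sum.not_neutral_contains_not_neutral)
    then have "i \<le> k" "poly.coeff a i \<noteq> 0" "poly.coeff b (k - i) \<noteq> 0" by auto
    then show "q + q' = - 2 * int k"
      using a b by (force simp: poly_grading_def)
  qed
next
  fix a b :: "'r poly" and q :: int
  assume a: "a \<in> poly_grading q" and b: "b \<in> poly_grading q"
  show "a + b \<in> poly_grading q"
    unfolding poly_grading_def
  proof (intro CollectI allI impI)
    fix k assume "poly.coeff (a + b) k \<noteq> 0"
    then have "poly.coeff a k \<noteq> 0 \<or> poly.coeff b k \<noteq> 0" by auto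
    then show "q = - 2 * int k" using a b by (auto simp: poly_grading_def)
  qed
qed (auto simp: poly_grading_def)

lemma graded_ring_laurent: "graded_ring (laurent_grading :: 'r::comm_ring_1 laurent grading)"
proof unfold_locales
  fix a b :: "'r laurent" and q q' :: int
  assume a: "a \<in> laurent_grading q" and b: "b \<in> laurent_grading q'"
  show "a * b \<in> laurent_grading (q + q')"
    unfolding laurent_grading_def
  proof (intro CollectI allI impI)
    fix k assume "Poly_Mapping.lookup (a * b) k \<noteq> 0"
    then have "k \<in> Poly_Mapping.keys (a * b)" by (simp add: in_keys_iff)
    then obtain i j where "k = i + j" "i \<in> Poly_Mapping.keys a" "j \<in> Poly_Mapping.keys b"
      using keys_mult[of a b] by auto
    then show "q + q' = - 2 * k"
      using a b by (force simp: laurent_grading_def in_keys_iff)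
  qed
next
  fix a b :: "'r laurent" and q :: int
  assume a: "a \<in> laurent_grading q" and b: "b \<in> laurent_grading q"
  show "a + b \<in> laurent_grading q"
    unfolding laurent_grading_def
  proof (intro CollectI allI impI)
    fix k assume "Poly_Mapping.lookup (a + b) k \<noteq> 0"
    then have "Poly_Mapping.lookup a k \<noteq> 0 \<or> Poly_Mapping.lookup b k \<noteq> 0"
      by (auto simp: lookup_add)
    then show "q = - 2 * k" using a b by (auto simp: laurent_grading_def)
  qed
qed (auto simp: laurent_grading_def lookup_one when_def)

text \<open>Since \<open>h\<close> has degree \<open>-2\<close>, only the parity of the quantum degree survives when \<open>h\<close> is set to \<open>1\<close>.\<close>

definition parity_grading :: "int grading" where
  "parity_grading q = (if even q then UNIV else {0})"

lemma mem_parity_grading_iff: "a \<in> parity_grading q \<longleftrightarrow> a = 0 \<or> even q"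
  by (simp add: parity_grading_def)

lemma graded_map_carrier:
  "graded_map G b M N \<phi> \<Longrightarrow> \<phi> \<in> carrier_mat (rk N) (rk M)"
  by (simp add: graded_map_def)

lemma graded_map_fst:
  assumes "graded_map G b M N \<phi>" "l < rk N" "j < rk M" "\<phi> $$ (l, j) \<noteq> 0"
  shows "fst (gens N ! l) = fst (gens M ! j) + fst b"
  using assms by (simp add: graded_map_def)

lemma mult_mat_entry:
  assumes "A \<in> carrier_mat nr n" "B \<in> carrier_mat n nc" "i < nr" "j < nc"
  shows "(A * B) $$ (i, j) = (\<Sum>k<n. A $$ (i, k) * B $$ (k, j))"
  using assms by (simp add: scalar_prod_def atLeast0LessThan)

context graded_ring
begin

text \<open>Zero is homogeneous of every degree, so the degree condition can be imposed on all entries; in this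
  form it passes to sums.\<close>

lemma graded_map_iff:
  "graded_map G b M N \<phi> \<longleftrightarrow> \<phi> \<in> carrier_mat (rk N) (rk M) \<and>
     (\<forall>l < rk N. \<forall>j < rk M.
        (\<phi> $$ (l, j) \<noteq> 0 \<longrightarrow> fst (gens N ! l) = fst (gens M ! j) + fst b) \<and>
        \<phi> $$ (l, j) \<in> G (snd (gens M ! j) + snd b - snd (gens N ! l)))"
  unfolding graded_map_def using zero_mem by metis

lemma sum_mem: "(\<And>k. k \<in> K \<Longrightarrow> f k \<in> G q) \<Longrightarrow> sum f K \<in> G q"
  by (induction K rule: infinite_finite_induct) (auto intro: zero_mem add_mem)

lemma graded_map_mult:
  assumes \<phi>: "graded_map G b M N \<phi>" and \<psi>: "graded_map G c N P \<psi>"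
  shows "graded_map G (fst b + fst c, snd b + snd c) M P (\<psi> * \<phi>)"
proof -
  note car = graded_map_carrier[OF \<phi>] graded_map_carrier[OF \<psi>]
  have entry: "(\<psi> * \<phi>) $$ (l, j) = (\<Sum>k<rk N. \<psi> $$ (l, k) * \<phi> $$ (k, j))"
    if "l < rk P" "j < rk M" for l j
    using car that by (intro mult_mat_entry)
  show ?thesis unfolding graded_map_iff
  proof (intro conjI allI impI)
    show "\<psi> * \<phi> \<in> carrier_mat (rk P) (rk M)" using car by simp
  next
    fix l j assume lj: "l < rk P" "j < rk M" and "(\<psi> * \<phi>) $$ (l, j) \<noteq> 0"
    then obtain k where "k < rk N" "\<psi> $$ (l, k) * \<phi> $$ (k, j) \<noteq> 0"
      unfolding entry[OF lj] by (meson lessThan_iff sum.not_neutral_contains_not_neutral)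
    then have "k < rk N" "\<psi> $$ (l, k) \<noteq> 0" "\<phi> $$ (k, j) \<noteq> 0" by auto
    then show "fst (gens P ! l) = fst (gens M ! j) + fst (fst b + fst c, snd b + snd c)"
      using graded_map_fst[OF \<phi> _ lj(2)] graded_map_fst[OF \<psi> lj(1)] by simp
  next
    fix l j assume lj: "l < rk P" "j < rk M"
    have "\<psi> $$ (l, k) * \<phi> $$ (k, j) \<in> G (snd (gens M ! j) + (snd b + snd c) - snd (gens P ! l))"
      if "k < rk N" for k
    proof -
      have "\<psi> $$ (l, k) \<in> G (snd (gens N ! k) + snd c - snd (gens P ! l))"
        "\<phi> $$ (k, j) \<in> G (snd (gens M ! j) + snd b - snd (gens N ! k))"
        using \<phi> \<psi> lj that by (auto simp: graded_map_iff)
      from mult_mem[OF this] show ?thesis by (simp add: algebra_simps)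
    qed
    then show "(\<psi> * \<phi>) $$ (l, j) \<in>
        G (snd (gens M ! j) + snd (fst b + fst c, snd b + snd c) - snd (gens P ! l))"
      unfolding entry[OF lj] by (auto intro: sum_mem)
  qed
qed

lemma graded_map_add:
  assumes "graded_map G b M N \<phi>" "graded_map G b M N \<psi>"
  shows "graded_map G b M N (\<phi> + \<psi>)"
  unfolding graded_map_iff
proof (intro conjI allI impI)
  show "\<phi> + \<psi> \<in> carrier_mat (rk N) (rk M)"
    using assms[THEN graded_map_carrier] by simp
next
  fix l j assume lj: "l < rk N" "j < rk M"
  then have e: "(\<phi> + \<psi>) $$ (l, j) = \<phi> $$ (l, j) + \<psi> $$ (l, j)"
    using assms[THEN graded_map_carrier] by simp
  show "(\<phi> + \<psi>) $$ (l, j) \<in> G (snd (gens M ! j) + snd b - snd (gens N ! l))"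
    unfolding e using assms lj by (intro add_mem) (auto simp: graded_map_iff)
  assume "(\<phi> + \<psi>) $$ (l, j) \<noteq> 0"
  then have "\<phi> $$ (l, j) \<noteq> 0 \<or> \<psi> $$ (l, j) \<noteq> 0" unfolding e by auto
  then show "fst (gens N ! l) = fst (gens M ! j) + fst b"
    using graded_map_fst[OF assms(1) lj] graded_map_fst[OF assms(2) lj] by blast
qed

lemma graded_map_zero: "graded_map G b M N (0\<^sub>m (rk N) (rk M))"
  by (simp add: graded_map_iff zero_mem)

lemma graded_map_one: "graded_map G (0, 0) M M (1\<^sub>m (rk M))"
  by (auto simp: graded_map_iff one_mem zero_mem)

lemma graded_map_sign_mat: "graded_map G (0, 0) M M (sign_mat M)"
  by (auto simp: graded_map_iff sign_mat_def one_mem zero_mem uminus_mem)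

end


section \<open>Base change\<close>

lemma gens_base_change [simp]: "gens (base_change \<rho> M) = gens M"
  and diff_base_change [simp]: "diff (base_change \<rho> M) = map_mat \<rho> (diff M)"
  by (simp_all add: base_change_def)

lemma map_mat_minus:
  assumes "ring_hom \<rho>" "A \<in> carrier_mat nr nc" "B \<in> carrier_mat nr nc"
  shows "map_mat \<rho> (A - B) = map_mat \<rho> A - map_mat \<rho> B"
proof -
  interpret ring_hom \<rho> by fact
  show ?thesis using assms(2,3) by (intro eq_matI) (auto simp: hom_minus)
qed

lemma map_mat_add:
  assumes "ring_hom \<rho>" "A \<in> carrier_mat nr nc" "B \<in> carrier_mat nr nc"
  shows "map_mat \<rho> (A + B) = map_mat \<rho> A + map_mat \<rho> B"
proof -
  interpret ring_hom \<rho> by fact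
  show ?thesis using assms(2,3) by (intro eq_matI) (auto simp: hom_add)
qed

locale graded_ring_hom = ring_hom \<rho>
  for \<rho> :: "'r::comm_ring_1 \<Rightarrow> 's::comm_ring_1" +
  fixes G :: "'r grading" and G' :: "'s grading"
  assumes graded: "a \<in> G q \<Longrightarrow> \<rho> a \<in> G' q"
begin

lemma graded_map_base_change:
  assumes "graded_map G b M N \<phi>"
  shows "graded_map G' b (base_change \<rho> M) (base_change \<rho> N) (map_mat \<rho> \<phi>)"
  unfolding graded_map_def
proof (intro conjI allI impI)
  show "map_mat \<rho> \<phi> \<in> carrier_mat (rk (base_change \<rho> N)) (rk (base_change \<rho> M))"
    using graded_map_carrier[OF assms] by simp
next
  fix l j assume lj: "l < rk (base_change \<rho> N)" "j < rk (base_change \<rho> M)"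
    and nz: "map_mat \<rho> \<phi> $$ (l, j) \<noteq> 0"
  have e: "map_mat \<rho> \<phi> $$ (l, j) = \<rho> (\<phi> $$ (l, j))"
    using graded_map_carrier[OF assms] lj by auto
  with nz have "\<phi> $$ (l, j) \<noteq> 0" by auto
  then show "fst (gens (base_change \<rho> N) ! l) = fst (gens (base_change \<rho> M) ! j) + fst b"
    "map_mat \<rho> \<phi> $$ (l, j)
      \<in> G' (snd (gens (base_change \<rho> M) ! j) + snd b - snd (gens (base_change \<rho> N) ! l))"
    using assms lj unfolding e graded_map_def by (auto intro: graded)
qed

lemma is_cplx_base_change:
  assumes "is_cplx G M"
  shows "is_cplx G' (base_change \<rho> M)"
proof -
  have d: "diff M \<in> carrier_mat (rk M) (rk M)"
    using assms by (auto simp: is_cplx_def graded_map_def)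
  have "map_mat \<rho> (diff M) * map_mat \<rho> (diff M) = map_mat \<rho> (diff M * diff M)"
    using d by (simp add: mat_hom_mult)
  also have "\<dots> = 0\<^sub>m (rk M) (rk M)"
    using assms by (auto simp: is_cplx_def intro!: eq_matI)
  finally show ?thesis
    using assms graded_map_base_change unfolding is_cplx_def
    by (metis diff_base_change gens_base_change)
qed

lemma chain_map_base_change:
  assumes "chain_map G M N \<phi>" "is_cplx G M" "is_cplx G N"
  shows "chain_map G' (base_change \<rho> M) (base_change \<rho> N) (map_mat \<rho> \<phi>)"
proof -
  have car: "diff M \<in> carrier_mat (rk M) (rk M)" "diff N \<in> carrier_mat (rk N) (rk N)"
    "\<phi> \<in> carrier_mat (rk N) (rk M)"
    using assms by (auto simp: is_cplx_def chain_map_def graded_map_def)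
  have "map_mat \<rho> (diff N) * map_mat \<rho> \<phi> = map_mat \<rho> (diff N * \<phi>)"
    using car by (simp add: mat_hom_mult)
  also have "\<dots> = map_mat \<rho> (\<phi> * diff M)"
    using assms by (simp add: chain_map_def)
  also have "\<dots> = map_mat \<rho> \<phi> * map_mat \<rho> (diff M)"
    using car by (simp add: mat_hom_mult)
  finally show ?thesis
    using assms graded_map_base_change by (simp add: chain_map_def)
qed

lemma homotopic_base_change:
  assumes h: "homotopic G M N \<phi> \<psi>" and M: "is_cplx G M" and N: "is_cplx G N"
    and \<phi>: "\<phi> \<in> carrier_mat (rk N) (rk M)" and \<psi>: "\<psi> \<in> carrier_mat (rk N) (rk M)"
  shows "homotopic G' (base_change \<rho> M) (base_change \<rho> N) (map_mat \<rho> \<phi>) (map_mat \<rho> \<psi>)"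
proof -
  obtain H where H: "graded_map G (- 1, 0) M N H" and eq: "\<phi> - \<psi> = diff N * H + H * diff M"
    using h by (auto simp: homotopic_def)
  have car: "diff M \<in> carrier_mat (rk M) (rk M)" "diff N \<in> carrier_mat (rk N) (rk N)"
    "H \<in> carrier_mat (rk N) (rk M)"
    using M N H by (auto simp: is_cplx_def graded_map_def)
  have "map_mat \<rho> \<phi> - map_mat \<rho> \<psi> = map_mat \<rho> (diff N * H + H * diff M)"
    using map_mat_minus[OF ring_hom_axioms \<phi> \<psi>] eq by simp
  also have "\<dots> = map_mat \<rho> (diff N) * map_mat \<rho> H + map_mat \<rho> H * map_mat \<rho> (diff M)"
    using car map_mat_add[OF ring_hom_axioms, of "diff N * H" "rk N" "rk M" "H * diff M"]
    by (simp add: mat_hom_mult)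
  finally show ?thesis
    unfolding homotopic_def using graded_map_base_change[OF H] by auto
qed

lemma homotopy_equivalence_base_change:
  assumes h: "homotopy_equivalence G M N \<phi>" and M: "is_cplx G M" and N: "is_cplx G N"
  shows "homotopy_equivalence G' (base_change \<rho> M) (base_change \<rho> N) (map_mat \<rho> \<phi>)"
proof -
  obtain \<psi> where \<phi>: "chain_map G M N \<phi>" and \<psi>: "chain_map G N M \<psi>"
    and 1: "homotopic G M M (\<psi> * \<phi>) (1\<^sub>m (rk M))"
    and 2: "homotopic G N N (\<phi> * \<psi>) (1\<^sub>m (rk N))"
    using h by (auto simp: homotopy_equivalence_def)
  have car: "\<phi> \<in> carrier_mat (rk N) (rk M)" "\<psi> \<in> carrier_mat (rk M) (rk N)"
    using \<phi> \<psi> by (auto simp: chain_map_def graded_map_def)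
  show ?thesis unfolding homotopy_equivalence_def
  proof (intro conjI exI[of _ "map_mat \<rho> \<psi>"])
    show "chain_map G' (base_change \<rho> M) (base_change \<rho> N) (map_mat \<rho> \<phi>)"
      "chain_map G' (base_change \<rho> N) (base_change \<rho> M) (map_mat \<rho> \<psi>)"
      using \<phi> \<psi> M N by (auto intro: chain_map_base_change)
    show "homotopic G' (base_change \<rho> M) (base_change \<rho> M) (map_mat \<rho> \<psi> * map_mat \<rho> \<phi>)
        (1\<^sub>m (rk (base_change \<rho> M)))"
      using homotopic_base_change[OF 1 M M] car by (simp add: mat_hom_mult mat_hom_one)
    show "homotopic G' (base_change \<rho> N) (base_change \<rho> N) (map_mat \<rho> \<phi> * map_mat \<rho> \<psi>)
        (1\<^sub>m (rk (base_change \<rho> N)))"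
      using homotopic_base_change[OF 2 N N] car by (simp add: mat_hom_mult mat_hom_one)
  qed
qed

end

lemma base_change_base_change:
  "base_change \<sigma> (base_change \<rho> M) = base_change (\<lambda>x. \<sigma> (\<rho> x)) M"
  by (auto simp: base_change_def intro!: eq_matI)

lemma base_change_rank_one:
  assumes "ring_hom \<rho>" shows "base_change \<rho> (rank_one b) = rank_one b"
proof -
  interpret ring_hom \<rho> by fact
  show ?thesis by (auto simp: base_change_def rank_one_def intro!: eq_matI)
qed

lemma gens_rank_one [simp]: "gens (rank_one b) = [b]"
  and diff_rank_one [simp]: "diff (rank_one b) = 0\<^sub>m 1 1"
  by (simp_all add: rank_one_def)



section \<open>Tensor products\<close>

lemma kron_carrier [simp]:
  "A \<in> carrier_mat a b \<Longrightarrow> B \<in> carrier_mat c d \<Longrightarrow> kron A B \<in> carrier_mat (a * c) (b * d)"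
  by (auto simp: kron_def)

lemma kron_entry:
  assumes "A \<in> carrier_mat a b" "B \<in> carrier_mat c d" "i < a * c" "j < b * d"
  shows "kron A B $$ (i, j) = A $$ (i div c, j div d) * B $$ (i mod c, j mod d)"
  using assms by (auto simp: kron_def)

lemma div_mod_less:
  fixes i a b :: nat
  assumes "i < a * b" shows "i div b < a" "i mod b < b"
proof -
  have "b > 0" using assms by (cases b) auto
  then show "i div b < a" "i mod b < b"
    using assms by (auto simp: less_mult_imp_div_less)
qed

lemma sum_div_mod:
  fixes f :: "nat \<Rightarrow> nat \<Rightarrow> 'a::comm_monoid_add"
  shows "(\<Sum>i<a * b. f (i div b) (i mod b)) = (\<Sum>k<a. \<Sum>l<b. f k l)"
proof -
  have less: "k * b + l < a * b" if "k < a" "l < b" for k l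
  proof -
    have "k * b + l < Suc k * b" using that by simp
    also have "\<dots> \<le> a * b" using that by (intro mult_le_mono1) simp
    finally show ?thesis .
  qed
  have "(\<Sum>i<a * b. f (i div b) (i mod b)) = (\<Sum>(k, l)\<in>{..<a} \<times> {..<b}. f k l)"
    by (rule sum.reindex_bij_witness[of _ "\<lambda>(k, l). k * b + l" "\<lambda>i. (i div b, i mod b)"])
      (auto simp: less div_mod_less)
  then show ?thesis by (simp add: sum.cartesian_product)
qed

text \<open>The mixed-product rule. The index of a generator of the middle module splits into quotient and
  remainder, which makes the sum over it a product of two sums.\<close>

lemma kron_mult:
  fixes A :: "'r::comm_ring_1 mat"
  assumes A: "A \<in> carrier_mat a b" and C: "C \<in> carrier_mat b c"
    and B: "B \<in> carrier_mat a' b'" and D: "D \<in> carrier_mat b' c'"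
  shows "kron A B * kron C D = kron (A * C) (B * D)"
proof (rule eq_matI)
  fix i j assume "i < dim_row (kron (A * C) (B * D))" "j < dim_col (kron (A * C) (B * D))"
  then have ij: "i < a * a'" "j < c * c'" using assms by (auto simp: kron_def)
  have "(kron A B * kron C D) $$ (i, j)
      = (\<Sum>k<b * b'. kron A B $$ (i, k) * kron C D $$ (k, j))"
    using assms ij by (intro mult_mat_entry) auto
  also have "\<dots> = (\<Sum>k<b * b'. A $$ (i div a', k div b') * B $$ (i mod a', k mod b')
      * (C $$ (k div b', j div c') * D $$ (k mod b', j mod c')))"
    using ij by (intro sum.cong) (auto simp: kron_entry[OF A B] kron_entry[OF C D])
  also have "\<dots> = (\<Sum>k<b. \<Sum>l<b'. A $$ (i div a', k) * B $$ (i mod a', l)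
      * (C $$ (k, j div c') * D $$ (l, j mod c')))"
    by (rule sum_div_mod)
  also have "\<dots> = (\<Sum>k<b. A $$ (i div a', k) * C $$ (k, j div c'))
      * (\<Sum>l<b'. B $$ (i mod a', l) * D $$ (l, j mod c'))"
    by (simp add: sum_product algebra_simps)
  also have "\<dots> = (A * C) $$ (i div a', j div c') * (B * D) $$ (i mod a', j mod c')"
    using div_mod_less[OF ij(1)] div_mod_less[OF ij(2)]
    by (simp only: mult_mat_entry[OF A C] mult_mat_entry[OF B D])
  also have "\<dots> = kron (A * C) (B * D) $$ (i, j)"
    using assms ij by (intro kron_entry[symmetric]) auto
  finally show "(kron A B * kron C D) $$ (i, j) = kron (A * C) (B * D) $$ (i, j)" .
qed (use assms in \<open>auto simp: kron_def\<close>)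

lemma kron_add_left:
  fixes A :: "'r::comm_ring_1 mat"
  assumes "A \<in> carrier_mat a b" "A' \<in> carrier_mat a b" "B \<in> carrier_mat c d"
  shows "kron (A + A') B = kron A B + kron A' B"
  using assms by (intro eq_matI) (auto simp: kron_def div_mod_less distrib_right left_diff_distrib
      distrib_left right_diff_distrib)

lemma kron_add_right:
  fixes A :: "'r::comm_ring_1 mat"
  assumes "A \<in> carrier_mat a b" "B \<in> carrier_mat c d" "B' \<in> carrier_mat c d"
  shows "kron A (B + B') = kron A B + kron A B'"
  using assms by (intro eq_matI) (auto simp: kron_def div_mod_less distrib_right left_diff_distrib
      distrib_left right_diff_distrib)

lemma kron_diff_left:
  fixes A :: "'r::comm_ring_1 mat"
  assumes "A \<in> carrier_mat a b" "A' \<in> carrier_mat a b" "B \<in> carrier_mat c d"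
  shows "kron (A - A') B = kron A B - kron A' B"
  using assms by (intro eq_matI) (auto simp: kron_def div_mod_less distrib_right left_diff_distrib
      distrib_left right_diff_distrib)

lemma kron_diff_right:
  fixes A :: "'r::comm_ring_1 mat"
  assumes "A \<in> carrier_mat a b" "B \<in> carrier_mat c d" "B' \<in> carrier_mat c d"
  shows "kron A (B - B') = kron A B - kron A B'"
  using assms by (intro eq_matI) (auto simp: kron_def div_mod_less distrib_right left_diff_distrib
      distrib_left right_diff_distrib)

lemma kron_uminus_left:
  fixes A :: "'r::comm_ring_1 mat"
  assumes "A \<in> carrier_mat a b" "B \<in> carrier_mat c d"
  shows "kron (- A) B = - kron A B"
  using assms by (intro eq_matI) (auto simp: kron_def div_mod_less)

lemma kron_zero_left:
  fixes B :: "'r::comm_ring_1 mat"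
  assumes "B \<in> carrier_mat c d" shows "kron (0\<^sub>m a b) B = 0\<^sub>m (a * c) (b * d)"
  using assms by (intro eq_matI) (auto simp: kron_def div_mod_less)

lemma kron_zero_right:
  fixes A :: "'r::comm_ring_1 mat"
  assumes "A \<in> carrier_mat a b" shows "kron A (0\<^sub>m c d) = 0\<^sub>m (a * c) (b * d)"
  using assms by (intro eq_matI) (auto simp: kron_def div_mod_less)

lemma kron_one: "kron (1\<^sub>m a) (1\<^sub>m b) = (1\<^sub>m (a * b) :: 'r::comm_ring_1 mat)"
proof (intro eq_matI)
  fix i j assume ij: "i < dim_row (1\<^sub>m (a * b) :: 'r mat)" "j < dim_col (1\<^sub>m (a * b) :: 'r mat)"
  have "i = j \<longleftrightarrow> i div b = j div b \<and> i mod b = j mod b" by (metis div_mult_mod_eq)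
  then show "kron (1\<^sub>m a) (1\<^sub>m b) $$ (i, j) = (1\<^sub>m (a * b) :: 'r mat) $$ (i, j)"
    using ij by (auto simp: kron_def div_mod_less)
qed (auto simp: kron_def)

lemma map_mat_kron:
  assumes "ring_hom \<rho>" "A \<in> carrier_mat a b" "B \<in> carrier_mat c d"
  shows "map_mat \<rho> (kron A B) = kron (map_mat \<rho> A) (map_mat \<rho> B)"
proof -
  interpret ring_hom \<rho> by fact
  show ?thesis using assms(2,3) by (intro eq_matI) (auto simp: kron_def hom_mult div_mod_less)
qed

lemma rk_tensor: "rk (tensor M N) = rk M * rk N"
  by (simp add: tensor_def)

lemma gens_tensor_nth:
  assumes "i < rk M * rk N"
  shows "gens (tensor M N) ! i =
    (fst (gens M ! (i div rk N)) + fst (gens N ! (i mod rk N)),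
     snd (gens M ! (i div rk N)) + snd (gens N ! (i mod rk N)))"
  using assms by (simp add: tensor_def product_nth)

lemma diff_tensor: "diff (tensor M N) = kron (diff M) (1\<^sub>m (rk N)) + kron (sign_mat M) (diff N)"
  by (simp add: tensor_def)

lemma sign_mat_carrier [simp]: "sign_mat M \<in> carrier_mat (rk M) (rk M)"
  by (simp add: sign_mat_def)

lemma sign_mat_mult_left:
  assumes "A \<in> carrier_mat (rk M) n" "i < rk M" "j < n"
  shows "(sign_mat M * A) $$ (i, j) = (if even (fst (gens M ! i)) then 1 else - 1) * A $$ (i, j)"
proof -
  have "(sign_mat M * A) $$ (i, j) = (\<Sum>k<rk M. sign_mat M $$ (i, k) * A $$ (k, j))"
    using assms by (intro mult_mat_entry) auto
  also have "\<dots> = (\<Sum>k<rk M. if k = i then (if even (fst (gens M ! i)) then 1 else - 1) * A $$ (i, j) else 0)"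
    using assms by (intro sum.cong) (auto simp: sign_mat_def)
  finally show ?thesis using assms by simp
qed

lemma sign_mat_mult_right:
  assumes "A \<in> carrier_mat n (rk M)" "i < n" "j < rk M"
  shows "(A * sign_mat M) $$ (i, j) = (if even (fst (gens M ! j)) then 1 else - 1) * A $$ (i, j)"
proof -
  have "(A * sign_mat M) $$ (i, j) = (\<Sum>k<rk M. A $$ (i, k) * sign_mat M $$ (k, j))"
    using assms by (intro mult_mat_entry) auto
  also have "\<dots> = (\<Sum>k<rk M. if k = j then (if even (fst (gens M ! j)) then 1 else - 1) * A $$ (i, j) else 0)"
    using assms by (intro sum.cong) (auto simp: sign_mat_def)
  finally show ?thesis using assms by simp
qed

lemma sign_mat_mult_sign_mat: "sign_mat M * sign_mat M = 1\<^sub>m (rk M)"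
proof (rule eq_matI)
  fix i j assume "i < dim_row (1\<^sub>m (rk M))" "j < dim_col (1\<^sub>m (rk M))"
  then show "(sign_mat M * sign_mat M) $$ (i, j) = 1\<^sub>m (rk M) $$ (i, j)"
    by (simp add: sign_mat_mult_left[where n = "rk M"]) (auto simp: sign_mat_def)
qed (auto simp: sign_mat_def)

text \<open>A nonzero entry of \<open>\<phi>\<close> joins generators whose homological degrees differ by \<open>fst b\<close>, so the two
  signs agree or differ according to the parity of \<open>fst b\<close>.\<close>

lemma sign_mat_commute:
  assumes \<phi>: "graded_map G b M N \<phi>"
  shows "sign_mat N * \<phi> = (if even (fst b) then \<phi> * sign_mat M else - (\<phi> * sign_mat M))"
proof (rule eq_matI)
  have c: "\<phi> \<in> carrier_mat (rk N) (rk M)" by (rule graded_map_carrier[OF \<phi>])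
  let ?R = "if even (fst b) then \<phi> * sign_mat M else - (\<phi> * sign_mat M)"
  have d: "?R \<in> carrier_mat (rk N) (rk M)" using c sign_mat_carrier[of M] by auto
  fix i j assume "i < dim_row ?R" "j < dim_col ?R"
  with d have ij: "i < rk N" "j < rk M" by auto
  have "fst (gens N ! i) = fst (gens M ! j) + fst b" if "\<phi> $$ (i, j) \<noteq> 0"
    using graded_map_fst[OF \<phi> ij that] .
  moreover have "?R $$ (i, j) = (if even (fst b) then 1 else - 1) * (\<phi> * sign_mat M) $$ (i, j)"
    using c ij by (simp add: sign_mat_def)
  ultimately show "(sign_mat N * \<phi>) $$ (i, j) = ?R $$ (i, j)"
    unfolding sign_mat_mult_left[OF c ij] sign_mat_mult_right[OF c ij]
    by (cases "\<phi> $$ (i, j) = 0") auto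
qed (use graded_map_carrier[OF \<phi>] in \<open>auto simp: sign_mat_def\<close>)

lemma base_change_tensor:
  assumes "ring_hom \<rho>" "diff M \<in> carrier_mat (rk M) (rk M)" "diff N \<in> carrier_mat (rk N) (rk N)"
  shows "base_change \<rho> (tensor M N) = tensor (base_change \<rho> M) (base_change \<rho> N)"
proof -
  interpret ring_hom \<rho> by fact
  have s: "map_mat \<rho> (sign_mat M) = sign_mat (base_change \<rho> M)"
    by (auto simp: sign_mat_def hom_uminus intro!: eq_matI)
  show ?thesis
    using assms
    by (simp add: base_change_def tensor_def map_mat_add[where nr = "rk M * rk N" and nc = "rk M * rk N"]
        map_mat_kron[where a = "rk M" and b = "rk M" and c = "rk N" and d = "rk N"] mat_hom_one s)
qed

lemma tensor_rank_one:
  "tensor (rank_one b) (rank_one c) = rank_one (fst b + fst c, snd b + snd c)"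
  by (auto simp: tensor_def rank_one_def kron_def sign_mat_def intro!: eq_matI)

context graded_ring
begin

lemma graded_map_kron:
  assumes \<phi>: "graded_map G b M M' \<phi>" and \<psi>: "graded_map G c N N' \<psi>"
  shows "graded_map G (fst b + fst c, snd b + snd c) (tensor M N) (tensor M' N') (kron \<phi> \<psi>)"
  unfolding graded_map_def rk_tensor
proof (intro conjI allI impI)
  note car = graded_map_carrier[OF \<phi>] graded_map_carrier[OF \<psi>]
  then show "kron \<phi> \<psi> \<in> carrier_mat (rk M' * rk N') (rk M * rk N)" by simp
  fix l j assume lj: "l < rk M' * rk N'" "j < rk M * rk N" and nz: "kron \<phi> \<psi> $$ (l, j) \<noteq> 0"
  note e = kron_entry[OF car lj]
  note less = div_mod_less[OF lj(1)] div_mod_less[OF lj(2)]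
  from nz have nz': "\<phi> $$ (l div rk N', j div rk N) \<noteq> 0" "\<psi> $$ (l mod rk N', j mod rk N) \<noteq> 0"
    unfolding e by auto
  show "fst (gens (tensor M' N') ! l)
      = fst (gens (tensor M N) ! j) + fst (fst b + fst c, snd b + snd c)"
    using graded_map_fst[OF \<phi> less(1,3) nz'(1)] graded_map_fst[OF \<psi> less(2,4) nz'(2)]
    by (simp add: gens_tensor_nth lj)
  have "\<phi> $$ (l div rk N', j div rk N)
      \<in> G (snd (gens M ! (j div rk N)) + snd b - snd (gens M' ! (l div rk N')))"
    "\<psi> $$ (l mod rk N', j mod rk N)
      \<in> G (snd (gens N ! (j mod rk N)) + snd c - snd (gens N' ! (l mod rk N')))"
    using \<phi> \<psi> less by (auto simp: graded_map_iff)
  from mult_mem[OF this] show "kron \<phi> \<psi> $$ (l, j) \<in> G (snd (gens (tensor M N) ! j)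
      + snd (fst b + fst c, snd b + snd c) - snd (gens (tensor M' N') ! l))"
    by (simp add: gens_tensor_nth lj e algebra_simps)
qed

end



lemma is_cplxD:
  assumes "is_cplx G M"
  shows "graded_map G (1, 0) M M (diff M)" "diff M \<in> carrier_mat (rk M) (rk M)"
    "diff M * diff M = 0\<^sub>m (rk M) (rk M)"
  using assms by (auto simp: is_cplx_def graded_map_def)

lemma chain_mapD:
  assumes "chain_map G M N \<phi>"
  shows "graded_map G (0, 0) M N \<phi>" "\<phi> \<in> carrier_mat (rk N) (rk M)"
    "diff N * \<phi> = \<phi> * diff M"
  using assms by (auto simp: chain_map_def graded_map_def)

context graded_ring
begin

text \<open>The square of the differential is \<open>d\<^sup>2 \<otimes> 1 + (d \<epsilon> + \<epsilon> d) \<otimes> d' + \<epsilon>\<^sup>2 \<otimes> d'\<^sup>2\<close> for the sign map \<open>\<epsilon>\<close>,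
  and \<open>\<epsilon>\<close> anticommutes with \<open>d\<close>.\<close>

lemma is_cplx_tensor:
  assumes M: "is_cplx G M" and N: "is_cplx G N"
  shows "is_cplx G (tensor M N)"
proof -
  note dM = is_cplxD[OF M] and dN = is_cplxD[OF N]
  define d e s where "d = diff M" and "e = diff N" and "s = sign_mat M"
  define I where "I = (1\<^sub>m (rk N) :: 'r mat)"
  have d: "d \<in> carrier_mat (rk M) (rk M)" and e: "e \<in> carrier_mat (rk N) (rk N)"
    and s: "s \<in> carrier_mat (rk M) (rk M)" and I: "I \<in> carrier_mat (rk N) (rk N)"
    using dM dN by (auto simp: d_def e_def s_def I_def)
  have sd: "s * d = - (d * s)"
    using sign_mat_commute[OF dM(1)] by (simp add: s_def d_def)
  have "graded_map G (1, 0) (tensor M N) (tensor M N) (diff (tensor M N))"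
    unfolding diff_tensor
    using graded_map_add graded_map_kron[OF dM(1) graded_map_one]
      graded_map_kron[OF graded_map_sign_mat dN(1)] by simp
  moreover have "diff (tensor M N) * diff (tensor M N) = 0\<^sub>m (rk M * rk N) (rk M * rk N)"
  proof -
    have c: "kron d I \<in> carrier_mat (rk M * rk N) (rk M * rk N)"
      "kron s e \<in> carrier_mat (rk M * rk N) (rk M * rk N)" using d e s I by auto
    have "(kron d I + kron s e) * (kron d I + kron s e)
        = (kron d I * kron d I + kron d I * kron s e) + (kron s e * kron d I + kron s e * kron s e)"
      using add_mult_distrib_mat[OF c add_carrier_mat[OF c(2)]]
        mult_add_distrib_mat[OF c(1) c] mult_add_distrib_mat[OF c(2) c] by simp
    also have "kron d I * kron d I = 0\<^sub>m (rk M * rk N) (rk M * rk N)"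
      using kron_mult[OF d d I I] kron_zero_left[of "I * I"] I dM(3) by (simp add: d_def)
    also have "kron s e * kron s e = 0\<^sub>m (rk M * rk N) (rk M * rk N)"
      using kron_mult[OF s s e e] kron_zero_right[of "s * s"] s dN(3) by (simp add: e_def)
    also have "kron s e * kron d I = - kron (d * s) e"
      using kron_mult[OF s d e I] kron_uminus_left[OF mult_carrier_mat[OF d s] e] e by (simp add: sd I_def)
    also have "kron d I * kron s e = kron (d * s) e"
      using kron_mult[OF d s I e] e by (simp add: I_def)
    also have "0\<^sub>m (rk M * rk N) (rk M * rk N) + kron (d * s) e
        + (- kron (d * s) e + 0\<^sub>m (rk M * rk N) (rk M * rk N)) = 0\<^sub>m (rk M * rk N) (rk M * rk N)"
      using kron_carrier[OF mult_carrier_mat[OF d s] e] by (auto intro!: eq_matI)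
    finally show ?thesis by (simp add: diff_tensor d_def e_def s_def I_def)
  qed
  ultimately show ?thesis by (simp add: is_cplx_def rk_tensor)
qed

lemma chain_map_kron:
  assumes \<phi>: "chain_map G M M' \<phi>" and \<psi>: "chain_map G N N' \<psi>"
    and M: "is_cplx G M" "is_cplx G M'" and N: "is_cplx G N" "is_cplx G N'"
  shows "chain_map G (tensor M N) (tensor M' N') (kron \<phi> \<psi>)"
proof -
  note a = chain_mapD[OF \<phi>] and b = chain_mapD[OF \<psi>]
  note d = is_cplxD(2)[OF M(1)] is_cplxD(2)[OF M(2)] is_cplxD(2)[OF N(1)] is_cplxD(2)[OF N(2)]
  have s: "sign_mat M' * \<phi> = \<phi> * sign_mat M" using sign_mat_commute[OF a(1)] by simp
  have "diff (tensor M' N') * kron \<phi> \<psi>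
      = kron (diff M') (1\<^sub>m (rk N')) * kron \<phi> \<psi> + kron (sign_mat M') (diff N') * kron \<phi> \<psi>"
    unfolding diff_tensor using a b d
    by (intro add_mult_distrib_mat[where nr = "rk M' * rk N'" and n = "rk M' * rk N'"
          and nc = "rk M * rk N"]) auto
  also have "kron (diff M') (1\<^sub>m (rk N')) * kron \<phi> \<psi> = kron (\<phi> * diff M) \<psi>"
    using kron_mult[OF d(2) a(2) one_carrier_mat b(2)] a b by simp
  also have "kron (sign_mat M') (diff N') * kron \<phi> \<psi> = kron (\<phi> * sign_mat M) (\<psi> * diff N)"
    using kron_mult[OF sign_mat_carrier a(2) d(4) b(2)] a b s by simp
  also have "kron (\<phi> * diff M) \<psi> = kron \<phi> \<psi> * kron (diff M) (1\<^sub>m (rk N))"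
    using kron_mult[OF a(2) d(1) b(2) one_carrier_mat] b by simp
  also have "kron (\<phi> * sign_mat M) (\<psi> * diff N) = kron \<phi> \<psi> * kron (sign_mat M) (diff N)"
    using kron_mult[OF a(2) sign_mat_carrier b(2) d(3)] by simp
  also have "kron \<phi> \<psi> * kron (diff M) (1\<^sub>m (rk N)) + kron \<phi> \<psi> * kron (sign_mat M) (diff N)
      = kron \<phi> \<psi> * diff (tensor M N)"
    unfolding diff_tensor
    using a b d
    by (intro mult_add_distrib_mat[symmetric, where nr = "rk M' * rk N'" and n = "rk M * rk N"
          and nc = "rk M * rk N"]) auto
  finally show ?thesis
    using graded_map_kron[OF a(1) b(1)] by (simp add: chain_map_def)
qed

text \<open>From \<open>f \<otimes> f' - g \<otimes> g' = (f - g) \<otimes> f' + g \<otimes> (f' - g')\<close> the homotopy \<open>H \<otimes> f' + \<epsilon> g \<otimes> H'\<close> is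
  obtained; the sign map \<open>\<epsilon>\<close> turns \<open>H'\<close> into a homotopy for the second tensor factor.\<close>

lemma homotopic_kron:
  assumes M: "is_cplx G M" "is_cplx G M'" and N: "is_cplx G N" "is_cplx G N'"
    and h: "homotopic G M M' f g" and h': "homotopic G N N' f' g'"
    and f: "chain_map G M M' f" and g: "chain_map G M M' g"
    and f': "chain_map G N N' f'" and g': "chain_map G N N' g'"
  shows "homotopic G (tensor M N) (tensor M' N') (kron f f') (kron g g')"
proof -
  obtain H where H: "graded_map G (- 1, 0) M M' H" and Heq: "f - g = diff M' * H + H * diff M"
    using h by (auto simp: homotopic_def)
  obtain H' where H': "graded_map G (- 1, 0) N N' H'"
    and Heq': "f' - g' = diff N' * H' + H' * diff N"
    using h' by (auto simp: homotopic_def)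
  define s s' where "s = sign_mat M" and "s' = sign_mat M'"
  define K where "K = kron H f' + kron (s' * g) H'"
  define m n where "m = rk M' * rk N'" and "n = rk M * rk N"
  note car = is_cplxD(2)[OF M(1)] is_cplxD(2)[OF M(2)] is_cplxD(2)[OF N(1)] is_cplxD(2)[OF N(2)]
    chain_mapD(2)[OF f] chain_mapD(2)[OF g] chain_mapD(2)[OF f'] chain_mapD(2)[OF g']
    graded_map_carrier[OF H] graded_map_carrier[OF H']
  have s: "s \<in> carrier_mat (rk M) (rk M)" and s': "s' \<in> carrier_mat (rk M') (rk M')"
    by (auto simp: s_def s'_def)
  have s'g: "s' * g \<in> carrier_mat (rk M') (rk M)" using s' car by simp
  have c: "kron H f' \<in> carrier_mat m n" "kron (s' * g) H' \<in> carrier_mat m n"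
    "kron (diff M') (1\<^sub>m (rk N')) \<in> carrier_mat m m" "kron s' (diff N') \<in> carrier_mat m m"
    "kron (diff M) (1\<^sub>m (rk N)) \<in> carrier_mat n n" "kron s (diff N) \<in> carrier_mat n n"
    using car s s' s'g by (auto simp: m_def n_def)
  have K: "graded_map G (- 1, 0) (tensor M N) (tensor M' N') K"
  proof -
    have "graded_map G (0, 0) M M' (s' * g)"
      using graded_map_mult[OF chain_mapD(1)[OF g] graded_map_sign_mat] by (simp add: s'_def)
    then show ?thesis unfolding K_def
      using graded_map_add graded_map_kron[OF H chain_mapD(1)[OF f']] graded_map_kron[OF _ H']
      by fastforce
  qed
  \<comment> \<open>The sign matrix anticommutes with maps of odd homological degree, so the mixed terms
    of \<open>d K + K d\<close> cancel in pairs.\<close>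
  have sH: "s' * H = - (H * s)" using sign_mat_commute[OF H] by (simp add: s_def s'_def)
  have sd: "s' * diff M' = - (diff M' * s')"
    using sign_mat_commute[OF is_cplxD(1)[OF M(2)]] by (simp add: s'_def)
  have sg: "s' * g = g * s"
    using sign_mat_commute[OF chain_mapD(1)[OF g]] by (simp add: s_def s'_def)
  have ss: "s * s = 1\<^sub>m (rk M)" "s' * s' = 1\<^sub>m (rk M')"
    by (simp_all add: s_def s'_def sign_mat_mult_sign_mat)
  have dsg: "diff M' * (s' * g) = - (s' * g * diff M)"
  proof -
    have "s' * g * diff M = s' * (diff M' * g)"
      using assoc_mult_mat[OF s' car(6) car(1)] chain_mapD(3)[OF g] by simp
    also have "\<dots> = - (diff M' * s') * g"
      using assoc_mult_mat[OF s' car(2) car(6)] sd by simp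
    also have "\<dots> = - (diff M' * (s' * g))"
      using assoc_mult_mat[OF car(2) s' car(6)] car s' by simp
    finally show ?thesis using car s' by simp
  qed
  have ssg: "s' * (s' * g) = g"
    using assoc_mult_mat[OF s' s' car(6)] ss car by simp
  have sgs: "s' * g * s = g"
    using assoc_mult_mat[OF car(6) s s] ss car by (simp add: sg)
  have 1: "kron (diff M') (1\<^sub>m (rk N')) * kron H f' = kron (diff M' * H) f'"
    "kron (diff M') (1\<^sub>m (rk N')) * kron (s' * g) H' = - kron (s' * g * diff M) H'"
    "kron s' (diff N') * kron H f' = - kron (H * s) (f' * diff N)"
    "kron s' (diff N') * kron (s' * g) H' = kron g (diff N' * H')"
    "kron H f' * kron (diff M) (1\<^sub>m (rk N)) = kron (H * diff M) f'"
    "kron (s' * g) H' * kron (diff M) (1\<^sub>m (rk N)) = kron (s' * g * diff M) H'"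
    "kron H f' * kron s (diff N) = kron (H * s) (f' * diff N)"
    "kron (s' * g) H' * kron s (diff N) = kron g (H' * diff N)"
    using kron_mult[OF car(2) car(9) one_carrier_mat car(7)]
      kron_mult[OF car(2) s'g one_carrier_mat car(10)]
      kron_uminus_left[OF mult_carrier_mat[OF s'g car(1)] car(10)]
      kron_mult[OF s' car(9) car(4) car(7)]
      kron_uminus_left[OF mult_carrier_mat[OF car(9) s] mult_carrier_mat[OF car(7) car(3)]]
      kron_mult[OF s' s'g car(4) car(10)]
      kron_mult[OF car(9) car(1) car(7) one_carrier_mat]
      kron_mult[OF s'g car(1) car(10) one_carrier_mat]
      kron_mult[OF car(9) s car(7) car(3)] kron_mult[OF s'g s car(10) car(3)]
      car chain_mapD(3)[OF f']
    by (simp_all add: dsg sH ssg sgs)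
  define X1 X2 X3 X4 X5 X6 where
    "X1 = kron (diff M' * H) f'" and "X2 = kron (s' * g * diff M) H'"
    and "X3 = kron (H * s) (f' * diff N)" and "X4 = kron g (diff N' * H')"
    and "X5 = kron (H * diff M) f'" and "X6 = kron g (H' * diff N)"
  have X: "X1 \<in> carrier_mat m n" "X2 \<in> carrier_mat m n" "X3 \<in> carrier_mat m n"
    "X4 \<in> carrier_mat m n" "X5 \<in> carrier_mat m n" "X6 \<in> carrier_mat m n"
    using car s s' by (auto simp: X1_def X2_def X3_def X4_def X5_def X6_def m_def n_def
        intro!: kron_carrier)
  have "diff (tensor M' N') * K = (X1 + - X3) + (- X2 + X4)"
    unfolding diff_tensor K_def s'_def[symmetric]
    using c X by (simp add: mult_add_distrib_mat[where nr = m and n = m and nc = n]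
        add_mult_distrib_mat[where nr = m and n = m and nc = n] 1 X1_def X2_def X3_def X4_def)
  moreover have "K * diff (tensor M N) = (X5 + X2) + (X3 + X6)"
    unfolding diff_tensor K_def s_def[symmetric]
    using c X by (simp add: mult_add_distrib_mat[where nr = m and n = n and nc = n]
        add_mult_distrib_mat[where nr = m and n = n and nc = n] 1 X2_def X3_def X5_def X6_def)
  ultimately have "diff (tensor M' N') * K + K * diff (tensor M N) = (X1 + X5) + (X4 + X6)"
    using X by (auto intro!: eq_matI)
  also have "X1 + X5 = kron (f - g) f'"
    unfolding Heq X1_def X5_def
    using car by (intro kron_add_left[symmetric]) auto
  also have "X4 + X6 = kron g (f' - g')"
    unfolding Heq' X4_def X6_def
    using car by (intro kron_add_right[symmetric]) auto
  also have "kron (f - g) f' + kron g (f' - g') = kron f f' - kron g g'"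
  proof -
    have "kron f f' \<in> carrier_mat m n" "kron g f' \<in> carrier_mat m n" "kron g g' \<in> carrier_mat m n"
      using car by (auto simp: m_def n_def)
    then show ?thesis
      unfolding kron_diff_left[OF car(5,6,7)] kron_diff_right[OF car(6,7,8)]
      by (auto intro!: eq_matI)
  qed
  finally show ?thesis unfolding homotopic_def using K by metis
qed

lemma chain_map_mult:
  assumes \<phi>: "chain_map G M N \<phi>" and \<psi>: "chain_map G N P \<psi>"
    and "is_cplx G M" "is_cplx G N" "is_cplx G P"
  shows "chain_map G M P (\<psi> * \<phi>)"
proof -
  note a = chain_mapD[OF \<phi>] and b = chain_mapD[OF \<psi>]
  note d = is_cplxD(2)[OF assms(3)] is_cplxD(2)[OF assms(4)] is_cplxD(2)[OF assms(5)]
  have "diff P * (\<psi> * \<phi>) = \<psi> * (diff N * \<phi>)"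
    using assoc_mult_mat[OF d(3) b(2) a(2)] assoc_mult_mat[OF b(2) d(2) a(2)] b(3) by simp
  also have "\<dots> = \<psi> * \<phi> * diff M"
    using assoc_mult_mat[OF b(2) a(2) d(1)] a(3) by simp
  finally show ?thesis
    using graded_map_mult[OF a(1) b(1)] by (simp add: chain_map_def)
qed

lemma chain_map_one: "is_cplx G M \<Longrightarrow> chain_map G M M (1\<^sub>m (rk M))"
  using graded_map_one is_cplxD(2)[of G M] by (simp add: chain_map_def)

lemma homotopic_refl:
  assumes "is_cplx G M" "is_cplx G N" "\<phi> \<in> carrier_mat (rk N) (rk M)"
  shows "homotopic G M N \<phi> \<phi>"
  unfolding homotopic_def
  using graded_map_zero is_cplxD(2)[OF assms(1)] is_cplxD(2)[OF assms(2)] assms(3)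
  by (intro exI[of _ "0\<^sub>m (rk N) (rk M)"]) auto

lemma homotopy_equivalence_one:
  assumes M: "is_cplx G M" shows "homotopy_equivalence G M M (1\<^sub>m (rk M))"
  unfolding homotopy_equivalence_def
  using chain_map_one[OF M] homotopic_refl[OF M M one_carrier_mat]
  by (intro conjI exI[of _ "1\<^sub>m (rk M)"]) auto

lemma homotopy_equivalence_kron:
  assumes M: "is_cplx G M" "is_cplx G M'" and N: "is_cplx G N" "is_cplx G N'"
    and \<phi>: "homotopy_equivalence G M M' \<phi>" and \<psi>: "homotopy_equivalence G N N' \<psi>"
  shows "homotopy_equivalence G (tensor M N) (tensor M' N') (kron \<phi> \<psi>)"
proof -
  obtain \<phi>' where \<phi>_map: "chain_map G M M' \<phi>" and \<phi>': "chain_map G M' M \<phi>'"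
    and h1: "homotopic G M M (\<phi>' * \<phi>) (1\<^sub>m (rk M))"
    and h2: "homotopic G M' M' (\<phi> * \<phi>') (1\<^sub>m (rk M'))"
    using \<phi> by (auto simp: homotopy_equivalence_def)
  obtain \<psi>' where \<psi>_map: "chain_map G N N' \<psi>" and \<psi>': "chain_map G N' N \<psi>'"
    and k1: "homotopic G N N (\<psi>' * \<psi>) (1\<^sub>m (rk N))"
    and k2: "homotopic G N' N' (\<psi> * \<psi>') (1\<^sub>m (rk N'))"
    using \<psi> by (auto simp: homotopy_equivalence_def)
  note car = chain_mapD(2)[OF \<phi>_map] chain_mapD(2)[OF \<phi>']
    chain_mapD(2)[OF \<psi>_map] chain_mapD(2)[OF \<psi>']
  show ?thesis unfolding homotopy_equivalence_def
  proof (intro conjI exI[of _ "kron \<phi>' \<psi>'"])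
    show "chain_map G (tensor M N) (tensor M' N') (kron \<phi> \<psi>)"
      by (intro chain_map_kron \<phi>_map \<psi>_map M N)
    show "chain_map G (tensor M' N') (tensor M N) (kron \<phi>' \<psi>')"
      by (intro chain_map_kron \<phi>' \<psi>' M N)
    show "homotopic G (tensor M N) (tensor M N) (kron \<phi>' \<psi>' * kron \<phi> \<psi>) (1\<^sub>m (rk (tensor M N)))"
      unfolding kron_mult[OF car(2) car(1) car(4) car(3)] rk_tensor kron_one[symmetric]
      by (intro homotopic_kron h1 k1 M N chain_map_mult[OF \<phi>_map \<phi>'] chain_map_mult[OF \<psi>_map \<psi>']
          chain_map_one)
    show "homotopic G (tensor M' N') (tensor M' N') (kron \<phi> \<psi> * kron \<phi>' \<psi>')
        (1\<^sub>m (rk (tensor M' N')))"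
      unfolding kron_mult[OF car(1) car(2) car(3) car(4)] rk_tensor kron_one[symmetric]
      by (intro homotopic_kron h2 k2 M N chain_map_mult[OF \<phi>' \<phi>_map] chain_map_mult[OF \<psi>' \<psi>_map]
          chain_map_one)
  qed
qed

end



section \<open>Setting h to 1\<close>

text \<open>The value at \<open>h = 1\<close>.\<close>

definition laurent_eval :: "'a::comm_ring_1 laurent \<Rightarrow> 'a" where
  "laurent_eval u = (\<Sum>k\<in>Poly_Mapping.keys u. Poly_Mapping.lookup u k)"

lemma laurent_eval_superset:
  assumes "finite K" "Poly_Mapping.keys u \<subseteq> K"
  shows "laurent_eval u = (\<Sum>k\<in>K. Poly_Mapping.lookup u k)"
  unfolding laurent_eval_def using assms by (intro sum.mono_neutral_left) (auto simp: in_keys_iff)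

lemma laurent_eval_single [simp]: "laurent_eval (Poly_Mapping.single k a) = a"
  by (subst laurent_eval_superset[of "{k}"]) auto

lemma laurent_eval_add: "laurent_eval (u + v) = laurent_eval u + laurent_eval v"
proof -
  let ?K = "Poly_Mapping.keys u \<union> Poly_Mapping.keys v"
  have "laurent_eval (u + v) = (\<Sum>k\<in>?K. Poly_Mapping.lookup (u + v) k)"
    by (intro laurent_eval_superset) (auto simp: in_keys_iff lookup_add)
  also have "\<dots> = laurent_eval u + laurent_eval v"
    by (simp add: lookup_add sum.distrib laurent_eval_superset[of ?K])
  finally show ?thesis .
qed

lemma laurent_eval_zero: "laurent_eval 0 = 0"
  by (simp add: laurent_eval_def)

lemma laurent_eval_sum: "laurent_eval (sum f K) = (\<Sum>k\<in>K. laurent_eval (f k))"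
  by (induction K rule: infinite_finite_induct) (auto simp: laurent_eval_add laurent_eval_zero)

lemma poly_mapping_eq_sum_single:
  "u = (\<Sum>k\<in>Poly_Mapping.keys u. Poly_Mapping.single k (Poly_Mapping.lookup u k))"
proof (rule poly_mapping_eqI)
  fix m
  have "Poly_Mapping.lookup (\<Sum>k\<in>Poly_Mapping.keys u. Poly_Mapping.single k (Poly_Mapping.lookup u k)) m
      = (\<Sum>k\<in>Poly_Mapping.keys u. if k = m then Poly_Mapping.lookup u k else 0)"
    by (auto simp: lookup_sum lookup_single when_def intro!: sum.cong)
  then show "Poly_Mapping.lookup u m = Poly_Mapping.lookup
      (\<Sum>k\<in>Poly_Mapping.keys u. Poly_Mapping.single k (Poly_Mapping.lookup u k)) m"
    by (simp add: in_keys_iff)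
qed

lemma laurent_eval_mult: "laurent_eval (u * v) = laurent_eval u * laurent_eval v"
proof -
  have "u * v = (\<Sum>k\<in>Poly_Mapping.keys u. \<Sum>l\<in>Poly_Mapping.keys v.
      Poly_Mapping.single (k + l) (Poly_Mapping.lookup u k * Poly_Mapping.lookup v l))"
    by (subst poly_mapping_eq_sum_single[of u], subst poly_mapping_eq_sum_single[of v])
      (simp add: sum_product mult_single)
  then show ?thesis
    by (simp add: laurent_eval_sum) (simp add: laurent_eval_def sum_product)
qed

lemma ring_hom_laurent_eval: "ring_hom (laurent_eval :: 'a::comm_ring_1 laurent \<Rightarrow> 'a)"
proof
  show "laurent_eval (1 :: 'a laurent) = 1"
    by (subst single_one[symmetric]) (rule laurent_eval_single)
qed (auto simp: laurent_eval_add laurent_eval_mult laurent_eval_zero)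

lemma poly_to_laurent_eq_sum:
  assumes "Polynomial.degree p \<le> N"
  shows "poly_to_laurent p = (\<Sum>k\<le>N. Poly_Mapping.single (int k) (poly.coeff p k))"
  unfolding poly_to_laurent_def using assms
  by (intro sum.mono_neutral_left) (auto simp: coeff_eq_0)

lemma poly_to_laurent_add: "poly_to_laurent (p + q) = poly_to_laurent p + poly_to_laurent q"
  by (rule poly_mapping_eqI) (simp add: lookup_poly_to_laurent lookup_add)

lemma poly_to_laurent_smult:
  fixes q :: "'a::comm_ring_1 poly"
  shows "poly_to_laurent (Polynomial.smult a q) = Poly_Mapping.single 0 a * poly_to_laurent q"
  by (simp add: poly_to_laurent_eq_sum[of _ "Polynomial.degree q"] degree_smult_le
      sum_distrib_left mult_single)

lemma poly_to_laurent_pCons_0: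
  fixes q :: "'a::comm_ring_1 poly"
  shows "poly_to_laurent (pCons 0 q) = Poly_Mapping.single 1 1 * poly_to_laurent q"
proof -
  have "poly_to_laurent (pCons 0 q)
      = (\<Sum>k\<le>Suc (Polynomial.degree q). Poly_Mapping.single (int k) (poly.coeff (pCons 0 q) k))"
    by (rule poly_to_laurent_eq_sum) (rule degree_pCons_le)
  also have "\<dots> = (\<Sum>k\<le>Polynomial.degree q. Poly_Mapping.single (1 + int k) (poly.coeff q k))"
    by (subst sum.atMost_Suc_shift) simp
  finally show ?thesis by (simp add: poly_to_laurent_def sum_distrib_left mult_single)
qed

lemma poly_to_laurent_mult:
  fixes p q :: "'a::comm_ring_1 poly"
  shows "poly_to_laurent (p * q) = poly_to_laurent p * poly_to_laurent q"
proof (induction p)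
  case 0
  have "poly_to_laurent (0 :: 'a poly) = 0" by (simp add: poly_to_laurent_def)
  then show ?case by simp
next
  case (pCons a p)
  have "pCons a p = Polynomial.smult a 1 + pCons 0 p" by simp
  then have "poly_to_laurent (pCons a p) = Poly_Mapping.single 0 a * poly_to_laurent 1
      + Poly_Mapping.single 1 1 * poly_to_laurent p"
    by (metis poly_to_laurent_add poly_to_laurent_smult poly_to_laurent_pCons_0)
  moreover have "poly_to_laurent (1 :: 'a poly) = 1"
    by (simp add: poly_to_laurent_def)
  moreover have "poly_to_laurent (pCons a p * q) = Poly_Mapping.single 0 a * poly_to_laurent q
      + Poly_Mapping.single 1 1 * poly_to_laurent (p * q)"
    by (simp add: poly_to_laurent_add poly_to_laurent_smult poly_to_laurent_pCons_0)
  ultimately show ?case using pCons.IH by (simp add: algebra_simps)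
qed

lemma ring_hom_poly_to_laurent: "ring_hom (poly_to_laurent :: 'a::comm_ring_1 poly \<Rightarrow> 'a laurent)"
proof
  show "poly_to_laurent (0 :: 'a poly) = 0" "poly_to_laurent (1 :: 'a poly) = 1"
    by (simp_all add: poly_to_laurent_def)
qed (simp_all only: poly_to_laurent_add poly_to_laurent_mult)

lemma laurent_eval_poly_to_laurent: "laurent_eval (poly_to_laurent p) = poly p 1"
  by (simp add: poly_to_laurent_def laurent_eval_sum poly_altdef)

lemma ring_hom_poly: "ring_hom (\<lambda>p :: 'a::comm_ring_1 poly. poly p a)"
  by unfold_locales auto

lemma ring_hom_int_mod2: "ring_hom int_mod2"
  by unfold_locales (auto simp: int_mod2_def)

lemma poly_mod2h_eq: "poly_mod2h p = int_mod2 (poly p 0)"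
  by (simp add: poly_mod2h_def int_mod2_def poly_0_coeff_0)

lemma ring_hom_poly_mod2h: "ring_hom poly_mod2h"
  by unfold_locales (auto simp: poly_mod2h_eq int_mod2_def)

lemma graded_ring_hom_int_mod2: "graded_ring_hom int_mod2 trivial_grading trivial_grading"
proof -
  interpret ring_hom int_mod2 by (rule ring_hom_int_mod2)
  show ?thesis by unfold_locales (auto simp: trivial_grading_def split: if_splits)
qed

lemma graded_ring_hom_poly_0:
  "graded_ring_hom (\<lambda>p :: int poly. poly p 0) poly_grading trivial_grading"
proof -
  interpret ring_hom "\<lambda>p :: int poly. poly p 0" by (rule ring_hom_poly)
  show ?thesis
    by unfold_locales (auto simp: trivial_grading_def poly_grading_def poly_0_coeff_0)
qed

lemma graded_ring_hom_poly_mod2h: "graded_ring_hom poly_mod2h poly_grading trivial_grading"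
proof -
  interpret ring_hom poly_mod2h by (rule ring_hom_poly_mod2h)
  show ?thesis
  proof unfold_locales
    fix a :: "int poly" and q :: int
    assume "a \<in> poly_grading q"
    then have "poly.coeff a 0 \<noteq> 0 \<Longrightarrow> q = 0" by (auto simp: poly_grading_def)
    then show "poly_mod2h a \<in> trivial_grading q"
      by (cases "poly.coeff a 0 = 0") (auto simp: trivial_grading_def poly_mod2h_def)
  qed
qed

lemma graded_ring_hom_poly_to_laurent:
  "graded_ring_hom (poly_to_laurent :: 'a::comm_ring_1 poly \<Rightarrow> _) poly_grading laurent_grading"
proof -
  interpret ring_hom "poly_to_laurent :: 'a poly \<Rightarrow> _" by (rule ring_hom_poly_to_laurent)
  show ?thesis
    by unfold_locales
      (auto simp: laurent_grading_def poly_grading_def lookup_poly_to_laurent split: if_splits)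
qed

lemma graded_ring_hom_laurent_eval:
  "graded_ring_hom (laurent_eval :: int laurent \<Rightarrow> int) laurent_grading parity_grading"
proof -
  interpret ring_hom "laurent_eval :: int laurent \<Rightarrow> int" by (rule ring_hom_laurent_eval)
  show ?thesis
  proof unfold_locales
    fix a :: "int laurent" and q :: int
    assume "a \<in> laurent_grading q"
    then have "k \<notin> Poly_Mapping.keys a" if "odd q" for k
      using that by (auto simp: laurent_grading_def in_keys_iff)
    then show "laurent_eval a \<in> parity_grading q"
      by (auto simp: mem_parity_grading_iff laurent_eval_def intro!: sum.neutral)
  qed
qed

text \<open>Setting \<open>h = 1\<close> loses no information about a graded matrix, because the power of \<open>h\<close> in an entry is
  determined by the degrees of the two generators. The homotopy theory of \<open>h\<inverse>D\<close> thus becomes that of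
  an integral complex whose quantum degree is remembered modulo 2, and the quantum degrees of
  the generators are kept as a filtration.\<close>

abbreviation collapse :: "int poly cplx \<Rightarrow> int cplx" where
  "collapse \<equiv> base_change (\<lambda>p. poly p 1)"

lemma base_change_laurent_eval_localize: "base_change laurent_eval (localize D) = collapse D"
  by (simp add: base_change_base_change laurent_eval_poly_to_laurent)

lemma is_cplx_localize: "is_cplx poly_grading D \<Longrightarrow> is_cplx laurent_grading (localize D)"
  by (rule graded_ring_hom.is_cplx_base_change[OF graded_ring_hom_poly_to_laurent])

lemma is_cplx_collapse:
  assumes "is_cplx poly_grading D" shows "is_cplx parity_grading (collapse D)"
  using graded_ring_hom.is_cplx_base_change[OF graded_ring_hom_laurent_eval is_cplx_localize[OF assms]]
  by (simp add: base_change_laurent_eval_localize)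

lemma is_cplx_rank_one: "is_cplx G (rank_one b)"
  by (simp add: is_cplx_def graded_map_def)

lemma collapse_tensor:
  assumes "is_cplx poly_grading D" "is_cplx poly_grading D'"
  shows "collapse (tensor D D') = tensor (collapse D) (collapse D')"
  using assms[THEN is_cplxD(2)] by (intro base_change_tensor ring_hom_poly)

lemma homotopy_equivalence_collapse:
  assumes "homotopy_equivalence laurent_grading (localize D) E \<phi>"
    and "is_cplx poly_grading D" "is_cplx laurent_grading E"
  shows "homotopy_equivalence parity_grading (collapse D) (base_change laurent_eval E)
    (map_mat laurent_eval \<phi>)"
  using graded_ring_hom.homotopy_equivalence_base_change[OF graded_ring_hom_laurent_eval assms(1)]
    is_cplx_localize[OF assms(2)] assms(3) by (simp add: base_change_laurent_eval_localize)


section \<open>Complexes whose cohomology is free of rank one\<close>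

text \<open>What the homotopy equivalence of \<open>h\<inverse>D\<close> with a free module of rank one amounts to at \<open>h = 1\<close>: the
  integral complex splits, up to homotopy, into a copy of \<open>\<int>\<close> in homological degree 0 and even
  quantum degree. The row \<open>\<phi>\<close> computes the cohomology class of a cocycle, and the column \<open>\<psi>\<close> is a
  generator. The data are integral, so they serve all fields at once.\<close>

locale split_cplx =
  fixes M :: "int cplx" and \<phi> \<psi> H :: "int mat"
  assumes cplx: "is_cplx parity_grading M"
    and graded_phi: "graded_map parity_grading (0, 0) M (rank_one (0, 0)) \<phi>"
    and graded_psi: "graded_map parity_grading (0, 0) (rank_one (0, 0)) M \<psi>"
    and graded_H: "graded_map parity_grading (- 1, 0) M M H"
    and phi_diff: "\<phi> * diff M = 0\<^sub>m 1 (rk M)"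
    and diff_psi: "diff M * \<psi> = 0\<^sub>m (rk M) 1"
    and phi_psi: "\<phi> * \<psi> = 1\<^sub>m 1"
    and psi_phi: "\<psi> * \<phi> - 1\<^sub>m (rk M) = diff M * H + H * diff M"
begin

lemma carriers:
  "diff M \<in> carrier_mat (rk M) (rk M)" "\<phi> \<in> carrier_mat 1 (rk M)"
  "\<psi> \<in> carrier_mat (rk M) 1" "H \<in> carrier_mat (rk M) (rk M)"
  using is_cplxD(2)[OF cplx] graded_map_carrier[OF graded_phi] graded_map_carrier[OF graded_psi]
    graded_map_carrier[OF graded_H] by auto

lemma phi_support:
  assumes "j < rk M" "\<phi> $$ (0, j) \<noteq> 0"
  shows "fst (gens M ! j) = 0" "even (snd (gens M ! j))"
  using graded_phi assms by (auto simp: graded_map_def mem_parity_grading_iff)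

lemma psi_support:
  assumes "j < rk M" "\<psi> $$ (j, 0) \<noteq> 0"
  shows "fst (gens M ! j) = 0" "even (snd (gens M ! j))"
  using graded_psi assms by (auto simp: graded_map_def mem_parity_grading_iff)

end

lemma diff_support:
  assumes "is_cplx parity_grading M" "i < rk M" "j < rk M" "diff M $$ (i, j) \<noteq> 0"
  shows "fst (gens M ! i) = fst (gens M ! j) + 1" "even (snd (gens M ! j)) = even (snd (gens M ! i))"
  using is_cplxD(1)[OF assms(1)] assms(2-) by (auto simp: graded_map_def mem_parity_grading_iff)

lemma split_cplx_of_homotopy_equivalence:
  assumes M: "is_cplx parity_grading M" and "even q"
    and h: "homotopy_equivalence parity_grading M (rank_one (0, q)) \<phi>"
  obtains \<psi> H where "split_cplx M \<phi> \<psi> H"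
proof -
  obtain \<psi> where \<phi>: "chain_map parity_grading M (rank_one (0, q)) \<phi>"
    and \<psi>: "chain_map parity_grading (rank_one (0, q)) M \<psi>"
    and 1: "homotopic parity_grading M M (\<psi> * \<phi>) (1\<^sub>m (rk M))"
    and 2: "homotopic parity_grading (rank_one (0, q)) (rank_one (0, q)) (\<phi> * \<psi>) (1\<^sub>m 1)"
    using h by (auto simp: homotopy_equivalence_def)
  obtain H where H: "graded_map parity_grading (- 1, 0) M M H"
    and eq: "\<psi> * \<phi> - 1\<^sub>m (rk M) = diff M * H + H * diff M"
    using 1 by (auto simp: homotopic_def)
  obtain K where K: "graded_map parity_grading (- 1, 0) (rank_one (0, q)) (rank_one (0, q)) K"
    and eqK: "\<phi> * \<psi> - 1\<^sub>m 1 = 0\<^sub>m 1 1 * K + K * 0\<^sub>m 1 1"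
    using 2 by (auto simp: homotopic_def)
  note c = chain_mapD(2)[OF \<phi>] chain_mapD(2)[OF \<psi>] is_cplxD(2)[OF M] graded_map_carrier[OF K]
  have d1: "\<phi> * diff M = 0\<^sub>m 1 1 * \<phi>" and d2: "diff M * \<psi> = \<psi> * 0\<^sub>m 1 1"
    using chain_mapD(3)[OF \<phi>] chain_mapD(3)[OF \<psi>] by simp_all
  \<comment> \<open>The target has zero differential, so homotopic endomorphisms of it are equal.\<close>
  have "\<phi> * \<psi> = (\<phi> * \<psi> - 1\<^sub>m 1) + 1\<^sub>m 1"
    using c by (auto intro!: eq_matI)
  also have "\<dots> = 1\<^sub>m 1"
    unfolding eqK using c by simp
  finally have pp: "\<phi> * \<psi> = 1\<^sub>m 1" .
  have "split_cplx M \<phi> \<psi> H"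
    using M H eq pp d1 d2 c chain_mapD(1)[OF \<phi>] chain_mapD(1)[OF \<psi>] \<open>even q\<close>
    by unfold_locales (auto simp: graded_map_def mem_parity_grading_iff)
  then show thesis by (rule that)
qed

lemma split_cplx_of_LEO:
  assumes "is_LEO (C, D, f)"
  obtains \<phi> \<psi> H where "split_cplx (collapse D) \<phi> \<psi> H"
proof -
  obtain q \<phi> where D: "is_cplx poly_grading D" and "even q"
    and h: "homotopy_equivalence laurent_grading (localize D) (rank_one (0, q)) \<phi>"
    using assms by (auto simp: is_LEO_def)
  have "homotopy_equivalence parity_grading (collapse D) (rank_one (0, q)) (map_mat laurent_eval \<phi>)"
    using homotopy_equivalence_collapse[OF h D is_cplx_rank_one]
    by (simp add: base_change_rank_one[OF ring_hom_laurent_eval])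
  with split_cplx_of_homotopy_equivalence[OF is_cplx_collapse[OF D] \<open>even q\<close>] that show thesis
    by blast
qed



section \<open>Certificates for the invariant\<close>

text \<open>The possible characteristics. Divisibility by \<open>p\<close> is vanishing in the prime field of
  characteristic \<open>p\<close>, also for \<open>p = 0\<close>, because \<open>0\<close> divides only \<open>0\<close>. So the rationals and the
  finite prime fields are treated by the same congruences between integers.\<close>

definition zero_or_prime :: "int \<Rightarrow> bool" where
  "zero_or_prime p \<longleftrightarrow> p = 0 \<or> normalization_semidom_class.prime p"

lemma zero_or_prime_not_dvd_one: "zero_or_prime p \<Longrightarrow> \<not> p dvd 1"
  by (auto simp: zero_or_prime_def not_prime_unit)

lemma zero_or_prime_dvd_mult_iff: "zero_or_prime p \<Longrightarrow> p dvd a * b \<longleftrightarrow> p dvd a \<or> p dvd b"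
  by (auto simp: zero_or_prime_def prime_dvd_mult_iff)

text \<open>Over the field of fractions of \<open>\<int>/p\<close> this is the Fredholm alternative: either some vector in the
  kernel of \<open>A\<close> is not annihilated by \<open>f\<close>, or \<open>f\<close> is a combination of the rows of \<open>A\<close>. Denominators
  are cleared: \<open>c\<close> is the common denominator of the coefficients. The proof eliminates one row at
  a time.\<close>

lemma fredholm_alternative:
  fixes A :: "'i \<Rightarrow> 'j \<Rightarrow> int"
  assumes p: "zero_or_prime p" and "finite R" "finite S"
  shows "(\<exists>z. (\<forall>i\<in>R. p dvd (\<Sum>j\<in>S. A i j * z j)) \<and> \<not> p dvd (\<Sum>j\<in>S. f j * z j)) \<or>
    (\<exists>\<mu> c. \<not> p dvd c \<and> (\<forall>j\<in>S. p dvd c * f j - (\<Sum>i\<in>R. \<mu> i * A i j)))"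
  (is "?sol R f \<or> ?dual R f")
  using \<open>finite R\<close>
proof (induction R arbitrary: f rule: finite_induct)
  case empty
  show ?case
  proof (cases "\<forall>j\<in>S. p dvd f j")
    case True
    then show ?thesis using zero_or_prime_not_dvd_one[OF p] 
      by (intro disjI2 exI[of _ "\<lambda>_. 0"] exI[of _ 1]) auto
  next
    case False
    then obtain k where k: "k \<in> S" "\<not> p dvd f k" by blast
    have "(\<Sum>j\<in>S. f j * (if j = k then 1 else 0)) = (\<Sum>j\<in>S. if j = k then f k else 0)"
      by (intro sum.cong) auto
    also have "\<dots> = f k" using k \<open>finite S\<close> by simp
    finally have "\<not> p dvd (\<Sum>j\<in>S. f j * (if j = k then 1 else 0))" using k by simp
    then show ?thesis by (intro disjI1 exI[of _ "\<lambda>j. if j = k then 1 else 0"]) simp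
  qed
next
  case (insert r R)
  define ev where "ev g z = (\<Sum>j\<in>S. g j * z j)" for g z :: "'j \<Rightarrow> int"
  have ev_lin: "ev g (\<lambda>j. b * z j - a * z' j) = b * ev g z - a * ev g z'" for g z z' a b
    by (simp add: ev_def sum_subtractf sum_distrib_left algebra_simps)
  have ev_lin': "ev (\<lambda>j. b * g j - a * g' j) z = b * ev g z - a * ev g' z" for g g' z a b
    by (simp add: ev_def sum_subtractf sum_distrib_left sum_distrib_right algebra_simps)
  have extend: "?dual (insert r R) f"
    if "\<not> p dvd c" "\<forall>j\<in>S. p dvd c * f j - (a * A r j + (\<Sum>i\<in>R. \<mu> i * A i j))" for c a \<mu>
  proof -
    have "(\<Sum>i\<in>insert r R. (\<mu>(r := a)) i * A i j) = a * A r j + (\<Sum>i\<in>R. \<mu> i * A i j)" for j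
      using insert.hyps by (auto intro!: sum.cong)
    with that show ?thesis by (intro exI[of _ "\<mu>(r := a)"] exI[of _ c]) simp
  qed
  show ?case
  proof (cases "?dual R (A r)")
    case True
    then obtain \<mu> c where c: "\<not> p dvd c" "\<forall>j\<in>S. p dvd c * A r j - (\<Sum>i\<in>R. \<mu> i * A i j)" by blast
    from insert.IH[of f] show ?thesis
    proof
      \<comment> \<open>Row \<open>r\<close> depends on the others, so it imposes no further condition.\<close>
      assume "?sol R f"
      then obtain z where z: "\<forall>i\<in>R. p dvd ev (A i) z" "\<not> p dvd ev f z" by (auto simp: ev_def)
      have "ev (\<lambda>j. c * A r j - (\<Sum>i\<in>R. \<mu> i * A i j)) z = c * ev (A r) z - (\<Sum>i\<in>R. \<mu> i * ev (A i) z)"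
      proof -
        have "(\<Sum>j\<in>S. (\<Sum>i\<in>R. \<mu> i * A i j) * z j) = (\<Sum>j\<in>S. \<Sum>i\<in>R. \<mu> i * (A i j * z j))"
          by (simp add: sum_distrib_right mult.assoc)
        also have "\<dots> = (\<Sum>i\<in>R. \<mu> i * ev (A i) z)"
          by (subst sum.swap) (simp add: ev_def sum_distrib_left)
        finally show ?thesis
          by (simp add: ev_def left_diff_distrib sum_subtractf sum_distrib_left mult.assoc)
      qed
      moreover have "p dvd ev (\<lambda>j. c * A r j - (\<Sum>i\<in>R. \<mu> i * A i j)) z"
        unfolding ev_def using c by (intro dvd_sum) auto
      moreover have "p dvd (\<Sum>i\<in>R. \<mu> i * ev (A i) z)" using z by (intro dvd_sum) auto
      ultimately have "p dvd c * ev (A r) z" by (metis dvd_add diff_add_cancel)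
      then have "p dvd ev (A r) z" using zero_or_prime_dvd_mult_iff[OF p] c by blast
      with z show ?thesis by (intro disjI1 exI[of _ z]) (auto simp: ev_def)
    next
      assume "?dual R f"
      then obtain \<mu> c where "\<not> p dvd c" "\<forall>j\<in>S. p dvd c * f j - (\<Sum>i\<in>R. \<mu> i * A i j)" by blast
      then show ?thesis using extend[of c 0 \<mu>] by simp
    qed
  next
    case False
    with insert.IH[of "A r"] obtain z where z: "\<forall>i\<in>R. p dvd ev (A i) z" "\<not> p dvd ev (A r) z"
      by (auto simp: ev_def)
    \<comment> \<open>Adding a multiple of row \<open>r\<close> to \<open>b f\<close> gives a functional that vanishes on \<open>z\<close>; the alternative
      for it and the remaining rows decides.\<close>
    define a b where "a = ev f z" and "b = ev (A r) z"
    from insert.IH[of "\<lambda>j. b * f j - a * A r j"] show ?thesis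
    proof
      assume "?sol R (\<lambda>j. b * f j - a * A r j)"
      then obtain w where w: "\<forall>i\<in>R. p dvd ev (A i) w"
        and nd: "\<not> p dvd ev (\<lambda>j. b * f j - a * A r j) w" by (auto simp: ev_def)
      \<comment> \<open>On this combination row \<open>r\<close> vanishes, and \<open>f\<close> takes the value of the modified functional on \<open>w\<close>.\<close>
      define v where "v = (\<lambda>j. b * w j - ev (A r) w * z j)"
      have "ev f v = b * ev f w - a * ev (A r) w"
        by (simp add: v_def ev_lin a_def)
      with nd have "\<not> p dvd ev f v" by (simp add: ev_lin')
      moreover have "ev (A r) v = 0" by (simp add: v_def ev_lin b_def)
      moreover have "\<forall>i\<in>R. p dvd ev (A i) v" using w z by (auto simp: v_def ev_lin)
      ultimately show ?thesis by (intro disjI1 exI[of _ v]) (auto simp: ev_def)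
    next
      assume "?dual R (\<lambda>j. b * f j - a * A r j)"
      then obtain \<mu> c where c: "\<not> p dvd c"
        "\<forall>j\<in>S. p dvd c * (b * f j - a * A r j) - (\<Sum>i\<in>R. \<mu> i * A i j)" by blast
      have "\<not> p dvd c * b" using c z zero_or_prime_dvd_mult_iff[OF p] by (auto simp: b_def)
      then show ?thesis using c extend[of "c * b" "c * a" \<mu>] by (simp add: algebra_simps)
    qed
  qed
qed

definition mod_zero :: "int \<Rightarrow> int mat \<Rightarrow> bool" where
  "mod_zero p A \<longleftrightarrow> (\<forall>i<dim_row A. \<forall>j<dim_col A. p dvd A $$ (i, j))"

lemma mod_zeroD: "mod_zero p A \<Longrightarrow> A \<in> carrier_mat n m \<Longrightarrow> i < n \<Longrightarrow> j < m \<Longrightarrow> p dvd A $$ (i, j)"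
  by (auto simp: mod_zero_def)

lemma mod_zero_zero [simp]: "mod_zero p (0\<^sub>m n m)"
  by (simp add: mod_zero_def)

lemma mod_zero_mult_left:
  assumes "mod_zero p A" "A \<in> carrier_mat a b" "B \<in> carrier_mat b c"
  shows "mod_zero p (A * B)"
  unfolding mod_zero_def
proof (intro allI impI)
  fix i j assume "i < dim_row (A * B)" "j < dim_col (A * B)"
  then have ij: "i < a" "j < c" using assms by auto
  show "p dvd (A * B) $$ (i, j)"
    unfolding mult_mat_entry[OF assms(2,3) ij]
    using ij by (intro dvd_sum dvd_mult2 mod_zeroD[OF assms(1,2)]) auto
qed

lemma mod_zero_mult_right:
  assumes "mod_zero p B" "A \<in> carrier_mat a b" "B \<in> carrier_mat b c"
  shows "mod_zero p (A * B)"
  unfolding mod_zero_def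
proof (intro allI impI)
  fix i j assume "i < dim_row (A * B)" "j < dim_col (A * B)"
  then have ij: "i < a" "j < c" using assms by auto
  show "p dvd (A * B) $$ (i, j)"
    unfolding mult_mat_entry[OF assms(2,3) ij]
    using ij by (intro dvd_sum dvd_mult mod_zeroD[OF assms(1,3)]) auto
qed

lemma mod_zero_add:
  assumes "mod_zero p A" "mod_zero p B" "A \<in> carrier_mat a b" "B \<in> carrier_mat a b"
  shows "mod_zero p (A + B)"
  using assms by (auto simp: mod_zero_def)

lemma mod_zero_kron:
  assumes "mod_zero p A \<or> mod_zero p B" "A \<in> carrier_mat a b" "B \<in> carrier_mat c d"
  shows "mod_zero p (kron A B)"
  unfolding mod_zero_def
proof (intro allI impI)
  fix i j assume "i < dim_row (kron A B)" "j < dim_col (kron A B)"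
  then have ij: "i < a * c" "j < b * d" using assms by (auto simp: kron_def)
  note less = div_mod_less[OF ij(1)] div_mod_less[OF ij(2)]
  from assms(1) show "p dvd kron A B $$ (i, j)"
    unfolding kron_entry[OF assms(2,3) ij]
    by (elim disjE) (blast intro: dvd_mult2 mod_zeroD[OF _ assms(2) less(1,3)],
        blast intro: dvd_mult mod_zeroD[OF _ assms(3) less(2,4)])
qed

text \<open>Integral vectors that are cocycles of homological degree 0 modulo \<open>p\<close>, supported in quantum
  filtration at least \<open>s\<close> and of the parity of \<open>s\<close>: these are, up to clearing denominators, the
  cocycles of \<open>D\<close> of quantum degree \<open>s\<close> over the prime field.\<close>

definition cocycle_mod :: "int \<Rightarrow> int cplx \<Rightarrow> int \<Rightarrow> int mat \<Rightarrow> bool" where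
  "cocycle_mod p M s z \<longleftrightarrow> z \<in> carrier_mat (rk M) 1 \<and>
     (\<forall>j<rk M. z $$ (j, 0) \<noteq> 0 \<longrightarrow>
        fst (gens M ! j) = 0 \<and> s \<le> snd (gens M ! j) \<and> even (snd (gens M ! j) - s)) \<and>
     mod_zero p (diff M * z)"

text \<open>Dually, functionals that kill coboundaries and the part of filtration greater than \<open>s\<close>, modulo \<open>p\<close>.\<close>

definition functional_mod :: "int \<Rightarrow> int cplx \<Rightarrow> int \<Rightarrow> int mat \<Rightarrow> bool" where
  "functional_mod p M s l \<longleftrightarrow> l \<in> carrier_mat 1 (rk M) \<and>
     (\<forall>j<rk M. \<not> p dvd l $$ (0, j) \<longrightarrow>
        fst (gens M ! j) = 0 \<and> snd (gens M ! j) \<le> s \<and> even (snd (gens M ! j) - s)) \<and>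
     mod_zero p (l * diff M)"

definition certificate :: "int \<Rightarrow> int cplx \<Rightarrow> int \<Rightarrow> bool" where
  "certificate p M s \<longleftrightarrow>
     (\<exists>z l. cocycle_mod p M s z \<and> functional_mod p M s l \<and> \<not> p dvd (l * z) $$ (0, 0))"

text \<open>A functional that vanishes above filtration \<open>s\<close> can only be nonzero on a vector that involves a
  generator of degree at most \<open>s\<close>.\<close>

lemma filtration_le:
  assumes z: "cocycle_mod p M q z" and l: "functional_mod p M s l" and nd: "\<not> p dvd (l * z) $$ (0, 0)"
  shows "q \<le> s"
proof -
  have "(l * z) $$ (0, 0) = (\<Sum>j<rk M. l $$ (0, j) * z $$ (j, 0))"
    using z l by (intro mult_mat_entry) (auto simp: cocycle_mod_def functional_mod_def)
  with nd have "\<not> (\<forall>j\<in>{..<rk M}. p dvd l $$ (0, j) * z $$ (j, 0))"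
    using dvd_sum[of "{..<rk M}" p "\<lambda>j. l $$ (0, j) * z $$ (j, 0)"] by metis
  then obtain j where j: "j < rk M" "\<not> p dvd l $$ (0, j)" "z $$ (j, 0) \<noteq> 0" by force
  then have "q \<le> snd (gens M ! j)" using z by (auto simp: cocycle_mod_def)
  also have "\<dots> \<le> s" using j l by (auto simp: functional_mod_def)
  finally show ?thesis .
qed

lemma minus_11_entry:
  fixes A B :: "int mat"
  assumes "A \<in> carrier_mat 1 1" "B \<in> carrier_mat 1 1"
  shows "(A - B) $$ (0, 0) = A $$ (0, 0) - B $$ (0, 0)"
  using assms by simp

lemma mult_11_entry:
  fixes A B :: "int mat"
  assumes "A \<in> carrier_mat 1 1" "B \<in> carrier_mat 1 1"
  shows "(A * B) $$ (0, 0) = A $$ (0, 0) * B $$ (0, 0)"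
  using mult_mat_entry[OF assms, of 0 0] by simp

lemma homotopy_apply:
  fixes A :: "'r::comm_ring_1 mat"
  assumes "A \<in> carrier_mat n n" "d \<in> carrier_mat n n" "H \<in> carrier_mat n n" "z \<in> carrier_mat n 1"
    and "A - 1\<^sub>m n = d * H + H * d"
  shows "A * z - z = d * (H * z) + H * (d * z)"
proof -
  have "A * z - z = (A - 1\<^sub>m n) * z"
    using minus_mult_distrib_mat[OF assms(1) one_carrier_mat assms(4)] assms(4) by simp
  then show ?thesis
    using assms add_mult_distrib_mat[of "d * H" n n "H * d" z 1]
      assoc_mult_mat[OF assms(2,3,4)] assoc_mult_mat[OF assms(3,2,4)] by simp
qed

context split_cplx
begin

lemma homotopy_on_vector:
  assumes "z \<in> carrier_mat (rk M) 1"
  shows "\<psi> * (\<phi> * z) - z = diff M * (H * z) + H * (diff M * z)"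
  using homotopy_apply[OF mult_carrier_mat[OF carriers(3,2)] carriers(1,4) assms psi_phi]
    assoc_mult_mat[OF carriers(3,2) assms] by simp

text \<open>Cohomology in degree 0 has rank one, so on cocycles every functional that kills coboundaries is the
  multiple \<open>(l \<psi>) \<phi>\<close> of \<open>\<phi>\<close>: apply \<open>l\<close> and \<open>z\<close> to \<open>\<psi>\<phi> - 1 = dH + Hd\<close>. Hence it is nonzero on a cocycle
  exactly if it is nonzero on the generator and the cocycle represents a nonzero class.\<close>

lemma functional_on_cocycle:
  assumes p: "zero_or_prime p"
    and l: "l \<in> carrier_mat 1 (rk M)" "mod_zero p (l * diff M)"
    and z: "z \<in> carrier_mat (rk M) 1" "mod_zero p (diff M * z)"
  shows "p dvd (l * z) $$ (0, 0) \<longleftrightarrow> p dvd (l * \<psi>) $$ (0, 0) \<or> p dvd (\<phi> * z) $$ (0, 0)"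
proof -
  let ?n = "rk M"
  note c = carriers
  define E where "E = l * (\<psi> * (\<phi> * z) - z)"
  have lz: "l * z \<in> carrier_mat 1 1" "l * \<psi> \<in> carrier_mat 1 1" "\<phi> * z \<in> carrier_mat 1 1"
    using c l z by auto
  have "E = (l * \<psi>) * (\<phi> * z) - l * z"
    unfolding E_def
    using mult_minus_distrib_mat[OF l(1), of "\<psi> * (\<phi> * z)" 1 z]
      assoc_mult_mat[OF l(1) c(3) lz(3)] c z by simp
  then have e1: "E $$ (0, 0) = (l * \<psi>) $$ (0, 0) * (\<phi> * z) $$ (0, 0) - (l * z) $$ (0, 0)"
    using minus_11_entry[OF mult_carrier_mat[OF lz(2,3)] lz(1)] mult_11_entry[OF lz(2,3)] by simp
  have "E = l * (diff M * (H * z) + H * (diff M * z))"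
    unfolding E_def homotopy_on_vector[OF z(1)] ..
  also have "\<dots> = (l * diff M) * (H * z) + (l * H) * (diff M * z)"
    using mult_add_distrib_mat[OF l(1), of "diff M * (H * z)" 1 "H * (diff M * z)"]
      assoc_mult_mat[OF l(1) c(1), of "H * z" 1] assoc_mult_mat[OF l(1) c(4), of "diff M * z" 1]
      c z by simp
  also have "mod_zero p \<dots>"
  proof (rule mod_zero_add)
    show "mod_zero p ((l * diff M) * (H * z))"
      by (rule mod_zero_mult_left[of p _ 1 ?n _ 1]) (use l z c in auto)
    show "mod_zero p ((l * H) * (diff M * z))"
      by (rule mod_zero_mult_right[of p _ _ 1 ?n 1]) (use l z c in auto)
    show "(l * diff M) * (H * z) \<in> carrier_mat 1 1" "(l * H) * (diff M * z) \<in> carrier_mat 1 1"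
      using l z c by auto
  qed
  finally have "mod_zero p E" .
  moreover have "E \<in> carrier_mat 1 1"
    unfolding E_def
    by (rule mult_carrier_mat[OF l(1) minus_carrier_mat[OF z(1)]])
  ultimately have "p dvd E $$ (0, 0)" by (auto simp: mod_zero_def)
  then have "p dvd (l * z) $$ (0, 0) \<longleftrightarrow> p dvd (l * \<psi>) $$ (0, 0) * (\<phi> * z) $$ (0, 0)"
    using e1 dvd_add_right_iff[of p "E $$ (0, 0)" "(l * z) $$ (0, 0)"] by simp
  then show ?thesis using zero_or_prime_dvd_mult_iff[OF p] by blast
qed

end



lemma cocycle_modD:
  assumes "cocycle_mod p M s z"
  shows "z \<in> carrier_mat (rk M) 1" "mod_zero p (diff M * z)"
  using assms by (auto simp: cocycle_mod_def)

lemma functional_modD: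
  assumes "functional_mod p M s l"
  shows "l \<in> carrier_mat 1 (rk M)" "mod_zero p (l * diff M)"
  using assms by (auto simp: functional_mod_def)

context split_cplx
begin

text \<open>The vector \<open>z\<close> witnesses that some class of quantum degree \<open>s\<close> remains nonzero after inverting \<open>h\<close>.\<close>

definition detects :: "int \<Rightarrow> int \<Rightarrow> int mat \<Rightarrow> bool" where
  "detects p s z \<longleftrightarrow> cocycle_mod p M s z \<and> \<not> p dvd (\<phi> * z) $$ (0, 0)"

lemma detects_even:
  assumes "detects p s z" shows "even s"
proof -
  have z: "cocycle_mod p M s z" and "\<not> p dvd (\<phi> * z) $$ (0, 0)"
    using assms by (auto simp: detects_def)
  moreover have "(\<phi> * z) $$ (0, 0) = (\<Sum>j<rk M. \<phi> $$ (0, j) * z $$ (j, 0))"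
    using carriers(2) cocycle_modD(1)[OF z] by (intro mult_mat_entry) auto
  ultimately have "\<not> (\<forall>j\<in>{..<rk M}. p dvd \<phi> $$ (0, j) * z $$ (j, 0))"
    using dvd_sum[of "{..<rk M}" p "\<lambda>j. \<phi> $$ (0, j) * z $$ (j, 0)"] by metis
  then obtain j where j: "j < rk M" "\<phi> $$ (0, j) \<noteq> 0" "z $$ (j, 0) \<noteq> 0" by force
  then show ?thesis using z phi_support[OF j(1,2)] by (auto simp: cocycle_mod_def)
qed

text \<open>By \<open>functional_on_cocycle\<close>, both the cocycle and the functional of a certificate are nonzero on
  cohomology. Therefore the functional is nonzero on every cocycle that represents a nonzero class,
  which bounds the filtration of the latter by \<open>s\<close>.\<close>

lemma certificate_detects:
  assumes p: "zero_or_prime p" and "certificate p M s"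
  shows "\<exists>z. detects p s z" and "detects p q z \<Longrightarrow> q \<le> s"
proof -
  obtain z0 l where z0: "cocycle_mod p M s z0" and l: "functional_mod p M s l"
    and nd: "\<not> p dvd (l * z0) $$ (0, 0)"
    using assms(2) by (auto simp: certificate_def)
  have nd': "\<not> p dvd (l * \<psi>) $$ (0, 0)" "\<not> p dvd (\<phi> * z0) $$ (0, 0)"
    using functional_on_cocycle[OF p functional_modD[OF l] cocycle_modD[OF z0]] nd by simp_all
  then show "\<exists>z. detects p s z" using z0 unfolding detects_def by blast
  show "q \<le> s" if "detects p q z"
  proof (rule filtration_le[OF _ l])
    show "cocycle_mod p M q z" using that by (simp add: detects_def)
    then show "\<not> p dvd (l * z) $$ (0, 0)"
      using functional_on_cocycle[OF p functional_modD[OF l] cocycle_modD[of p M q z]] nd'(1) that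
      by (simp add: detects_def)
  qed
qed

text \<open>Let \<open>s\<close> be the largest filtration in which \<open>\<phi>\<close> is nonzero on some cocycle. On vectors of higher
  filtration \<open>\<phi>\<close> then vanishes on the kernel of \<open>d\<close>, so by the Fredholm alternative a multiple of \<open>\<phi>\<close>
  agrees there with a combination \<open>m d\<close> of the rows of \<open>d\<close>. The difference \<open>b \<phi> - m d\<close> vanishes in
  higher filtration, kills coboundaries because \<open>\<phi> d = 0\<close> and \<open>d\<^sup>2 = 0\<close>, and agrees with \<open>b \<phi>\<close> on
  cocycles.\<close>

lemma certificate_exists:
  assumes p: "zero_or_prime p"
  shows "\<exists>s. even s \<and> certificate p M s"
proof -
  let ?n = "rk M"
  note c = carriers
  \<comment> \<open>A bound for all quantum degrees; the interval from \<open>-2 B\<close> to \<open>B\<close> contains the maximum, and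
    \<open>-2 B\<close> has the parity of the support of \<open>\<psi>\<close>.\<close>
  define B where "B = (\<Sum>j<?n. \<bar>snd (gens M ! j)\<bar>)"
  have B: "\<bar>snd (gens M ! j)\<bar> \<le> B" if "j < ?n" for j
    unfolding B_def using that by (intro member_le_sum) auto
  have "0 \<le> B" unfolding B_def by (intro sum_nonneg) auto
  have nonempty: "detects p (- 2 * B) \<psi>"
    unfolding detects_def cocycle_mod_def
  proof (intro conjI allI impI)
    fix j assume j: "j < ?n" "\<psi> $$ (j, 0) \<noteq> 0"
    show "fst (gens M ! j) = 0" "even (snd (gens M ! j) - - 2 * B)"
      using psi_support[OF j] by auto
    show "- 2 * B \<le> snd (gens M ! j)" using B[OF j(1)] \<open>0 \<le> B\<close> by linarith
  qed (use c zero_or_prime_not_dvd_one[OF p] in \<open>auto simp: diff_psi phi_psi\<close>)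
  have bounded: "q \<le> B" if z: "detects p q z" for q z
  proof (rule ccontr)
    assume q: "\<not> q \<le> B"
    have z': "cocycle_mod p M q z" "\<not> p dvd (\<phi> * z) $$ (0, 0)"
      using z by (simp_all add: detects_def)
    have "z $$ (j, 0) = 0" if "j < ?n" for j
    proof (rule ccontr)
      assume "z $$ (j, 0) \<noteq> 0"
      then have "q \<le> snd (gens M ! j)" using z'(1) that by (simp add: cocycle_mod_def)
      then show False using B[OF that] q by linarith
    qed
    then have "z = 0\<^sub>m ?n 1" using cocycle_modD(1)[OF z'(1)] by (intro eq_matI) auto
    then show False using z'(2) c by simp
  qed
  define Q where "Q = {q \<in> {- 2 * B..B}. \<exists>z. detects p q z}"
  have "- 2 * B \<in> Q" 
    unfolding Q_def using nonempty \<open>0 \<le> B\<close> by (intro CollectI conjI exI[of _ \<psi>]) simp_all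
  moreover have "finite Q" by (rule finite_subset[of _ "{- 2 * B..B}"]) (auto simp: Q_def)
  ultimately have Q: "finite Q" "Q \<noteq> {}" by auto
  define s where "s = Max Q"
  have "s \<in> Q" unfolding s_def using Q by (rule Max_in)
  then obtain z0 where z0: "detects p s z0" by (auto simp: Q_def)
  have "even s" by (rule detects_even[OF z0])
  have maximal: "\<not> detects p (s + 2) z" for z
  proof
    assume z: "detects p (s + 2) z"
    have "- 2 * B \<le> s" using \<open>s \<in> Q\<close> by (simp add: Q_def)
    then have "s + 2 \<in> Q" unfolding Q_def using z bounded[OF z]
      by (intro CollectI conjI exI[of _ z]) simp_all
    then have "s + 2 \<le> s" unfolding s_def by (rule Max_ge[OF Q(1)])
    then show False by simp
  qed
  define S where "S = {j. j < ?n \<and> fst (gens M ! j) = 0 \<and> s < snd (gens M ! j) \<and> even (snd (gens M ! j))}"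
  define R where "R = {i. i < ?n \<and> fst (gens M ! i) = 1 \<and> even (snd (gens M ! i))}"
  have fin: "finite S" "finite R" by (auto simp: S_def R_def)
  consider (sol) z where "\<forall>i\<in>R. p dvd (\<Sum>j\<in>S. diff M $$ (i, j) * z j)"
      "\<not> p dvd (\<Sum>j\<in>S. \<phi> $$ (0, j) * z j)"
    | (dual) \<mu> b where "\<not> p dvd b"
      "\<forall>j\<in>S. p dvd b * \<phi> $$ (0, j) - (\<Sum>i\<in>R. \<mu> i * diff M $$ (i, j))"
    using fredholm_alternative[OF p fin(2,1), of "\<lambda>i j. diff M $$ (i, j)" "\<lambda>j. \<phi> $$ (0, j)"]
    by blast
  then show ?thesis
  proof cases
    case sol
    define Z where "Z = mat ?n 1 (\<lambda>(j, _). if j \<in> S then z j else 0)"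
    have Z: "Z \<in> carrier_mat ?n 1" by (simp add: Z_def)
    have entry: "(A * Z) $$ (i, 0) = (\<Sum>j\<in>S. A $$ (i, j) * z j)"
      if "A \<in> carrier_mat m ?n" "i < m" for A i m
    proof -
      have "(A * Z) $$ (i, 0) = (\<Sum>j<?n. A $$ (i, j) * Z $$ (j, 0))"
        using mult_mat_entry[OF that(1) Z that(2)] by simp
      also have "\<dots> = (\<Sum>j\<in>S. A $$ (i, j) * Z $$ (j, 0))"
        by (rule sum.mono_neutral_right) (auto simp: S_def Z_def)
      also have "\<dots> = (\<Sum>j\<in>S. A $$ (i, j) * z j)"
        by (rule sum.cong) (auto simp: S_def Z_def)
      finally show ?thesis .
    qed
    have "detects p (s + 2) Z"
      unfolding detects_def cocycle_mod_def
    proof (intro conjI allI impI Z)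
      fix j assume j: "j < ?n" "Z $$ (j, 0) \<noteq> 0"
      then have "j \<in> S" by (auto simp: Z_def split: if_splits)
      then show "fst (gens M ! j) = 0" "even (snd (gens M ! j) - (s + 2))"
        "s + 2 \<le> snd (gens M ! j)"
        using \<open>even s\<close> by (auto simp: S_def) presburger
    next
      show "mod_zero p (diff M * Z)"
        unfolding mod_zero_def
      proof (intro allI impI)
        fix i k assume "i < dim_row (diff M * Z)" "k < dim_col (diff M * Z)"
        then have i: "i < ?n" and k: "k = 0" using c Z by auto
        have "p dvd (\<Sum>j\<in>S. diff M $$ (i, j) * z j)"
        proof (cases "i \<in> R")
          case False
          have "diff M $$ (i, j) = 0" if "j \<in> S" for j
          proof (rule ccontr)
            assume nz: "diff M $$ (i, j) \<noteq> 0"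
            have j: "j < ?n" "fst (gens M ! j) = 0" "even (snd (gens M ! j))"
              using that by (simp_all add: S_def)
            then have "i \<in> R" using diff_support[OF cplx i j(1) nz] i by (simp add: R_def)
            with False show False by simp
          qed
          then show ?thesis by simp
        qed (use sol in auto)
        then show "p dvd (diff M * Z) $$ (i, k)" using entry[OF c(1) i] k by simp
      qed
      show "\<not> p dvd (\<phi> * Z) $$ (0, 0)" using entry[OF c(2), of 0] sol by simp
    qed
    with maximal show ?thesis by blast
  next
    case dual
    define m where "m = mat 1 ?n (\<lambda>(_, i). if i \<in> R then \<mu> i else 0)"
    define l where "l = b \<cdot>\<^sub>m \<phi> - m * diff M"
    have m: "m \<in> carrier_mat 1 ?n" by (simp add: m_def)
    have md: "m * diff M \<in> carrier_mat 1 ?n" using m c by simp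
    have l: "l \<in> carrier_mat 1 ?n" unfolding l_def using c m by auto
    have entry: "l $$ (0, j) = b * \<phi> $$ (0, j) - (\<Sum>i\<in>R. \<mu> i * diff M $$ (i, j))" if "j < ?n" for j
    proof -
      have "(m * diff M) $$ (0, j) = (\<Sum>i<?n. m $$ (0, i) * diff M $$ (i, j))"
        using mult_mat_entry[OF m c(1) _ that] by simp
      also have "\<dots> = (\<Sum>i\<in>R. m $$ (0, i) * diff M $$ (i, j))"
        by (rule sum.mono_neutral_right) (auto simp: R_def m_def)
      also have "\<dots> = (\<Sum>i\<in>R. \<mu> i * diff M $$ (i, j))"
        by (rule sum.cong) (auto simp: R_def m_def)
      finally show ?thesis using that c m by (simp add: l_def)
    qed
    have "functional_mod p M s l"
      unfolding functional_mod_def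
    proof (intro conjI allI impI l)
      fix j assume j: "j < ?n" "\<not> p dvd l $$ (0, j)"
      from j(2) have "\<phi> $$ (0, j) \<noteq> 0 \<or> (\<exists>i\<in>R. diff M $$ (i, j) \<noteq> 0)"
        by (rule contrapos_np) (simp add: entry[OF j(1)])
      then have *: "fst (gens M ! j) = 0 \<and> even (snd (gens M ! j))"
      proof
        assume "\<phi> $$ (0, j) \<noteq> 0"
        then show ?thesis using phi_support[OF j(1)] by simp
      next
        assume "\<exists>i\<in>R. diff M $$ (i, j) \<noteq> 0"
        then obtain i where "i \<in> R" "diff M $$ (i, j) \<noteq> 0" by blast
        then show ?thesis using diff_support[OF cplx _ j(1)] by (auto simp: R_def)
      qed
      have "j \<notin> S" using dual j entry[OF j(1)] by auto
      with * j show "snd (gens M ! j) \<le> s" by (auto simp: S_def)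
      from * show "fst (gens M ! j) = 0" "even (snd (gens M ! j) - s)" using \<open>even s\<close> by auto
    next
      have "l * diff M = b \<cdot>\<^sub>m \<phi> * diff M - m * diff M * diff M"
        unfolding l_def using c md by (intro minus_mult_distrib_mat) auto
      also have "m * diff M * diff M = 0\<^sub>m 1 ?n"
        using assoc_mult_mat[OF m c(1) c(1)] is_cplxD(3)[OF cplx] m by simp
      also have "b \<cdot>\<^sub>m \<phi> * diff M = 0\<^sub>m 1 ?n"
        using mult_smult_assoc_mat[OF c(2) c(1)] phi_diff by simp
      finally have "l * diff M = 0\<^sub>m 1 ?n" by simp
      then show "mod_zero p (l * diff M)" by simp
    qed
    moreover have "\<not> p dvd (l * z0) $$ (0, 0)"
    proof -
      have z: "z0 \<in> carrier_mat ?n 1" "mod_zero p (diff M * z0)"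
        using z0 cocycle_modD by (auto simp: detects_def)
      have f: "\<phi> * z0 \<in> carrier_mat 1 1" "m * (diff M * z0) \<in> carrier_mat 1 1"
        using c m z by auto
      have "l * z0 = b \<cdot>\<^sub>m (\<phi> * z0) - m * (diff M * z0)"
        unfolding l_def
        using minus_mult_distrib_mat[OF smult_carrier_mat[OF c(2)] md z(1)]
          mult_smult_assoc_mat[OF c(2) z(1)] assoc_mult_mat[OF m c(1) z(1)] by simp
      then have "(l * z0) $$ (0, 0) = (b \<cdot>\<^sub>m (\<phi> * z0)) $$ (0, 0) - (m * (diff M * z0)) $$ (0, 0)"
        using minus_11_entry[OF smult_carrier_mat[OF f(1)] f(2)] by simp
      also have "(b \<cdot>\<^sub>m (\<phi> * z0)) $$ (0, 0) = b * (\<phi> * z0) $$ (0, 0)"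
        using f(1) by (intro index_smult_mat(1)) auto
      finally have e: "(l * z0) $$ (0, 0) = b * (\<phi> * z0) $$ (0, 0) - (m * (diff M * z0)) $$ (0, 0)" .
      have "mod_zero p (m * (diff M * z0))"
        by (rule mod_zero_mult_right[OF z(2) m]) (use c z in auto)
      then have d: "p dvd (m * (diff M * z0)) $$ (0, 0)" by (rule mod_zeroD[OF _ f(2)]) auto
      have "\<not> p dvd b * (\<phi> * z0) $$ (0, 0)"
        using dual z0 zero_or_prime_dvd_mult_iff[OF p] by (auto simp: detects_def)
      then show ?thesis
        unfolding e using dvd_add[OF _ d, of "b * (\<phi> * z0) $$ (0, 0) - (m * (diff M * z0)) $$ (0, 0)"]
        by auto
    qed
    ultimately have "certificate p M s"
      using z0 by (auto simp: certificate_def detects_def)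
    with \<open>even s\<close> show ?thesis by blast
  qed
qed

end

text \<open>Both filtrations add up under tensor products. For the functional: if the degrees of two generators
  sum to more than \<open>s + t\<close>, one of them is too large for its factor.\<close>

lemma certificate_tensor:
  assumes p: "zero_or_prime p"
    and M: "is_cplx parity_grading M" and N: "is_cplx parity_grading N"
    and "certificate p M s" "certificate p N t"
  shows "certificate p (tensor M N) (s + t)"
proof -
  obtain z l where z: "cocycle_mod p M s z" and l: "functional_mod p M s l"
    and lz: "\<not> p dvd (l * z) $$ (0, 0)" using assms by (auto simp: certificate_def)
  obtain z' l' where z': "cocycle_mod p N t z'" and l': "functional_mod p N t l'"
    and lz': "\<not> p dvd (l' * z') $$ (0, 0)" using assms by (auto simp: certificate_def)
  define m n where "m = rk M" and "n = rk N"
  have c: "z \<in> carrier_mat m 1" "l \<in> carrier_mat 1 m" "z' \<in> carrier_mat n 1" "l' \<in> carrier_mat 1 n"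
    "diff M \<in> carrier_mat m m" "diff N \<in> carrier_mat n n" "sign_mat M \<in> carrier_mat m m"
    using cocycle_modD(1)[OF z] cocycle_modD(1)[OF z'] functional_modD(1)[OF l]
      functional_modD(1)[OF l'] is_cplxD(2)[OF M] is_cplxD(2)[OF N]
    by (auto simp: m_def n_def)
  have kc: "kron (diff M) (1\<^sub>m n) \<in> carrier_mat (m * n) (m * n)"
    "kron (sign_mat M) (diff N) \<in> carrier_mat (m * n) (m * n)"
    "kron z z' \<in> carrier_mat (m * n) 1" "kron l l' \<in> carrier_mat 1 (m * n)"
    using c kron_carrier[OF c(1) c(3)] kron_carrier[OF c(2) c(4)] by simp_all
  have "cocycle_mod p (tensor M N) (s + t) (kron z z')"
    unfolding cocycle_mod_def rk_tensor m_def[symmetric] n_def[symmetric]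
  proof (intro conjI allI impI kc(3))
    fix j assume j: "j < m * n" and nz: "kron z z' $$ (j, 0) \<noteq> 0"
    note less = div_mod_less[OF j]
    have "kron z z' $$ (j, 0) = z $$ (j div n, 0) * z' $$ (j mod n, 0)"
      using kron_entry[OF c(1) c(3) j, of 0] by simp
    with nz have "z $$ (j div n, 0) \<noteq> 0" "z' $$ (j mod n, 0) \<noteq> 0" by auto
    then have "fst (gens M ! (j div n)) = 0 \<and> s \<le> snd (gens M ! (j div n))
        \<and> even (snd (gens M ! (j div n)) - s)"
      "fst (gens N ! (j mod n)) = 0 \<and> t \<le> snd (gens N ! (j mod n))
        \<and> even (snd (gens N ! (j mod n)) - t)"
      using z z' less by (auto simp: cocycle_mod_def m_def n_def)
    then show "fst (gens (tensor M N) ! j) = 0" "s + t \<le> snd (gens (tensor M N) ! j)"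
      "even (snd (gens (tensor M N) ! j) - (s + t))"
      using j by (auto simp: gens_tensor_nth m_def n_def)
  next
    have "diff (tensor M N) * kron z z'
        = kron (diff M) (1\<^sub>m n) * kron z z' + kron (sign_mat M) (diff N) * kron z z'"
      unfolding diff_tensor n_def[symmetric] by (rule add_mult_distrib_mat[OF kc(1,2,3)])
    also have "\<dots> = kron (diff M * z) z' + kron (sign_mat M * z) (diff N * z')"
      using c kron_mult[OF c(5) c(1) one_carrier_mat c(3)] kron_mult[OF c(7) c(1) c(6) c(3)]
      by simp
    also have "mod_zero p \<dots>"
    proof (rule mod_zero_add[of p _ _ "m * n" "1 * 1"])
      show "mod_zero p (kron (diff M * z) z')"
        by (rule mod_zero_kron[of p _ _ m 1 n 1]) (use c cocycle_modD[OF z] in auto)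
      show "mod_zero p (kron (sign_mat M * z) (diff N * z'))"
        by (rule mod_zero_kron[of p _ _ m 1 n 1]) (use c cocycle_modD[OF z'] in auto)
      show "kron (diff M * z) z' \<in> carrier_mat (m * n) (1 * 1)"
        "kron (sign_mat M * z) (diff N * z') \<in> carrier_mat (m * n) (1 * 1)"
        by (rule kron_carrier; use c in simp)+
    qed
    finally show "mod_zero p (diff (tensor M N) * kron z z')" .
  qed
  moreover have "functional_mod p (tensor M N) (s + t) (kron l l')"
    unfolding functional_mod_def rk_tensor m_def[symmetric] n_def[symmetric]
  proof (intro conjI allI impI kc(4))
    fix j assume j: "j < m * n" and nz: "\<not> p dvd kron l l' $$ (0, j)"
    note less = div_mod_less[OF j]
    have "kron l l' $$ (0, j) = l $$ (0, j div n) * l' $$ (0, j mod n)"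
      using kron_entry[OF c(2) c(4), of 0 j] j by simp
    with nz have "\<not> p dvd l $$ (0, j div n)" "\<not> p dvd l' $$ (0, j mod n)" by auto
    then have "fst (gens M ! (j div n)) = 0 \<and> snd (gens M ! (j div n)) \<le> s
        \<and> even (snd (gens M ! (j div n)) - s)"
      "fst (gens N ! (j mod n)) = 0 \<and> snd (gens N ! (j mod n)) \<le> t
        \<and> even (snd (gens N ! (j mod n)) - t)"
      using l l' less by (auto simp: functional_mod_def m_def n_def)
    then show "fst (gens (tensor M N) ! j) = 0" "snd (gens (tensor M N) ! j) \<le> s + t"
      "even (snd (gens (tensor M N) ! j) - (s + t))"
      using j by (auto simp: gens_tensor_nth m_def n_def)
  next
    have "kron l l' * diff (tensor M N)
        = kron l l' * kron (diff M) (1\<^sub>m n) + kron l l' * kron (sign_mat M) (diff N)"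
      unfolding diff_tensor n_def[symmetric] by (rule mult_add_distrib_mat[OF kc(4,1,2)])
    also have "\<dots> = kron (l * diff M) l' + kron (l * sign_mat M) (l' * diff N)"
      using c kron_mult[OF c(2) c(5) c(4) one_carrier_mat] kron_mult[OF c(2) c(7) c(4) c(6)]
      by simp
    also have "mod_zero p \<dots>"
    proof (rule mod_zero_add[of p _ _ "1 * 1" "m * n"])
      show "mod_zero p (kron (l * diff M) l')"
        by (rule mod_zero_kron[of p _ _ 1 m 1 n]) (use c functional_modD[OF l] in auto)
      show "mod_zero p (kron (l * sign_mat M) (l' * diff N))"
        by (rule mod_zero_kron[of p _ _ 1 m 1 n]) (use c functional_modD[OF l'] in auto)
      show "kron (l * diff M) l' \<in> carrier_mat (1 * 1) (m * n)"
        "kron (l * sign_mat M) (l' * diff N) \<in> carrier_mat (1 * 1) (m * n)"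
        by (rule kron_carrier; use c in simp)+
    qed
    finally show "mod_zero p (kron l l' * diff (tensor M N))" .
  qed
  moreover have "\<not> p dvd (kron l l' * kron z z') $$ (0, 0)"
  proof -
    have "(kron l l' * kron z z') $$ (0, 0) = (l * z) $$ (0, 0) * (l' * z') $$ (0, 0)"
      unfolding kron_mult[OF c(2) c(1) c(4) c(3)]
      using kron_entry[OF mult_carrier_mat[OF c(2) c(1)] mult_carrier_mat[OF c(4) c(3)], of 0 0]
      by simp
    then show ?thesis using lz lz' zero_or_prime_dvd_mult_iff[OF p] by simp
  qed
  ultimately show ?thesis by (auto simp: certificate_def)
qed

text \<open>An integral certificate reduces modulo \<open>p\<close>; its last condition survives unless \<open>p\<close> divides the integer
  \<open>l z\<close>, which serves as \<open>N\<close>.\<close>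

lemma certificate_zero_imp_finite_exceptions:
  assumes "certificate 0 M s"
  shows "\<exists>N. N \<noteq> 0 \<and> (\<forall>p. \<not> p dvd N \<longrightarrow> certificate p M s)"
proof -
  obtain z l where z: "cocycle_mod 0 M s z" and l: "functional_mod 0 M s l"
    and lz: "(l * z) $$ (0, 0) \<noteq> 0" using assms by (auto simp: certificate_def)
  have "cocycle_mod p M s z" for p
    using z by (auto simp: cocycle_mod_def mod_zero_def)
  moreover have "functional_mod p M s l" for p
    using l by (auto simp: functional_mod_def mod_zero_def)
  ultimately show ?thesis
    using lz by (auto simp: certificate_def intro!: exI[of _ "(l * z) $$ (0, 0)"])
qed



section \<open>Prime fields\<close>

text \<open>The two properties by which a prime field is accessible to integral vectors: its elements are
  fractions of multiples of the unit, and such a multiple vanishes exactly if \<open>p\<close> divides it. Only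
  multiples by integers enter the definition of the differential on cochains.\<close>

locale prime_field = field F for F :: "'a ring" (structure) +
  fixes p :: int
  assumes zero_or_prime: "zero_or_prime p"
    and int_eq_zero_iff: "add_pow F (n :: int) \<one> = \<zero> \<longleftrightarrow> p dvd n"
    and fraction: "x \<in> carrier F \<Longrightarrow> \<exists>N n :: int. \<not> p dvd N \<and> add_pow F N x = add_pow F n \<one>"
begin

abbreviation smul :: "int \<Rightarrow> 'a \<Rightarrow> 'a" where "smul \<equiv> add_pow F"

abbreviation emb :: "int \<Rightarrow> 'a" where "emb n \<equiv> smul n \<one>"

lemma smul_closed [simp, intro]: "x \<in> carrier F \<Longrightarrow> smul n x \<in> carrier F"
  by (rule add.int_pow_closed)

lemma smul_smul: "x \<in> carrier F \<Longrightarrow> smul m (smul n x) = smul (m * n) x"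
  using add.int_pow_pow[of x m n] by (simp add: mult.commute)

lemma smul_add_left: "x \<in> carrier F \<Longrightarrow> smul (m + n) x = smul m x \<oplus> smul n x"
  by (rule add.int_pow_mult)

lemma smul_add_right:
  "x \<in> carrier F \<Longrightarrow> y \<in> carrier F \<Longrightarrow> smul m (x \<oplus> y) = smul m x \<oplus> smul m y"
  by (rule add.int_pow_distrib)

lemma smul_zero [simp]: "smul m \<zero> = \<zero>"
  by (rule add.int_pow_one)

lemma zero_smul [simp]: "smul 0 x = \<zero>"
  by (simp add: add_pow_def)

lemma smul_eq_mult: "x \<in> carrier F \<Longrightarrow> smul m x = emb m \<otimes> x"
  using add_pow_ldistr_int[OF one_closed, of x m] by simp

lemma emb_eq_iff: "emb m = emb n \<longleftrightarrow> p dvd m - n"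
proof -
  have "emb m = emb (m - n) \<oplus> emb n" using smul_add_left[OF one_closed, of "m - n" n] by simp
  then have "emb m = emb n \<longleftrightarrow> emb (m - n) = \<zero>"
    using add.r_cancel_one[of "emb n" "emb (m - n)"] by auto
  then show ?thesis by (simp add: int_eq_zero_iff)
qed

lemma smul_cancel:
  assumes "\<not> p dvd N" "x \<in> carrier F" "y \<in> carrier F" "smul N x = smul N y"
  shows "x = y"
  using assms m_lcancel[of "emb N" x y] int_eq_zero_iff[of N]
  unfolding smul_eq_mult[OF assms(2), of N] smul_eq_mult[OF assms(3), of N] by simp

lemma smul_inverse:
  assumes "\<not> p dvd N" shows "\<exists>y\<in>carrier F. smul N y = \<one>"
proof -
  have "emb N \<in> Units F" using assms int_eq_zero_iff[of N] field_Units by simp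
  then have "inv (emb N) \<in> carrier F" "emb N \<otimes> inv (emb N) = \<one>" by simp_all
  then show ?thesis using smul_eq_mult[of "inv (emb N)" N] by (intro bexI[of _ "inv (emb N)"]) simp_all
qed

lemma common_denominator:
  assumes "finite S" "v \<in> S \<rightarrow> carrier F"
  shows "\<exists>N n. \<not> p dvd N \<and> (\<forall>b\<in>S. smul N (v b) = emb (n b))"
  using assms
proof (induction S rule: finite_induct)
  case empty
  show ?case using zero_or_prime_not_dvd_one[OF zero_or_prime] by (intro exI[of _ "1 :: int"]) simp
next
  case (insert a S)
  then obtain N n where N: "\<not> p dvd N" and n: "\<forall>b\<in>S. smul N (v b) = emb (n b)" by auto
  have va: "v a \<in> carrier F" and vS: "\<And>b. b \<in> S \<Longrightarrow> v b \<in> carrier F" using insert.prems by auto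
  obtain N' k where N': "\<not> p dvd N'" and k: "smul N' (v a) = emb k"
    using fraction[OF va] by blast
  show ?case
  proof (intro exI conjI ballI)
    show "\<not> p dvd N * N'" using N N' zero_or_prime_dvd_mult_iff[OF zero_or_prime] by blast
    fix b assume "b \<in> insert a S"
    then consider "b = a" | "b \<in> S" "b \<noteq> a" using insert.hyps by blast
    then show "smul (N * N') (v b) = emb (if b = a then N * k else N' * n b)"
    proof cases
      case 1
      then show ?thesis using smul_smul[OF va, of N N'] smul_smul[OF one_closed, of N k] k by simp
    next
      case 2
      then show ?thesis
        using smul_smul[OF vS, of b N' N] smul_smul[OF one_closed, of N' "n b"] n
        by (simp add: mult.commute[of N N'])
    qed
  qed
qed

lemma smul_finsum:
  assumes "finite S" "f \<in> S \<rightarrow> carrier F"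
  shows "smul N (finsum F f S) = finsum F (\<lambda>b. smul N (f b)) S"
  using assms by (induction S rule: finite_induct) (auto simp: smul_add_right Pi_def)

lemma finsum_emb: "finite S \<Longrightarrow> finsum F (\<lambda>b. emb (c b)) S = emb (sum c S)"
  by (induction S rule: finite_induct) (auto simp: smul_add_left Pi_def)

text \<open>Once the entries of \<open>v\<close> have the common denominator \<open>N\<close>, linear combinations over the field are
  computed on the integral numerators.\<close>

lemma smul_finsum_emb:
  assumes "finite S" "v \<in> S \<rightarrow> carrier F" "\<And>b. b \<in> S \<Longrightarrow> smul N (v b) = emb (n b)"
  shows "smul N (finsum F (\<lambda>b. smul (c b) (v b)) S) = emb (\<Sum>b\<in>S. c b * n b)"
proof -
  have "smul N (finsum F (\<lambda>b. smul (c b) (v b)) S) = finsum F (\<lambda>b. smul N (smul (c b) (v b))) S"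
    using assms by (intro smul_finsum) auto
  also have "\<dots> = finsum F (\<lambda>b. emb (c b * n b)) S"
  proof (rule finsum_cong')
    fix b assume b: "b \<in> S"
    then have vb: "v b \<in> carrier F" using assms by auto
    have "smul N (smul (c b) (v b)) = smul (c b) (smul N (v b))"
      using smul_smul[OF vb, of N "c b"] smul_smul[OF vb, of "c b" N] by (simp add: mult.commute[of N])
    then show "smul N (smul (c b) (v b)) = emb (c b * n b)"
      using assms(3)[OF b] smul_smul[OF one_closed, of "c b" "n b"] by simp
  qed auto
  also have "\<dots> = emb (\<Sum>b\<in>S. c b * n b)" using assms(1) by (rule finsum_emb)
  finally show ?thesis .
qed

end

lemma rat_field_ops:
  "carrier rat_field = UNIV" "\<zero>\<^bsub>rat_field\<^esub> = 0" "\<one>\<^bsub>rat_field\<^esub> = 1"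
  "x \<oplus>\<^bsub>rat_field\<^esub> y = x + y"
  by (simp_all add: ring_of_type_algebra_def)

lemma prime_field_rat: "prime_field rat_field 0"
proof -
  interpret field rat_field by (rule field_from_type_algebra)
  have nat: "add_pow rat_field (n :: nat) x = of_nat n * x" for n x
    by (induction n) (auto simp: rat_field_ops algebra_simps)
  have neg: "\<ominus>\<^bsub>rat_field\<^esub> x = - x" for x
    by (rule add.inv_equality) (auto simp: rat_field_ops)
  have int: "add_pow rat_field (n :: int) x = of_int n * x" for n x
    by (cases "n \<ge> 0") (auto simp: add_pow_int_ge add_pow_int_lt nat neg)
  show ?thesis
  proof unfold_locales
    fix x :: rat
    obtain a b where "quotient_of x = (a, b)" by (cases "quotient_of x")
    then have "b > 0" "x = of_int a / of_int b"
      by (auto simp: quotient_of_denom_pos quotient_of_div)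
    then have "\<not> 0 dvd b \<and> add_pow rat_field b x = add_pow rat_field a \<one>\<^bsub>rat_field\<^esub>"
      by (simp add: int rat_field_ops)
    then show "\<exists>(N :: int) (n :: int). \<not> 0 dvd N \<and> add_pow rat_field N x = add_pow rat_field n \<one>\<^bsub>rat_field\<^esub>"
      by (intro exI)
  qed (auto simp: zero_or_prime_def int rat_field_ops)
qed

lemma prime_field_residue_ring:
  assumes "normalization_semidom_class.prime (p :: nat)"
  shows "prime_field (residue_ring (int p)) (int p)"
proof -
  define R where "R = residue_ring (int p)"
  interpret residues_prime p R
    by unfold_locales (use assms in \<open>auto simp: R_def prime_gt_1_nat prime_ge_2_nat\<close>)
  interpret field R by (rule is_field)
  have p: "1 < int p" using assms prime_gt_1_nat by simp
  have nat: "add_pow R (n :: nat) x = (int n * x) mod int p" if "x \<in> carrier R" for n x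
  proof (induction n)
    case 0
    show ?case by (simp add: res_zero_eq)
  next
    case (Suc n)
    then show ?case using that by (simp add: res_add_eq algebra_simps mod_simps)
  qed
  have int: "add_pow R (n :: int) x = (n * x) mod int p" if "x \<in> carrier R" for n x
  proof (cases "n \<ge> 0")
    case True
    then show ?thesis by (simp add: add_pow_int_ge nat[OF that])
  next
    case False
    then show ?thesis
      by (simp add: add_pow_int_lt nat[OF that] res_neg_eq mod_simps)
  qed
  have one: "\<one>\<^bsub>R\<^esub> = 1" "1 \<in> carrier R" using one_closed by (simp_all add: res_one_eq)
  have "prime_field R (int p)"
  proof unfold_locales
    show "zero_or_prime (int p)" using assms by (simp add: zero_or_prime_def)
    show "add_pow R (n :: int) \<one>\<^bsub>R\<^esub> = \<zero>\<^bsub>R\<^esub> \<longleftrightarrow> int p dvd n" for n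
      using int[OF one(2)] by (simp add: one res_zero_eq dvd_eq_mod_eq_0)
    fix x assume x: "x \<in> carrier R"
    have "add_pow R (1 :: int) x = add_pow R x \<one>\<^bsub>R\<^esub>"
      using int[OF x] int[OF one(2)] by (simp add: one)
    moreover have "\<not> int p dvd 1" using p by auto
    ultimately show "\<exists>N n :: int. \<not> int p dvd N \<and> add_pow R N x = add_pow R n \<one>\<^bsub>R\<^esub>"
      by (intro exI conjI)
  qed
  then show ?thesis by (simp add: R_def)
qed



section \<open>The invariant over a prime field in terms of integral vectors\<close>

context prime_field
begin

lemma carrier_cochains:
  assumes "finite (zbasis_at K i q)"
  shows "carrier (cochains K F i q) = (zbasis_at K i q \<rightarrow>\<^sub>E carrier F)"
proof -
  have "finite {b \<in> zbasis_at K i q. v b \<noteq> \<zero>}" for v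
    using assms by simp
  then show ?thesis
    unfolding cochains_def by (subst carrier_sum_group[OF a_group]) auto
qed

lemma mult_cochains: "x \<otimes>\<^bsub>cochains K F i q\<^esub> y = (\<lambda>b\<in>zbasis_at K i q. x b \<oplus> y b)"
  by (simp add: cochains_def)

lemma one_cochains: "\<one>\<^bsub>cochains K F i q\<^esub> = (\<lambda>b\<in>zbasis_at K i q. \<zero>)"
  by (simp add: cochains_def)

lemma group_cochains: "group (cochains K F i q)"
  unfolding cochains_def by (rule sum_group) (rule a_group)

text \<open>Summation over the whole finite basis in place of the support of \<open>v\<close>, which would depend on \<open>v\<close>.\<close>

lemma codiff_apply:
  assumes fin: "finite (zbasis_at K i q)" and v: "v \<in> zbasis_at K i q \<rightarrow> carrier F"
    and b': "b' \<in> zbasis_at K (i + 1) q"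
  shows "codiff K F i q v b' = finsum F (\<lambda>b. smul (zcoef K b b') (v b)) (zbasis_at K i q)"
proof -
  have "codiff K F i q v b'
      = finsum F (\<lambda>b. smul (zcoef K b b') (v b)) {b \<in> zbasis_at K i q. v b \<noteq> \<zero>}"
    using b' by (simp add: codiff_def)
  also have "\<dots> = finsum F (\<lambda>b. smul (zcoef K b b') (v b)) (zbasis_at K i q)"
    using fin v by (intro add.finprod_mono_neutral_cong_left) (auto simp: Pi_def)
  finally show ?thesis .
qed

lemma codiff_hom:
  assumes "finite (zbasis_at K i q)" "finite (zbasis_at K (i + 1) q)"
  shows "codiff K F i q \<in> hom (cochains K F i q) (cochains K F (i + 1) q)"
proof (rule homI)
  fix v assume "v \<in> carrier (cochains K F i q)"
  then have v: "v \<in> zbasis_at K i q \<rightarrow> carrier F" using carrier_cochains[OF assms(1)] by auto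
  show "codiff K F i q v \<in> carrier (cochains K F (i + 1) q)"
    unfolding carrier_cochains[OF assms(2)]
  proof (rule PiE_I)
    fix b' assume b': "b' \<in> zbasis_at K (i + 1) q"
    show "codiff K F i q v b' \<in> carrier F"
      unfolding codiff_apply[OF assms(1) v b'] using v by (intro finsum_closed) auto
  qed (simp add: codiff_def)
next
  fix v w assume "v \<in> carrier (cochains K F i q)" "w \<in> carrier (cochains K F i q)"
  then have v: "v \<in> zbasis_at K i q \<rightarrow> carrier F" and w: "w \<in> zbasis_at K i q \<rightarrow> carrier F"
    using carrier_cochains[OF assms(1)] by auto
  let ?u = "v \<otimes>\<^bsub>cochains K F i q\<^esub> w"
  have u: "?u \<in> zbasis_at K i q \<rightarrow> carrier F" using v w by (auto simp: mult_cochains)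
  show "codiff K F i q ?u = codiff K F i q v \<otimes>\<^bsub>cochains K F (i + 1) q\<^esub> codiff K F i q w"
  proof
    fix b'
    show "codiff K F i q ?u b'
        = (codiff K F i q v \<otimes>\<^bsub>cochains K F (i + 1) q\<^esub> codiff K F i q w) b'"
    proof (cases "b' \<in> zbasis_at K (i + 1) q")
      case True
      have "finsum F (\<lambda>b. smul (zcoef K b b') (?u b)) (zbasis_at K i q)
          = finsum F (\<lambda>b. smul (zcoef K b b') (v b) \<oplus> smul (zcoef K b b') (w b)) (zbasis_at K i q)"
        using v w by (intro finsum_cong') (auto simp: mult_cochains smul_add_right Pi_def)
      also have "\<dots> = finsum F (\<lambda>b. smul (zcoef K b b') (v b)) (zbasis_at K i q)
          \<oplus> finsum F (\<lambda>b. smul (zcoef K b b') (w b)) (zbasis_at K i q)"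
        using v w by (intro finsum_addf) auto
      finally show ?thesis
        unfolding codiff_apply[OF assms(1) u True] codiff_apply[OF assms(1) v True, symmetric]
          codiff_apply[OF assms(1) w True, symmetric]
        using True by (simp add: mult_cochains)
    next
      case False
      then show ?thesis by (simp add: codiff_def mult_cochains)
    qed
  qed
qed

lemma subgroup_coboundaries:
  assumes "\<And>i. finite (zbasis_at K i q)"
  shows "subgroup (coboundaries K F i q) (cochains K F i q)"
proof -
  have "group_hom (cochains K F (i - 1) q) (cochains K F i q) (codiff K F (i - 1) q)"
    using codiff_hom[of K "i - 1" q] assms group_cochains[of K "i - 1" q] group_cochains[of K i q]
    by (simp add: group_hom_def group_hom_axioms_def)
  from group_hom.img_is_subgroup[OF this] show ?thesis by (simp add: coboundaries_def)
qed

end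

abbreviation zpoly :: "int poly cplx \<Rightarrow> (nat \<times> int) zcplx" where
  "zpoly \<equiv> poly_to_zcplx"

abbreviation zlaurent :: "int poly cplx \<Rightarrow> (nat \<times> int) zcplx" where
  "zlaurent D \<equiv> laurent_to_zcplx (localize D)"

lemma r_coset_cocycles: "B #>\<^bsub>cocycles K A i q\<^esub> x = B #>\<^bsub>cochains K A i q\<^esub> x"
  by (simp add: r_coset_def cocycles_def)

lemma zbasis_at_laurent:
  "zbasis_at (zlaurent D) i q
    = {(j, k). j < rk D \<and> fst (gens D ! j) = i \<and> snd (gens D ! j) - 2 * k = q}"
  by (auto simp: zbasis_at_def laurent_to_zcplx_def)

lemma zbasis_at_poly:
  "zbasis_at (zpoly D) i q = {b \<in> zbasis_at (zlaurent D) i q. snd b \<ge> 0}"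
  by (auto simp: zbasis_at_def laurent_to_zcplx_def poly_to_zcplx_def)

lemma finite_zbasis_at_laurent: "finite (zbasis_at (zlaurent D) i q)"
proof (rule finite_subset)
  show "zbasis_at (zlaurent D) i q
      \<subseteq> (\<lambda>j. (j, (snd (gens D ! j) - q) div 2)) ` {..<rk D}"
    by (auto simp: zbasis_at_laurent)
qed simp

lemma finite_zbasis_at_poly: "finite (zbasis_at (zpoly D) i q)"
  using finite_zbasis_at_laurent by (simp add: zbasis_at_poly)

lemma zcoef_poly_eq_laurent:
  assumes D: "diff D \<in> carrier_mat (rk D) (rk D)"
    and "b \<in> zbasis (zlaurent D)" "b' \<in> zbasis (zlaurent D)"
  shows "zcoef (zpoly D) b b' = zcoef (zlaurent D) b b'"
  using assms by (auto simp: laurent_to_zcplx_def poly_to_zcplx_def lookup_poly_to_laurent)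

text \<open>Between cochains of fixed quantum degree only one power of \<open>h\<close> can occur in each matrix entry, so the
  coefficient is the value of the entry at \<open>h = 1\<close>.\<close>

lemma zcoef_laurent:
  assumes D: "is_cplx poly_grading D"
    and b: "(j, k) \<in> zbasis_at (zlaurent D) i q"
    and b': "(l, m) \<in> zbasis_at (zlaurent D) (i + 1) q"
  shows "zcoef (zlaurent D) (j, k) (l, m) = diff (collapse D) $$ (l, j)"
proof -
  define d where "d = diff D $$ (l, j)"
  have jl: "j < rk D" "l < rk D" using b b' by (auto simp: zbasis_at_laurent)
  have "d \<in> poly_grading (2 * (k - m))"
  proof -
    have "d \<in> poly_grading (snd (gens D ! j) + 0 - snd (gens D ! l))"
      using is_cplxD(1)[OF D] jl
      by (cases "d = 0") (auto simp: graded_map_def d_def poly_grading_def)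
    then show ?thesis using b b' by (auto simp: zbasis_at_laurent algebra_simps)
  qed
  then have only: "poly.coeff d r \<noteq> 0 \<Longrightarrow> int r = m - k" for r
    by (auto simp: poly_grading_def)
  have "poly d 1 = (\<Sum>r\<le>Polynomial.degree d. poly.coeff d r)" by (simp add: poly_altdef)
  also have "\<dots> = (\<Sum>r\<le>Polynomial.degree d. if m \<ge> k \<and> r = nat (m - k) then poly.coeff d r else 0)"
  proof (rule sum.cong)
    fix r
    show "poly.coeff d r = (if m \<ge> k \<and> r = nat (m - k) then poly.coeff d r else 0)"
      using only[of r] by (cases "poly.coeff d r = 0") auto
  qed simp
  also have "\<dots> = (if m < k then 0 else poly.coeff d (nat (m - k)))"
    by (auto simp: sum.delta intro: coeff_eq_0)
  finally have "poly d 1 = Poly_Mapping.lookup (poly_to_laurent d) (m - k)"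
    by (simp add: lookup_poly_to_laurent)
  then show ?thesis using jl is_cplxD(2)[OF D] by (simp add: laurent_to_zcplx_def d_def)
qed

text \<open>The integral vector at \<open>h = 1\<close> of a cochain of bidegree \<open>(i, q)\<close> of \<open>h\<inverse>D\<close>: a generator \<open>e\<^sub>j\<close> of the right
  homological degree and parity contributes the single basis element \<open>h\<^sup>k e\<^sub>j\<close> with
  \<open>2 k = snd (gens D ! j) - q\<close>.\<close>

definition column :: "int poly cplx \<Rightarrow> int \<Rightarrow> int \<Rightarrow> (nat \<times> int \<Rightarrow> int) \<Rightarrow> int mat" where
  "column D i q n = mat (rk D) 1 (\<lambda>(j, _).
     if fst (gens D ! j) = i \<and> even (snd (gens D ! j) - q) then n (j, (snd (gens D ! j) - q) div 2) else 0)"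

lemma column_carrier [simp]: "column D i q n \<in> carrier_mat (rk D) 1"
  by (simp add: column_def)

lemma column_entry:
  assumes "(j, k) \<in> zbasis_at (zlaurent D) i q"
  shows "column D i q n $$ (j, 0) = n (j, k)"
  using assms by (auto simp: zbasis_at_laurent column_def)

lemma mult_column_entry:
  assumes A: "A \<in> carrier_mat r (rk D)" and l: "l < r"
  shows "(A * column D i q n) $$ (l, 0)
    = (\<Sum>(j, k)\<in>zbasis_at (zlaurent D) i q. A $$ (l, j) * n (j, k))"
proof -
  let ?J = "{j. j < rk D \<and> fst (gens D ! j) = i \<and> even (snd (gens D ! j) - q)}"
  have "(A * column D i q n) $$ (l, 0) = (\<Sum>j<rk D. A $$ (l, j) * column D i q n $$ (j, 0))"
    using mult_mat_entry[OF A column_carrier l] by simp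
  also have "\<dots> = (\<Sum>j\<in>?J. A $$ (l, j) * column D i q n $$ (j, 0))"
    by (rule sum.mono_neutral_right) (auto simp: column_def)
  also have "\<dots> = (\<Sum>(j, k)\<in>zbasis_at (zlaurent D) i q. A $$ (l, j) * n (j, k))"
    by (rule sum.reindex_bij_witness[of _ fst "\<lambda>j. (j, (snd (gens D ! j) - q) div 2)"])
      (auto simp: zbasis_at_laurent column_def)
  finally show ?thesis .
qed



lemma mod_zero_11_iff: "A \<in> carrier_mat 1 1 \<Longrightarrow> mod_zero p A \<longleftrightarrow> p dvd A $$ (0, 0)"
  by (auto simp: mod_zero_def)

lemma column_eq_self:
  assumes "y \<in> carrier_mat (rk D) 1"
    and "\<And>j. j < rk D \<Longrightarrow> y $$ (j, 0) \<noteq> 0 \<Longrightarrow> fst (gens D ! j) = i \<and> even (snd (gens D ! j) - q)"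
  shows "column D i q (\<lambda>(j, k). y $$ (j, 0)) = y"
proof (rule eq_matI)
  fix j c assume "j < dim_row y" "c < dim_col y"
  then have "j < rk D" "c = 0" using assms(1) by auto
  then show "column D i q (\<lambda>(j, k). y $$ (j, 0)) $$ (j, c) = y $$ (j, c)"
    using assms(2)[of j] by (auto simp: column_def)
qed (use assms in \<open>auto simp: column_def\<close>)

lemma graded_mult_column_support:
  assumes A: "graded_map parity_grading (a, 0) (collapse D) (collapse D) A"
    and l: "l < rk D" and nz: "(A * column D i q n) $$ (l, 0) \<noteq> 0"
  shows "fst (gens D ! l) = i + a" "even (snd (gens D ! l) - q)"
proof -
  have c: "A \<in> carrier_mat (rk D) (rk D)" using graded_map_carrier[OF A] by simp
  obtain j k where jk: "(j, k) \<in> zbasis_at (zlaurent D) i q" "A $$ (l, j) \<noteq> 0"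
  proof -
    have "(\<Sum>(j, k)\<in>zbasis_at (zlaurent D) i q. A $$ (l, j) * n (j, k)) \<noteq> 0"
      using nz by (simp add: mult_column_entry[OF c l])
    then obtain b where "b \<in> zbasis_at (zlaurent D) i q" "(case b of (j, k) \<Rightarrow> A $$ (l, j) * n (j, k)) \<noteq> 0"
      by (rule sum.not_neutral_contains_not_neutral)
    then show thesis using that by (cases b) auto
  qed
  then have "j < rk D" "fst (gens D ! j) = i" "even (snd (gens D ! j) - q)"
    by (auto simp: zbasis_at_laurent)
  moreover from this have "fst (gens D ! l) = fst (gens D ! j) + a"
    "even (snd (gens D ! j) - snd (gens D ! l))"
    using A l jk(2) by (auto simp: graded_map_def mem_parity_grading_iff)
  ultimately show "fst (gens D ! l) = i + a" "even (snd (gens D ! l) - q)" by auto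
qed

context prime_field
begin

definition extend_zero :: "int poly cplx \<Rightarrow> int \<Rightarrow> int \<Rightarrow> (nat \<times> int \<Rightarrow> 'a) \<Rightarrow> nat \<times> int \<Rightarrow> 'a" where
  "extend_zero D i q v = (\<lambda>b\<in>zbasis_at (zlaurent D) i q. if b \<in> zbasis_at (zpoly D) i q then v b else \<zero>)"

lemma extend_zero_apply:
  "b \<in> zbasis_at (zlaurent D) i q \<Longrightarrow> extend_zero D i q v b = (if b \<in> zbasis_at (zpoly D) i q then v b else \<zero>)"
  by (simp add: extend_zero_def)

lemma carrier_cochains_poly: "carrier (cochains (zpoly D) F i q) = zbasis_at (zpoly D) i q \<rightarrow>\<^sub>E carrier F"
  and carrier_cochains_laurent: "carrier (cochains (zlaurent D) F i q) = zbasis_at (zlaurent D) i q \<rightarrow>\<^sub>E carrier F"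
  by (simp_all add: carrier_cochains finite_zbasis_at_poly finite_zbasis_at_laurent)

lemma extend_zero_closed:
  assumes "v \<in> carrier (cochains (zpoly D) F i q)"
  shows "extend_zero D i q v \<in> carrier (cochains (zlaurent D) F i q)"
  using assms unfolding carrier_cochains_poly carrier_cochains_laurent
  by (auto simp: extend_zero_def PiE_iff)

lemma extend_zero_mult:
  "extend_zero D i q (v \<otimes>\<^bsub>cochains (zpoly D) F i q\<^esub> w)
    = extend_zero D i q v \<otimes>\<^bsub>cochains (zlaurent D) F i q\<^esub> extend_zero D i q w"
  by (rule ext) (simp add: mult_cochains extend_zero_def zbasis_at_poly)

text \<open>No negative powers of \<open>h\<close> occur in the differential, so the differential of a cochain without negative
  powers has none either.\<close>

lemma extend_zero_codiff:
  assumes D: "diff D \<in> carrier_mat (rk D) (rk D)" and u: "u \<in> carrier (cochains (zpoly D) F i q)"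
  shows "extend_zero D (i + 1) q (codiff (zpoly D) F i q u) = codiff (zlaurent D) F i q (extend_zero D i q u)"
proof
  fix b'
  have supp: "{b \<in> zbasis_at (zlaurent D) i q. extend_zero D i q u b \<noteq> \<zero>} = {b \<in> zbasis_at (zpoly D) i q. u b \<noteq> \<zero>}"
    by (auto simp: extend_zero_def zbasis_at_poly)
  have uc: "u b \<in> carrier F" if "b \<in> zbasis_at (zpoly D) i q" for b
    using u that unfolding carrier_cochains_poly by auto
  have L: "b \<in> zbasis (zlaurent D)" if "b \<in> zbasis_at (zlaurent D) i q" for b i
    using that by (simp add: zbasis_at_def)
  show "extend_zero D (i + 1) q (codiff (zpoly D) F i q u) b' = codiff (zlaurent D) F i q (extend_zero D i q u) b'"
  proof (cases "b' \<in> zbasis_at (zlaurent D) (i + 1) q")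
    case False
    then show ?thesis by (simp add: extend_zero_def codiff_def)
  next
    case True
    have eq: "codiff (zlaurent D) F i q (extend_zero D i q u) b'
        = finsum F (\<lambda>b. smul (zcoef (zpoly D) b b') (u b)) {b \<in> zbasis_at (zpoly D) i q. u b \<noteq> \<zero>}"
    proof -
      have "codiff (zlaurent D) F i q (extend_zero D i q u) b' = finsum F (\<lambda>b. smul (zcoef (zlaurent D) b b') (extend_zero D i q u b))
          {b \<in> zbasis_at (zpoly D) i q. u b \<noteq> \<zero>}"
        using True by (simp add: codiff_def supp)
      also have "\<dots> = finsum F (\<lambda>b. smul (zcoef (zpoly D) b b') (u b)) {b \<in> zbasis_at (zpoly D) i q. u b \<noteq> \<zero>}"
        using True uc
        by (intro finsum_cong') (auto simp: extend_zero_def zbasis_at_poly zcoef_poly_eq_laurent[OF D L L])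
      finally show ?thesis .
    qed
    show ?thesis
    proof (cases "b' \<in> zbasis_at (zpoly D) (i + 1) q")
      case True
      then show ?thesis using eq by (simp add: extend_zero_def codiff_def zbasis_at_poly)
    next
      case neg: False
      have "smul (zcoef (zpoly D) b b') (u b) = \<zero>" if "b \<in> zbasis_at (zpoly D) i q" for b
      proof -
        have "snd b' < snd b" using neg True that by (auto simp: zbasis_at_poly)
        then show ?thesis by (cases b, cases b') (simp add: poly_to_zcplx_def)
      qed
      then have "codiff (zlaurent D) F i q (extend_zero D i q u) b' = \<zero>"
        unfolding eq by (intro add.finprod_one_eqI) auto
      then show ?thesis using True neg by (simp add: extend_zero_def)
    qed
  qed
qed

text \<open>The map on cohomology sends the class of a cocycle \<open>a\<close> to the coset of its extension by zero, which is
  trivial exactly if the extension is a coboundary. That the coset does not depend on the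
  representative follows because extension by zero sends coboundaries to coboundaries.\<close>

lemma nonzero_image_iff:
  assumes D: "diff D \<in> carrier_mat (rk D) (rk D)"
  shows "(\<exists>U \<in> carrier (cohomology (zpoly D) F i q).
        localization_map D F i q U \<noteq> \<one>\<^bsub>cohomology (zlaurent D) F i q\<^esub>)
    \<longleftrightarrow> (\<exists>a \<in> carrier (cocycles (zpoly D) F i q). extend_zero D i q a \<notin> coboundaries (zlaurent D) F i q)"
proof -
  let ?P = "cochains (zpoly D) F i q" and ?L = "cochains (zlaurent D) F i q"
  let ?BP = "coboundaries (zpoly D) F i q" and ?BL = "coboundaries (zlaurent D) F i q"
  interpret L: group ?L by (rule group_cochains)
  have BP: "subgroup ?BP ?P" and BL: "subgroup ?BL ?L"
    by (simp_all add: subgroup_coboundaries finite_zbasis_at_poly finite_zbasis_at_laurent)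
  have ext_B: "extend_zero D i q b \<in> ?BL" if bB: "b \<in> ?BP" for b
  proof -
    obtain u where u: "u \<in> carrier (cochains (zpoly D) F (i - 1) q)"
      and b: "b = codiff (zpoly D) F (i - 1) q u" using bB unfolding coboundaries_def by blast
    have "extend_zero D i q b = codiff (zlaurent D) F (i - 1) q (extend_zero D (i - 1) q u)"
      using extend_zero_codiff[OF D u] by (simp add: b)
    then show ?thesis using extend_zero_closed[OF u] by (auto simp: coboundaries_def)
  qed
  have loc: "localization_map D F i q (?BP #>\<^bsub>cocycles (zpoly D) F i q\<^esub> a)
      = ?BL #>\<^bsub>?L\<^esub> extend_zero D i q a" if a: "a \<in> carrier (cocycles (zpoly D) F i q)" for a
  proof -
    have aP: "a \<in> carrier ?P" using a by (simp add: cocycles_def kernel_def)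
    have "?BL #>\<^bsub>?L\<^esub> extend_zero D i q (b \<otimes>\<^bsub>?P\<^esub> a) = ?BL #>\<^bsub>?L\<^esub> extend_zero D i q a" if b: "b \<in> ?BP" for b
    proof -
      have bL: "extend_zero D i q b \<in> carrier ?L" using ext_B[OF b] subgroup.subset[OF BL] by blast
      have "?BL #>\<^bsub>?L\<^esub> extend_zero D i q (b \<otimes>\<^bsub>?P\<^esub> a)
          = (?BL #>\<^bsub>?L\<^esub> extend_zero D i q b) #>\<^bsub>?L\<^esub> extend_zero D i q a"
        using L.coset_mult_assoc[OF subgroup.subset[OF BL] bL extend_zero_closed[OF aP]] by (simp add: extend_zero_mult)
      then show ?thesis using L.coset_join2[OF bL BL ext_B[OF b]] by simp
    qed
    moreover have "?BP \<noteq> {}" using subgroup.one_closed[OF BP] by blast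
    moreover have "localization_map D F i q (?BP #>\<^bsub>cocycles (zpoly D) F i q\<^esub> a)
        = (\<Union>b\<in>?BP. ?BL #>\<^bsub>?L\<^esub> extend_zero D i q (b \<otimes>\<^bsub>?P\<^esub> a))"
      unfolding localization_map_def cohomology_map_def r_coset_cocycles
      by (auto simp: r_coset_def extend_zero_def)
    ultimately show ?thesis by auto
  qed
  have "?BL #>\<^bsub>?L\<^esub> extend_zero D i q a \<noteq> ?BL \<longleftrightarrow> extend_zero D i q a \<notin> ?BL"
    if "a \<in> carrier (cocycles (zpoly D) F i q)" for a
  proof -
    have "extend_zero D i q a \<in> carrier ?L"
      using that by (intro extend_zero_closed) (simp add: cocycles_def kernel_def)
    then show ?thesis using L.coset_join1[OF _ _ BL] L.coset_join2[OF _ BL] by blast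
  qed
  then show ?thesis
    by (simp add: cohomology_def carrier_FactGroup loc cong: bex_cong)
qed

lemma smul_codiff:
  assumes D: "is_cplx poly_grading D" and v: "v \<in> zbasis_at (zlaurent D) i q \<rightarrow> carrier F"
    and n: "\<And>b. b \<in> zbasis_at (zlaurent D) i q \<Longrightarrow> smul N (v b) = emb (n b)"
    and b': "(l, m) \<in> zbasis_at (zlaurent D) (i + 1) q"
  shows "smul N (codiff (zlaurent D) F i q v (l, m)) = emb ((diff (collapse D) * column D i q n) $$ (l, 0))"
proof -
  have l: "l < rk D" using b' by (simp add: zbasis_at_laurent)
  have c: "diff (collapse D) \<in> carrier_mat (rk D) (rk D)" using is_cplxD(2)[OF D] by simp
  have "smul N (codiff (zlaurent D) F i q v (l, m))
      = emb (\<Sum>b\<in>zbasis_at (zlaurent D) i q. zcoef (zlaurent D) b (l, m) * n b)"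
    unfolding codiff_apply[OF finite_zbasis_at_laurent v b']
    by (rule smul_finsum_emb[OF finite_zbasis_at_laurent v n])
  also have "(\<Sum>b\<in>zbasis_at (zlaurent D) i q. zcoef (zlaurent D) b (l, m) * n b)
      = (\<Sum>(j, k)\<in>zbasis_at (zlaurent D) i q. diff (collapse D) $$ (l, j) * n (j, k))"
    using zcoef_laurent[OF D _ b'] by (intro sum.cong) auto
  also have "\<dots> = (diff (collapse D) * column D i q n) $$ (l, 0)"
    by (rule mult_column_entry[OF c l, symmetric])
  finally show ?thesis .
qed

text \<open>The passage from cochains over the field to integral vectors. A cochain of \<open>D\<close> has nonnegative powers of
  \<open>h\<close>, which is the condition on the filtration. A coboundary is killed by \<open>\<phi>\<close> since \<open>\<phi> d = 0\<close>;
  conversely, if \<open>\<phi> z\<close> and \<open>d z\<close> vanish, then \<open>z = - d (H z)\<close> by the homotopy. Denominators are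
  cleared by a multiplication with some \<open>N\<close> that is invertible in the field.\<close>

lemma nonzero_image_iff_detects:
  assumes D: "is_cplx poly_grading D" and split: "split_cplx (collapse D) \<phi> \<psi> H"
  shows "(\<exists>a \<in> carrier (cocycles (zpoly D) F 0 q). extend_zero D 0 q a \<notin> coboundaries (zlaurent D) F 0 q)
    \<longleftrightarrow> (\<exists>z. split_cplx.detects (collapse D) \<phi> p q z)"
proof -
  interpret S: split_cplx "collapse D" \<phi> \<psi> H by (rule split)
  let ?n = "rk D"
  define d where "d = diff (collapse D)"
  have c: "d \<in> carrier_mat ?n ?n" "\<phi> \<in> carrier_mat 1 ?n" "\<psi> \<in> carrier_mat ?n 1" "H \<in> carrier_mat ?n ?n"
    using S.carriers by (simp_all add: d_def)
  have gd: "graded_map parity_grading (1, 0) (collapse D) (collapse D) d"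
    using is_cplxD(1)[OF S.cplx] by (simp add: d_def)
  have cocycle: "a \<in> carrier (cocycles (zpoly D) F 0 q) \<longleftrightarrow> a \<in> carrier (cochains (zpoly D) F 0 q)
      \<and> (\<forall>b'\<in>zbasis_at (zlaurent D) 1 q. codiff (zlaurent D) F 0 q (extend_zero D 0 q a) b' = \<zero>)" for a
  proof (cases "a \<in> carrier (cochains (zpoly D) F 0 q)")
    case True
    note e = extend_zero_codiff[OF is_cplxD(2)[OF D] True, symmetric]
    have "codiff (zpoly D) F 0 q a = (\<lambda>b\<in>zbasis_at (zpoly D) 1 q. \<zero>)
        \<longleftrightarrow> (\<forall>b'\<in>zbasis_at (zpoly D) 1 q. codiff (zpoly D) F 0 q a b' = \<zero>)"
      by (auto simp: codiff_def fun_eq_iff)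
    then show ?thesis
      using True unfolding e
      by (auto simp: cocycles_def kernel_def one_cochains extend_zero_def zbasis_at_poly)
  next
    case False
    then show ?thesis by (simp add: cocycles_def kernel_def)
  qed
  show ?thesis
  proof
    assume "\<exists>z. S.detects p q z"
    then obtain z where z: "cocycle_mod p (collapse D) q z" and nd: "\<not> p dvd (\<phi> * z) $$ (0, 0)"
      by (auto simp: S.detects_def)
    have zc: "z \<in> carrier_mat ?n 1" using cocycle_modD(1)[OF z] by simp
    have zsupp: "fst (gens D ! j) = 0" "q \<le> snd (gens D ! j)" "even (snd (gens D ! j) - q)"
      if "j < ?n" "z $$ (j, 0) \<noteq> 0" for j
      using z that by (auto simp: cocycle_mod_def)
    define n where "n = (\<lambda>(j, k :: int). z $$ (j, 0))"
    have zcol: "column D 0 q n = z"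
      unfolding n_def by (rule column_eq_self[OF zc]) (use zsupp in auto)
    define a where "a = (\<lambda>b\<in>zbasis_at (zpoly D) 0 q. emb (n b))"
    have aC: "a \<in> carrier (cochains (zpoly D) F 0 q)"
      unfolding carrier_cochains_poly by (auto simp: a_def)
    have ea: "extend_zero D 0 q a b = emb (n b)" if b: "b \<in> zbasis_at (zlaurent D) 0 q" for b
    proof (cases "b \<in> zbasis_at (zpoly D) 0 q")
      case True
      then show ?thesis using b by (simp add: extend_zero_apply a_def)
    next
      case False
      obtain j k where jk: "b = (j, k)" by (cases b)
      have "j < ?n" "snd (gens D ! j) < q" using False b by (auto simp: jk zbasis_at_poly zbasis_at_laurent)
      then have "n b = 0" using zsupp(2)[of j] by (auto simp: jk n_def)
      then show ?thesis using b False by (simp add: extend_zero_apply)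
    qed
    have one: "smul 1 (extend_zero D 0 q a b) = emb (n b)" if "b \<in> zbasis_at (zlaurent D) 0 q" for b
      using ea[OF that] smul_smul[OF one_closed, of 1 "n b"] by simp
    have eC: "extend_zero D 0 q a \<in> zbasis_at (zlaurent D) 0 q \<rightarrow> carrier F"
      using extend_zero_closed[OF aC] unfolding carrier_cochains_laurent by auto
    have "codiff (zlaurent D) F 0 q (extend_zero D 0 q a) b' = \<zero>" if "b' \<in> zbasis_at (zlaurent D) 1 q" for b'
    proof -
      obtain l m where lm: "b' = (l, m)" by (cases b')
      have lm': "(l, m) \<in> zbasis_at (zlaurent D) (0 + 1) q" using that lm by simp
      have l: "l < ?n" using lm' by (simp add: zbasis_at_laurent)
      have x: "codiff (zlaurent D) F 0 q (extend_zero D 0 q a) (l, m) \<in> carrier F"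
        unfolding codiff_apply[OF finite_zbasis_at_laurent eC lm'] using eC by (intro finsum_closed) auto
      have "p dvd (d * z) $$ (l, 0)"
        using mod_zeroD[OF cocycle_modD(2)[OF z], of ?n 1 l 0] c zc l by (simp add: d_def)
      then have "smul 1 (codiff (zlaurent D) F 0 q (extend_zero D 0 q a) (l, m)) = \<zero>"
        using smul_codiff[OF D eC one lm'] int_eq_zero_iff by (simp add: zcol d_def)
      then show ?thesis using x by (simp add: lm add.int_pow_1)
    qed
    then have "a \<in> carrier (cocycles (zpoly D) F 0 q)" using cocycle aC by blast
    moreover have "extend_zero D 0 q a \<notin> coboundaries (zlaurent D) F 0 q"
    proof
      assume "extend_zero D 0 q a \<in> coboundaries (zlaurent D) F 0 q"
      then obtain u where u: "u \<in> carrier (cochains (zlaurent D) F (- 1) q)"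
        and eu: "extend_zero D 0 q a = codiff (zlaurent D) F (- 1) q u" by (auto simp: coboundaries_def)
      have uC: "u \<in> zbasis_at (zlaurent D) (- 1) q \<rightarrow> carrier F"
        using u unfolding carrier_cochains_laurent by auto
      obtain N w where N: "\<not> p dvd N" and "\<forall>b\<in>zbasis_at (zlaurent D) (- 1) q. smul N (u b) = emb (w b)"
        using common_denominator[OF finite_zbasis_at_laurent uC] by blast
      then have w: "\<And>b. b \<in> zbasis_at (zlaurent D) (- 1) q \<Longrightarrow> smul N (u b) = emb (w b)" by blast
      define W where "W = column D (- 1) q w"
      have Wc: "W \<in> carrier_mat ?n 1" unfolding W_def by (rule column_carrier)
      have dvd: "p dvd N * z $$ (l, 0) - (d * W) $$ (l, 0)" if l: "l < ?n" for l
      proof (cases "fst (gens D ! l) = 0 \<and> even (snd (gens D ! l) - q)")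
        case True
        then have "(l, (snd (gens D ! l) - q) div 2) \<in> zbasis_at (zlaurent D) 0 q"
          using l by (auto simp: zbasis_at_laurent)
        then obtain m where lm: "(l, m) \<in> zbasis_at (zlaurent D) 0 q" by blast
        then have lm': "(l, m) \<in> zbasis_at (zlaurent D) (- 1 + 1) q" by simp
        have "smul N (extend_zero D 0 q a (l, m)) = emb (N * z $$ (l, 0))"
          using ea[OF lm] smul_smul[OF one_closed] by (simp add: n_def)
        moreover have "smul N (extend_zero D 0 q a (l, m)) = emb ((d * W) $$ (l, 0))"
          unfolding eu using smul_codiff[OF D uC w lm'] by (simp add: d_def W_def)
        ultimately have "emb (N * z $$ (l, 0)) = emb ((d * W) $$ (l, 0))" by simp
        then show ?thesis unfolding emb_eq_iff .
      next
        case False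
        then have "z $$ (l, 0) = 0" "(d * W) $$ (l, 0) = 0"
          using zsupp[OF l] graded_mult_column_support[OF gd l, of "- 1" q w]
          by (auto simp: W_def)
        then show ?thesis by simp
      qed
      have dW: "d * W \<in> carrier_mat ?n 1" using c Wc by simp
      have "mod_zero p (N \<cdot>\<^sub>m z - d * W)"
        unfolding mod_zero_def
      proof (intro allI impI)
        fix l j assume "l < dim_row (N \<cdot>\<^sub>m z - d * W)" "j < dim_col (N \<cdot>\<^sub>m z - d * W)"
        then have l: "l < ?n" "j = 0" using minus_carrier_mat[OF dW, of "N \<cdot>\<^sub>m z"] by auto
        have "(N \<cdot>\<^sub>m z - d * W) $$ (l, 0) = (N \<cdot>\<^sub>m z) $$ (l, 0) - (d * W) $$ (l, 0)"
          using dW l by (intro index_minus_mat(1)) auto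
        also have "(N \<cdot>\<^sub>m z) $$ (l, 0) = N * z $$ (l, 0)"
          using zc l by (intro index_smult_mat(1)) auto
        finally show "p dvd (N \<cdot>\<^sub>m z - d * W) $$ (l, j)" using dvd[OF l(1)] l by simp
      qed
      then have "mod_zero p (\<phi> * (N \<cdot>\<^sub>m z - d * W))"
        by (rule mod_zero_mult_right[OF _ c(2)]) (rule minus_carrier_mat[OF dW])
      moreover have "\<phi> * (N \<cdot>\<^sub>m z - d * W) = N \<cdot>\<^sub>m (\<phi> * z)"
      proof -
        have "\<phi> * (d * W) = 0\<^sub>m 1 1"
          using assoc_mult_mat[OF c(2) c(1) Wc] S.phi_diff Wc by (simp add: d_def)
        moreover have "\<phi> * (N \<cdot>\<^sub>m z) = N \<cdot>\<^sub>m (\<phi> * z)" using mult_smult_distrib[OF c(2) zc] .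
        moreover have "A - 0\<^sub>m 1 1 = A" if "A \<in> carrier_mat 1 1" for A :: "int mat"
          using that by (intro eq_matI) auto
        ultimately show ?thesis
          using mult_minus_distrib_mat[OF c(2) smult_carrier_mat[OF zc] dW]
            mult_carrier_mat[OF c(2) zc] by simp
      qed
      moreover have fz: "\<phi> * z \<in> carrier_mat 1 1" using c zc by simp
      ultimately have "p dvd (N \<cdot>\<^sub>m (\<phi> * z)) $$ (0, 0)"
        using mod_zeroD[of p "N \<cdot>\<^sub>m (\<phi> * z)" 1 1 0 0] by simp
      also have "(N \<cdot>\<^sub>m (\<phi> * z)) $$ (0, 0) = N * (\<phi> * z) $$ (0, 0)"
        using fz by (intro index_smult_mat(1)) auto
      finally have "p dvd N * (\<phi> * z) $$ (0, 0)" .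
      then show False using N nd zero_or_prime_dvd_mult_iff[OF zero_or_prime] by blast
    qed
    ultimately show "\<exists>a \<in> carrier (cocycles (zpoly D) F 0 q). extend_zero D 0 q a \<notin> coboundaries (zlaurent D) F 0 q"
      by blast
  next
    assume "\<exists>a \<in> carrier (cocycles (zpoly D) F 0 q). extend_zero D 0 q a \<notin> coboundaries (zlaurent D) F 0 q"
    then obtain a where a: "a \<in> carrier (cocycles (zpoly D) F 0 q)"
      and nb: "extend_zero D 0 q a \<notin> coboundaries (zlaurent D) F 0 q" by blast
    have aC: "a \<in> carrier (cochains (zpoly D) F 0 q)" using a cocycle by blast
    then have aP: "a \<in> zbasis_at (zpoly D) 0 q \<rightarrow> carrier F" unfolding carrier_cochains_poly by auto
    obtain N n0 where N: "\<not> p dvd N" and n0: "\<forall>b\<in>zbasis_at (zpoly D) 0 q. smul N (a b) = emb (n0 b)"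
      using common_denominator[OF finite_zbasis_at_poly aP] by blast
    define n where "n = (\<lambda>b :: nat \<times> int. if snd b \<ge> 0 then n0 b else 0)"
    define v where "v = extend_zero D 0 q a"
    have vE: "v \<in> zbasis_at (zlaurent D) 0 q \<rightarrow>\<^sub>E carrier F"
      using extend_zero_closed[OF aC] unfolding v_def carrier_cochains_laurent .
    then have vC: "v \<in> zbasis_at (zlaurent D) 0 q \<rightarrow> carrier F" by auto
    have vn: "smul N (v b) = emb (n b)" if "b \<in> zbasis_at (zlaurent D) 0 q" for b
      using bspec[OF n0, of b] that by (auto simp: v_def extend_zero_apply n_def zbasis_at_poly)
    define z where "z = column D 0 q n"
    have zc: "z \<in> carrier_mat ?n 1" unfolding z_def by (rule column_carrier)
    have dz: "p dvd (d * z) $$ (l, 0)" if l: "l < ?n" for l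
    proof (cases "fst (gens D ! l) = 1 \<and> even (snd (gens D ! l) - q)")
      case True
      then have "(l, (snd (gens D ! l) - q) div 2) \<in> zbasis_at (zlaurent D) (0 + 1) q"
        using l by (auto simp: zbasis_at_laurent)
      then obtain m where lm: "(l, m) \<in> zbasis_at (zlaurent D) (0 + 1) q" by blast
      have "codiff (zlaurent D) F 0 q v (l, m) = \<zero>"
        using a cocycle lm by (simp add: v_def)
      then have "emb ((d * z) $$ (l, 0)) = \<zero>"
        using smul_codiff[OF D vC vn lm] by (simp add: d_def z_def)
      then show ?thesis by (simp add: int_eq_zero_iff)
    next
      case False
      then have "(d * z) $$ (l, 0) = 0"
        using graded_mult_column_support[OF gd l, of 0 q n] by (auto simp: z_def)
      then show ?thesis by simp
    qed
    have zmod: "mod_zero p (d * z)"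
      using dz c zc unfolding mod_zero_def by auto
    have "cocycle_mod p (collapse D) q z"
      unfolding cocycle_mod_def
    proof (intro conjI allI impI)
      fix j assume "j < rk (collapse D)" "z $$ (j, 0) \<noteq> 0"
      then have j: "fst (gens D ! j) = 0" "even (snd (gens D ! j) - q)"
        "(snd (gens D ! j) - q) div 2 \<ge> 0"
        by (auto simp: z_def column_def n_def split: if_splits)
      then show "fst (gens (collapse D) ! j) = 0" "q \<le> snd (gens (collapse D) ! j)"
        "even (snd (gens (collapse D) ! j) - q)" by auto
    qed (use zc zmod in \<open>auto simp: d_def\<close>)
    moreover have "\<not> p dvd (\<phi> * z) $$ (0, 0)"
    proof
      assume dvd: "p dvd (\<phi> * z) $$ (0, 0)"
      obtain y where y: "y \<in> carrier F" "smul N y = \<one>" using smul_inverse[OF N] by blast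
      \<comment> \<open>The primitive \<open>- H z\<close> of the numerators, divided by the denominator \<open>N\<close>.\<close>
      define x where "x = - (H * z)"
      have xc: "x \<in> carrier_mat ?n 1" unfolding x_def using c zc by simp
      have xe: "x $$ (j, 0) = - (H * z) $$ (j, 0)" if "j < ?n" for j
        using that c zc by (simp add: x_def)
      have xcol: "column D (- 1) q (\<lambda>(j, k). x $$ (j, 0)) = x"
      proof (rule column_eq_self[OF xc])
        fix j assume j: "j < ?n" "x $$ (j, 0) \<noteq> 0"
        then show "fst (gens D ! j) = - 1 \<and> even (snd (gens D ! j) - q)"
          using graded_mult_column_support[OF S.graded_H j(1), of 0 q n] xe[OF j(1)]
          by (simp add: z_def)
      qed
      define u where "u = (\<lambda>(j, k)\<in>zbasis_at (zlaurent D) (- 1) q. smul (x $$ (j, 0)) y)"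
      have uC: "u \<in> carrier (cochains (zlaurent D) F (- 1) q)"
        unfolding carrier_cochains_laurent u_def using y by (auto simp: PiE_iff split: prod.split)
      then have uP: "u \<in> zbasis_at (zlaurent D) (- 1) q \<rightarrow> carrier F"
        unfolding carrier_cochains_laurent by auto
      have Nu: "smul N (u b) = emb ((\<lambda>(j, k). x $$ (j, 0)) b)" if "b \<in> zbasis_at (zlaurent D) (- 1) q" for b
      proof (cases b)
        case (Pair j k)
        then show ?thesis
          using that smul_smul[OF y(1), of N "x $$ (j, 0)"] smul_smul[OF y(1), of "x $$ (j, 0)" N] y
          by (simp add: u_def mult.commute[of N])
      qed
      have "codiff (zlaurent D) F (- 1) q u = v"
      proof
        fix b
        show "codiff (zlaurent D) F (- 1) q u b = v b"
        proof (cases "b \<in> zbasis_at (zlaurent D) 0 q")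
          case True
          obtain l m where lm: "b = (l, m)" by (cases b)
          have l: "l < ?n" using True by (simp add: lm zbasis_at_laurent)
          have lm': "(l, m) \<in> zbasis_at (zlaurent D) (- 1 + 1) q" using True lm by simp
          have 1: "smul N (codiff (zlaurent D) F (- 1) q u b) = emb ((d * x) $$ (l, 0))"
            using smul_codiff[OF D uP Nu lm'] unfolding xcol by (simp add: lm d_def)
          have 2: "smul N (v b) = emb (z $$ (l, 0))"
            using vn[OF True] True by (simp add: lm z_def column_entry)
          have "p dvd (d * x) $$ (l, 0) - z $$ (l, 0)"
          proof -
            have e: "d * x = - (d * (H * z))"
              unfolding x_def using c zc by simp
            have "(\<psi> * (\<phi> * z) - z) $$ (l, 0) = (d * (H * z) + H * (d * z)) $$ (l, 0)"
              using S.homotopy_on_vector[of z] zc by (simp add: d_def)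
            moreover have "(\<psi> * (\<phi> * z) - z) $$ (l, 0) = (\<psi> * (\<phi> * z)) $$ (l, 0) - z $$ (l, 0)"
              using zc l by (intro index_minus_mat(1)) auto
            moreover have "(d * (H * z) + H * (d * z)) $$ (l, 0)
                = (d * (H * z)) $$ (l, 0) + (H * (d * z)) $$ (l, 0)"
              using c zc l by (intro index_add_mat(1)) auto
            moreover have "(d * x) $$ (l, 0) = - (d * (H * z)) $$ (l, 0)"
              unfolding e using c zc l by (intro index_uminus_mat(1)) auto
            ultimately have "(d * x) $$ (l, 0) - z $$ (l, 0)
                = (H * (d * z)) $$ (l, 0) - (\<psi> * (\<phi> * z)) $$ (l, 0)" by linarith
            moreover have "p dvd (H * (d * z)) $$ (l, 0)"
              using mod_zeroD[OF mod_zero_mult_right[OF zmod c(4)], of 1 ?n 1 l 0] c zc l by simp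
            moreover have "p dvd (\<psi> * (\<phi> * z)) $$ (l, 0)"
            proof -
              have fz: "\<phi> * z \<in> carrier_mat 1 1" using c zc by simp
              have "mod_zero p (\<phi> * z)" using dvd mod_zero_11_iff[OF fz] by simp
              from mod_zeroD[OF mod_zero_mult_right[OF this c(3) fz], of ?n 1 l 0] show ?thesis
                using c fz l by simp
            qed
            ultimately show ?thesis by simp
          qed
          then have "smul N (codiff (zlaurent D) F (- 1) q u b) = smul N (v b)"
            unfolding 1 2 emb_eq_iff .
          moreover have "codiff (zlaurent D) F (- 1) q u b \<in> carrier F"
            unfolding lm codiff_apply[OF finite_zbasis_at_laurent uP lm']
            using uP by (intro finsum_closed) auto
          ultimately show ?thesis using smul_cancel[OF N] vC True by blast
        next
          case False
          then have "codiff (zlaurent D) F (- 1) q u b = undefined" "v b = undefined"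
            by (simp_all add: codiff_def v_def extend_zero_def)
          then show ?thesis by simp
        qed
      qed
      then have "v \<in> coboundaries (zlaurent D) F 0 q" using uC by (auto simp: coboundaries_def)
      with nb show False by (simp add: v_def)
    qed
    ultimately show "\<exists>z. S.detects p q z" by (auto simp: S.detects_def)
  qed
qed

theorem s_triple_eq:
  assumes LEO: "is_LEO (C, D, f)" and cert: "certificate p (collapse D) s"
  shows "s_triple F (C, D, f) = s"
proof -
  have D: "is_cplx poly_grading D" using LEO by (simp add: is_LEO_def)
  obtain \<phi> \<psi> H where split: "split_cplx (collapse D) \<phi> \<psi> H" using split_cplx_of_LEO[OF LEO] .
  interpret S: split_cplx "collapse D" \<phi> \<psi> H by (rule split)
  have "s_triple F (C, D, f) = (GREATEST q. \<exists>z. S.detects p q z)"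
    by (simp add: s_triple_def nonzero_image_iff[OF is_cplxD(2)[OF D]]
        nonzero_image_iff_detects[OF D split])
  also have "\<dots> = s"
    using S.certificate_detects[OF zero_or_prime cert] by (intro Greatest_equality) auto
  finally show ?thesis .
qed

end



section \<open>Local maps and tensor products of triples\<close>

lemma is_LEO_certificate:
  assumes "is_LEO (C, D, f)" "zero_or_prime p"
  shows "\<exists>s. even s \<and> certificate p (collapse D) s"
proof -
  obtain \<phi> \<psi> H where "split_cplx (collapse D) \<phi> \<psi> H" using split_cplx_of_LEO[OF assms(1)] .
  then show ?thesis using split_cplx.certificate_exists assms(2) by blast
qed

text \<open>At \<open>h = 1\<close> a local map is a homotopy equivalence \<open>b\<close> with inverse \<open>b'\<close> that does not lower the filtration.
  If \<open>z\<close> is a cocycle modulo \<open>p\<close> with \<open>\<phi> z \<noteq> 0\<close>, then \<open>\<phi> b'\<close> is a functional on the target that kills coboundaries and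
  is nonzero on \<open>b z\<close>, so \<open>b z\<close> represents a nonzero class as well.\<close>

lemma local_map_certificate_le:
  assumes T: "is_LEO (C, D, f)" and T': "is_LEO (C', D', f')"
    and map: "local_map (C, D, f) (C', D', f') \<alpha> \<beta>"
    and p: "zero_or_prime p"
    and cert: "certificate p (collapse D) s" and cert': "certificate p (collapse D') s'"
  shows "s \<le> s'"
proof -
  have D: "is_cplx poly_grading D" and D': "is_cplx poly_grading D'"
    using T T' by (simp_all add: is_LEO_def)
  obtain \<phi> \<psi> H where "split_cplx (collapse D) \<phi> \<psi> H" using split_cplx_of_LEO[OF T] .
  then interpret S: split_cplx "collapse D" \<phi> \<psi> H .
  obtain \<phi>' \<psi>' H' where "split_cplx (collapse D') \<phi>' \<psi>' H'" using split_cplx_of_LEO[OF T'] .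
  then interpret S': split_cplx "collapse D'" \<phi>' \<psi>' H' .
  define M M' where "M = collapse D" and "M' = collapse D'"
  define b where "b = map_mat (\<lambda>p :: int poly. poly p 1) \<beta>"
  have \<beta>: "chain_map poly_grading D D' \<beta>"
    and eq: "homotopy_equivalence laurent_grading (localize D) (localize D') (map_mat poly_to_laurent \<beta>)"
    using map by (simp_all add: local_map_def)
  have \<beta>c: "\<beta> \<in> carrier_mat (rk D') (rk D)" using chain_mapD(2)[OF \<beta>] .
  have "map_mat laurent_eval (map_mat poly_to_laurent \<beta>) = b"
    unfolding b_def by (intro eq_matI) (auto simp: laurent_eval_poly_to_laurent)
  then have "homotopy_equivalence parity_grading M M' b"
    using homotopy_equivalence_collapse[OF eq D is_cplx_localize[OF D']]
    by (simp add: base_change_laurent_eval_localize M_def M'_def)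
  then obtain b' where bmap: "chain_map parity_grading M M' b" and b'map: "chain_map parity_grading M' M b'"
    and "homotopic parity_grading M M (b' * b) (1\<^sub>m (rk M))"
    by (auto simp: homotopy_equivalence_def)
  then obtain K where K: "graded_map parity_grading (- 1, 0) M M K"
    and bb: "b' * b - 1\<^sub>m (rk M) = diff M * K + K * diff M"
    by (auto simp: homotopic_def)
  define m m' where "m = rk M" and "m' = rk M'"
  note d = S.carriers[folded M_def m_def] and d' = S'.carriers[folded M'_def m'_def]
  have bc: "b \<in> carrier_mat m' m" and b'c: "b' \<in> carrier_mat m m'" and Kc: "K \<in> carrier_mat m m"
    using chain_mapD(2)[OF bmap] chain_mapD(2)[OF b'map] graded_map_carrier[OF K]
    by (simp_all add: m_def m'_def)
  obtain z where z: "cocycle_mod p M s z" and nd: "\<not> p dvd (\<phi> * z) $$ (0, 0)"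
    using S.certificate_detects(1)[OF p cert] by (auto simp: S.detects_def M_def)
  have zc: "z \<in> carrier_mat m 1" and dz: "mod_zero p (diff M * z)"
    using cocycle_modD[OF z] by (simp_all add: m_def)
  have bz: "b * z \<in> carrier_mat m' 1" using bc zc by simp
  have bz_cocycle: "cocycle_mod p M' s (b * z)"
    unfolding cocycle_mod_def
  proof (intro conjI allI impI)
    fix l assume l: "l < rk M'" and "(b * z) $$ (l, 0) \<noteq> 0"
    then have "(\<Sum>j<m. b $$ (l, j) * z $$ (j, 0)) \<noteq> 0"
      using mult_mat_entry[OF bc zc, of l 0] by (simp add: m'_def)
    then obtain j where "j \<in> {..<m}" "b $$ (l, j) * z $$ (j, 0) \<noteq> 0"
      by (rule sum.not_neutral_contains_not_neutral)
    then have j: "j < m" "b $$ (l, j) \<noteq> 0" "z $$ (j, 0) \<noteq> 0" by auto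
    have lD: "l < rk D'" "j < rk D" using l j by (simp_all add: M'_def M_def m_def)
    have "\<beta> $$ (l, j) \<noteq> 0" using j(2) \<beta>c lD by (auto simp: b_def)
    \<comment> \<open>A nonzero entry of \<open>\<beta>\<close> is a multiple of a power of \<open>h\<close>, so \<open>\<beta>\<close> does not lower the
      quantum degree of generators.\<close>
    then have deg: "fst (gens D' ! l) = fst (gens D ! j)"
      and "\<beta> $$ (l, j) \<in> poly_grading (snd (gens D ! j) - snd (gens D' ! l))"
      using chain_mapD(1)[OF \<beta>] lD by (auto simp: graded_map_def)
    moreover obtain k where "poly.coeff (\<beta> $$ (l, j)) k \<noteq> 0"
      using \<open>\<beta> $$ (l, j) \<noteq> 0\<close> by (metis leading_coeff_0_iff)
    ultimately have "snd (gens D ! j) - snd (gens D' ! l) = - 2 * int k"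
      by (simp add: poly_grading_def)
    moreover have "fst (gens D ! j) = 0" "s \<le> snd (gens D ! j)" "even (snd (gens D ! j) - s)"
      using z j(1,3) by (auto simp: cocycle_mod_def M_def m_def)
    ultimately show "fst (gens M' ! l) = 0" "s \<le> snd (gens M' ! l)" "even (snd (gens M' ! l) - s)"
      using deg by (simp_all add: M'_def) presburger
  next
    have "diff M' * (b * z) = b * (diff M * z)"
      using assoc_mult_mat[OF d'(1) bc zc] assoc_mult_mat[OF bc d(1) zc] chain_mapD(3)[OF bmap] by simp
    then show "mod_zero p (diff M' * (b * z))"
      using mod_zero_mult_right[OF dz bc mult_carrier_mat[OF d(1) zc]] by simp
  qed (use bz in \<open>simp add: m'_def\<close>)
  have c: "\<phi> * b' \<in> carrier_mat 1 m'" using d b'c by simp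
  have "\<phi> * b' * diff M' = \<phi> * diff M * b'"
    using assoc_mult_mat[OF d(2) b'c d'(1)] assoc_mult_mat[OF d(2) d(1) b'c] chain_mapD(3)[OF b'map] by simp
  also have "\<dots> = 0\<^sub>m 1 m'" using S.phi_diff b'c by (simp add: M_def m_def)
  finally have c_diff: "mod_zero p (\<phi> * b' * diff M')" by simp
  have "\<not> p dvd ((\<phi> * b') * (b * z)) $$ (0, 0)"
  proof -
    have fz: "\<phi> * z \<in> carrier_mat 1 1" and fbz: "(\<phi> * b') * (b * z) \<in> carrier_mat 1 1"
      using d zc c bz by auto
    have Xc: "\<phi> * K * (diff M * z) \<in> carrier_mat 1 1"
      by (rule mult_carrier_mat[OF mult_carrier_mat[OF d(2) Kc] mult_carrier_mat[OF d(1) zc]])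
    have "(\<phi> * b') * (b * z) - \<phi> * z = \<phi> * (b' * b * z - z)"
      using mult_minus_distrib_mat[OF d(2), of "b' * b * z" 1 z] assoc_mult_mat[OF d(2) b'c bz]
        assoc_mult_mat[OF b'c bc zc] b'c bc zc by simp
    also have "\<dots> = \<phi> * diff M * (K * z) + \<phi> * K * (diff M * z)"
      unfolding homotopy_apply[OF mult_carrier_mat[OF b'c bc] d(1) Kc zc bb[folded m_def]]
      using mult_add_distrib_mat[OF d(2), of "diff M * (K * z)" 1 "K * (diff M * z)"]
        assoc_mult_mat[OF d(2) d(1) mult_carrier_mat[OF Kc zc]]
        assoc_mult_mat[OF d(2) Kc mult_carrier_mat[OF d(1) zc]]
        d Kc zc by simp
    also have "\<phi> * diff M * (K * z) = 0\<^sub>m 1 1"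
      using S.phi_diff Kc zc by (simp add: M_def[symmetric] m_def[symmetric])
    also have "0\<^sub>m 1 1 + \<phi> * K * (diff M * z) = \<phi> * K * (diff M * z)"
      by (rule left_add_zero_mat[OF Xc])
    finally have e: "(\<phi> * b') * (b * z) - \<phi> * z = \<phi> * K * (diff M * z)" .
    have "mod_zero p (\<phi> * K * (diff M * z))"
      by (rule mod_zero_mult_right[OF dz mult_carrier_mat[OF d(2) Kc] mult_carrier_mat[OF d(1) zc]])
    then have "p dvd ((\<phi> * b') * (b * z) - \<phi> * z) $$ (0, 0)"
      unfolding e using mod_zero_11_iff[OF Xc] by simp
    then have "p dvd ((\<phi> * b') * (b * z)) $$ (0, 0) - (\<phi> * z) $$ (0, 0)"
      unfolding minus_11_entry[OF fbz fz] .
    then show ?thesis using nd by (meson dvd_diff_right_iff)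
  qed
  then have "\<not> p dvd (\<phi>' * (b * z)) $$ (0, 0)"
    using S'.functional_on_cocycle[OF p, of "\<phi> * b'" "b * z"] c c_diff cocycle_modD[OF bz_cocycle]
    by (simp add: M'_def m'_def)
  then have "S'.detects p s (b * z)"
    using bz_cocycle by (simp add: S'.detects_def M'_def)
  then show ?thesis by (rule S'.certificate_detects(2)[OF p cert'])
qed

lemma s_triple_local_equiv:
  assumes F: "prime_field F p" and "(T, T') \<in> local_equiv"
  shows "s_triple F T = s_triple F T'"
proof -
  obtain C D f C' D' f' where T: "T = (C, D, f)" and T': "T' = (C', D', f')"
    by (cases T, cases T') auto
  have LEO: "is_LEO (C, D, f)" "is_LEO (C', D', f')"
    and maps: "\<exists>\<alpha> \<beta>. local_map (C, D, f) (C', D', f') \<alpha> \<beta>"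
      "\<exists>\<alpha> \<beta>. local_map (C', D', f') (C, D, f) \<alpha> \<beta>"
    using assms(2) by (auto simp: local_equiv_def T T')
  have p: "zero_or_prime p" by (rule prime_field.zero_or_prime[OF F])
  obtain s s' where s: "certificate p (collapse D) s" and s': "certificate p (collapse D') s'"
    using is_LEO_certificate[OF LEO(1) p] is_LEO_certificate[OF LEO(2) p] by blast
  have "s \<le> s'" "s' \<le> s"
    using maps local_map_certificate_le[OF LEO _ p s s'] local_map_certificate_le[OF LEO(2,1) _ p s' s]
    by blast+
  then show ?thesis
    using prime_field.s_triple_eq[OF F LEO(1) s] prime_field.s_triple_eq[OF F LEO(2) s']
    by (simp add: T T')
qed

lemma local_equiv_refl:
  assumes "is_LEO T" shows "(T, T) \<in> local_equiv"
proof -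
  obtain C D f where T: "T = (C, D, f)" by (cases T) auto
  have C: "is_cplx trivial_grading C" and D: "is_cplx poly_grading D"
    and f: "homotopy_equivalence trivial_grading (base_change int_mod2 C) (base_change poly_mod2h D) f"
    using assms by (auto simp: T is_LEO_def)
  interpret tr: graded_ring "trivial_grading :: int grading" by (rule graded_ring_trivial)
  interpret tr2: graded_ring "trivial_grading :: bit grading" by (rule graded_ring_trivial)
  interpret po: graded_ring "poly_grading :: int poly grading" by (rule graded_ring_poly)
  interpret la: graded_ring "laurent_grading :: int laurent grading" by (rule graded_ring_laurent)
  interpret h1: ring_hom int_mod2 by (rule ring_hom_int_mod2)
  interpret h2: ring_hom poly_mod2h by (rule ring_hom_poly_mod2h)
  interpret h3: ring_hom "poly_to_laurent :: int poly \<Rightarrow> _" by (rule ring_hom_poly_to_laurent)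
  have fc: "f \<in> carrier_mat (rk D) (rk C)"
    using f by (auto simp: homotopy_equivalence_def dest: chain_mapD(2))
  have "local_map (C, D, f) (C, D, f) (1\<^sub>m (rk C)) (1\<^sub>m (rk D))"
    unfolding local_map_def split
  proof (intro conjI)
    show "chain_map trivial_grading C C (1\<^sub>m (rk C))" by (rule tr.chain_map_one[OF C])
    show "chain_map poly_grading D D (1\<^sub>m (rk D))" by (rule po.chain_map_one[OF D])
    show "homotopy_equivalence laurent_grading (localize D) (localize D) (map_mat poly_to_laurent (1\<^sub>m (rk D)))"
      using la.homotopy_equivalence_one[OF is_cplx_localize[OF D]] by (simp add: h3.mat_hom_one)
    have "is_cplx trivial_grading (base_change int_mod2 C)"
      "is_cplx trivial_grading (base_change poly_mod2h D)"
      using graded_ring_hom.is_cplx_base_change[OF graded_ring_hom_int_mod2 C]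
        graded_ring_hom.is_cplx_base_change[OF graded_ring_hom_poly_mod2h D] by simp_all
    then show "homotopic trivial_grading (base_change int_mod2 C) (base_change poly_mod2h D)
        (f * map_mat int_mod2 (1\<^sub>m (rk C))) (map_mat poly_mod2h (1\<^sub>m (rk D)) * f)"
      using tr2.homotopic_refl[of "base_change int_mod2 C" "base_change poly_mod2h D" f] fc
      by (simp add: h1.mat_hom_one h2.mat_hom_one)
  qed
  then show ?thesis using assms by (auto simp: local_equiv_def T)
qed

lemma is_LEO_tensor:
  assumes "is_LEO T" "is_LEO T'"
  shows "is_LEO (tensor_triple T T')"
proof -
  obtain C D f where T: "T = (C, D, f)" by (cases T) auto
  obtain C' D' f' where T': "T' = (C', D', f')" by (cases T') auto
  have C: "is_cplx trivial_grading C" "is_cplx trivial_grading C'"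
    and D: "is_cplx poly_grading D" "is_cplx poly_grading D'"
    and f: "homotopy_equivalence trivial_grading (base_change int_mod2 C) (base_change poly_mod2h D) f"
    and f': "homotopy_equivalence trivial_grading (base_change int_mod2 C') (base_change poly_mod2h D') f'"
    using assms by (auto simp: T T' is_LEO_def)
  obtain q \<phi> q' \<phi>' where q: "even q" "even q'"
    and \<phi>: "homotopy_equivalence laurent_grading (localize D) (rank_one (0, q)) \<phi>"
    and \<phi>': "homotopy_equivalence laurent_grading (localize D') (rank_one (0, q')) \<phi>'"
    using assms by (auto simp: T T' is_LEO_def)
  interpret tr: graded_ring "trivial_grading :: int grading" by (rule graded_ring_trivial)
  interpret tr2: graded_ring "trivial_grading :: bit grading" by (rule graded_ring_trivial)
  interpret po: graded_ring "poly_grading :: int poly grading" by (rule graded_ring_poly)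
  interpret la: graded_ring "laurent_grading :: int laurent grading" by (rule graded_ring_laurent)
  have "homotopy_equivalence trivial_grading (base_change int_mod2 (tensor C C'))
      (base_change poly_mod2h (tensor D D')) (kron f f')"
    unfolding base_change_tensor[OF ring_hom_int_mod2 C[THEN is_cplxD(2)]]
      base_change_tensor[OF ring_hom_poly_mod2h D[THEN is_cplxD(2)]]
    by (intro tr2.homotopy_equivalence_kron f f' C D
        graded_ring_hom.is_cplx_base_change[OF graded_ring_hom_int_mod2]
        graded_ring_hom.is_cplx_base_change[OF graded_ring_hom_poly_mod2h])
  moreover have "homotopy_equivalence laurent_grading (localize (tensor D D')) (rank_one (0, q + q')) (kron \<phi> \<phi>')"
    using la.homotopy_equivalence_kron[OF is_cplx_localize[OF D(1)] is_cplx_rank_one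
        is_cplx_localize[OF D(2)] is_cplx_rank_one \<phi> \<phi>']
    by (simp add: tensor_rank_one base_change_tensor[OF ring_hom_poly_to_laurent D[THEN is_cplxD(2)]])
  moreover have "even (q + q')" using q by simp
  ultimately show ?thesis
    using tr.is_cplx_tensor[OF C] po.is_cplx_tensor[OF D]
    unfolding T T' tensor_triple_def is_LEO_def split by blast
qed

lemma s_triple_tensor:
  assumes F: "prime_field F p" and T: "is_LEO T" and T': "is_LEO T'"
  shows "s_triple F (tensor_triple T T') = s_triple F T + s_triple F T'"
proof -
  obtain C D f where Teq: "T = (C, D, f)" by (cases T) auto
  obtain C' D' f' where Teq': "T' = (C', D', f')" by (cases T') auto
  have p: "zero_or_prime p" by (rule prime_field.zero_or_prime[OF F])
  have D: "is_cplx poly_grading D" "is_cplx poly_grading D'"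
    using T T' by (simp_all add: Teq Teq' is_LEO_def)
  obtain s s' where s: "certificate p (collapse D) s" and s': "certificate p (collapse D') s'"
    using is_LEO_certificate[OF _ p] T T' unfolding Teq Teq' by blast
  have "certificate p (collapse (tensor D D')) (s + s')"
    unfolding collapse_tensor[OF D]
    by (rule certificate_tensor[OF p is_cplx_collapse[OF D(1)] is_cplx_collapse[OF D(2)] s s'])
  then have "s_triple F (tensor_triple T T') = s + s'"
    using prime_field.s_triple_eq[OF F] is_LEO_tensor[OF T T']
    by (simp add: Teq Teq' tensor_triple_def)
  then show ?thesis
    using prime_field.s_triple_eq[OF F _ s] prime_field.s_triple_eq[OF F _ s'] T T'
    by (simp add: Teq Teq')
qed



section \<open>Triples realizing prescribed invariants\<close>

lemma homotopy_equivalence_rank_oneI: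
  assumes G: "graded_ring G" and M: "is_cplx G M"
    and \<phi>: "graded_map G (0, 0) M (rank_one b) \<phi>" and \<psi>: "graded_map G (0, 0) (rank_one b) M \<psi>"
    and H: "graded_map G (- 1, 0) M M H"
    and "\<phi> * diff M = 0\<^sub>m 1 (rk M)" "diff M * \<psi> = 0\<^sub>m (rk M) 1" "\<phi> * \<psi> = 1\<^sub>m 1"
    and "\<psi> * \<phi> - 1\<^sub>m (rk M) = diff M * H + H * diff M"
  shows "homotopy_equivalence G M (rank_one b) \<phi>"
proof -
  interpret graded_ring G by (rule G)
  have c: "\<phi> \<in> carrier_mat 1 (rk M)" "\<psi> \<in> carrier_mat (rk M) 1"
    using graded_map_carrier[OF \<phi>] graded_map_carrier[OF \<psi>] by simp_all
  have "chain_map G M (rank_one b) \<phi>" "chain_map G (rank_one b) M \<psi>"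
    using assms c by (simp_all add: chain_map_def)
  moreover have "homotopic G M M (\<psi> * \<phi>) (1\<^sub>m (rk M))"
    unfolding homotopic_def using H assms(9) by blast
  moreover have "homotopic G (rank_one b) (rank_one b) (\<phi> * \<psi>) (1\<^sub>m (rk (rank_one b)))"
    using homotopic_refl[OF is_cplx_rank_one is_cplx_rank_one, of "1\<^sub>m 1"] assms(8) by simp
  ultimately show ?thesis unfolding homotopy_equivalence_def by blast
qed

text \<open>Every complex \<open>D\<close> is part of a triple: \<open>C = D/h\<close> satisfies \<open>C/2 = D/(2, h)\<close> on the nose.\<close>

definition quotient_triple :: "int poly cplx \<Rightarrow> triple" where
  "quotient_triple D = (base_change (\<lambda>p. poly p 0) D, D, 1\<^sub>m (rk D))"

lemma is_LEO_quotient_triple: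
  assumes D: "is_cplx poly_grading D" and "even q"
    and "homotopy_equivalence laurent_grading (localize D) (rank_one (0, q)) \<phi>"
  shows "is_LEO (quotient_triple D)"
proof -
  interpret graded_ring "trivial_grading :: bit grading" by (rule graded_ring_trivial)
  have "base_change int_mod2 (base_change (\<lambda>p. poly p 0) D) = base_change poly_mod2h D"
    by (simp add: base_change_base_change poly_mod2h_eq[abs_def])
  then show ?thesis
    using assms graded_ring_hom.is_cplx_base_change[OF graded_ring_hom_poly_0 D]
      homotopy_equivalence_one[OF graded_ring_hom.is_cplx_base_change[OF graded_ring_hom_poly_mod2h D]]
    by (auto simp: is_LEO_def quotient_triple_def)
qed

lemma poly_to_laurent_monom: "poly_to_laurent (Polynomial.monom a k) = Poly_Mapping.single (int k) a"
  by (rule poly_mapping_eqI) (auto simp: lookup_poly_to_laurent lookup_single when_def)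

lemma poly_to_laurent_const: "poly_to_laurent [:a:] = Poly_Mapping.single 0 a"
  using poly_to_laurent_monom[of a 0] by (simp add: monom_0)

lemma poly_to_laurent_zero: "poly_to_laurent 0 = 0"
  by (simp add: poly_to_laurent_def)

lemma single_mem_laurent_grading: "q = - 2 * k \<Longrightarrow> Poly_Mapping.single k a \<in> laurent_grading q"
  by (auto simp: laurent_grading_def lookup_single when_def)

lemma monom_mem_poly_grading: "q = - 2 * int k \<Longrightarrow> Polynomial.monom a k \<in> poly_grading q"
  by (auto simp: poly_grading_def)

lemma const_mem_poly_grading: "[:a:] \<in> poly_grading 0"
  using monom_mem_poly_grading[of 0 0 a] by (simp add: monom_0)

lemma less_3_iff: "i < (3 :: nat) \<longleftrightarrow> i = 0 \<or> i = 1 \<or> i = 2"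
  by auto

lemma all_less_3: "(\<forall>i<(3 :: nat). P i) \<longleftrightarrow> P 0 \<and> P 1 \<and> P 2"
  by (auto simp: less_3_iff)

lemma sum_less_3: "(\<Sum>k<(3 :: nat). f k) = f 0 + f 1 + f 2"
  by (simp add: numeral_3_eq_3 numeral_2_eq_2)

lemma mat_eqI:
  assumes "A \<in> carrier_mat m n" "B \<in> carrier_mat m n"
    and "\<forall>i<m. \<forall>j<n. A $$ (i, j) = B $$ (i, j)"
  shows "A = B"
  using assms by (intro eq_matI) auto

text \<open>The complex \<open>a \<mapsto> n c, b \<mapsto> h\<^sup>k c\<close> with \<open>a, b, c\<close> the generators in this order. After inverting \<open>h\<close> its
  cohomology is generated by \<open>a - n h\<^bsup>-k\<^esup> b\<close>. Over a field in which \<open>n = 0\<close>,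
  the generator \<open>a\<close> is a cocycle of filtration \<open>0\<close>; otherwise every nontrivial cocycle involves \<open>b\<close>, of filtration \<open>-2 k\<close>.\<close>

definition cone_up :: "int \<Rightarrow> nat \<Rightarrow> int poly cplx" where
  "cone_up n k = \<lparr>gens = [(0, 0), (0, - 2 * int k), (1, 0)],
     diff = mat 3 3 (\<lambda>(i, j). if i = 2 \<and> j = 0 then [:n:]
       else if i = 2 \<and> j = 1 then Polynomial.monom 1 k else 0)\<rparr>"

text \<open>The dual complex \<open>x \<mapsto> n y + h\<^sup>k z\<close>. After inverting \<open>h\<close> its cohomology is generated by \<open>y\<close>. Over a
  field in which \<open>n = 0\<close>, the cocycle \<open>z\<close> of filtration \<open>2 k\<close> is a coboundary in \<open>h\<inverse>D\<close>, which leaves \<open>y\<close> of filtration \<open>0\<close>;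
  otherwise \<open>z\<close> represents a nonzero class.\<close>

definition cone_down :: "int \<Rightarrow> nat \<Rightarrow> int poly cplx" where
  "cone_down n k = \<lparr>gens = [(- 1, 0), (0, 0), (0, 2 * int k)],
     diff = mat 3 3 (\<lambda>(i, j). if i = 1 \<and> j = 0 then [:n:]
       else if i = 2 \<and> j = 0 then Polynomial.monom 1 k else 0)\<rparr>"

lemma rk_cone: "rk (cone_up n k) = 3" "rk (cone_down n k) = 3"
  by (simp_all add: cone_up_def cone_down_def)

lemma is_cplx_cone_up: "is_cplx poly_grading (cone_up n k)"
  unfolding is_cplx_def rk_cone
proof
  show "graded_map poly_grading (1, 0) (cone_up n k) (cone_up n k) (diff (cone_up n k))"
    unfolding graded_map_def rk_cone all_less_3
    by (auto simp: cone_up_def const_mem_poly_grading monom_mem_poly_grading)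
  have c: "diff (cone_up n k) \<in> carrier_mat 3 3" by (simp add: cone_up_def)
  show "diff (cone_up n k) * diff (cone_up n k) = 0\<^sub>m 3 3"
    by (rule mat_eqI[where m = 3 and n = 3]) (use c in \<open>simp_all del: index_mult_mat(1)
      add: all_less_3 mult_mat_entry[OF c c] sum_less_3, simp_all add: cone_up_def\<close>)
qed

lemma is_cplx_cone_down: "is_cplx poly_grading (cone_down n k)"
  unfolding is_cplx_def rk_cone
proof
  show "graded_map poly_grading (1, 0) (cone_down n k) (cone_down n k) (diff (cone_down n k))"
    unfolding graded_map_def rk_cone all_less_3
    by (auto simp: cone_down_def const_mem_poly_grading monom_mem_poly_grading)
  have c: "diff (cone_down n k) \<in> carrier_mat 3 3" by (simp add: cone_down_def)
  show "diff (cone_down n k) * diff (cone_down n k) = 0\<^sub>m 3 3"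
    by (rule mat_eqI[where m = 3 and n = 3]) (use c in \<open>simp_all del: index_mult_mat(1)
      add: all_less_3 mult_mat_entry[OF c c] sum_less_3, simp_all add: cone_down_def\<close>)
qed

lemma is_LEO_cone_up: "is_LEO (quotient_triple (cone_up n k))"
proof (rule is_LEO_quotient_triple[OF is_cplx_cone_up, of 0])
  define E where "E = localize (cone_up n k)"
  \<comment> \<open>All entries that occur are multiples of \<open>h\<^sup>m\<^sup>k\<close> with \<open>m\<close> in \<open>{-1, 0, 1}\<close>; in this notation the
    products reduce to arithmetic in \<open>m\<close>.\<close>
  define h where "h m a = Poly_Mapping.single (m * int k) (a :: int)" for m a
  have h_mult: "h m a * h m' a' = h (m + m') (a * a')" for m m' a a'
    by (simp add: h_def mult_single distrib_right)
  have h_neg: "- h m a = h m (- a)" for m a by (simp add: h_def single_uminus)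
  have h_one: "h 0 1 = 1" by (simp add: h_def)
  define \<phi> where "\<phi> = mat 1 3 (\<lambda>(i, j). if j = 0 then 1 else 0 :: int laurent)"
  define \<psi> where "\<psi> = mat 3 1 (\<lambda>(i, j). if i = 0 then 1 else if i = 1 then h (- 1) (- n) else 0)"
  define H where "H = mat 3 3 (\<lambda>(i, j). if i = 1 \<and> j = 2 then h (- 1) (- 1) else 0)"
  have d: "diff E = mat 3 3 (\<lambda>(i, j). if i = 2 \<and> j = 0 then h 0 n
      else if i = 2 \<and> j = 1 then h 1 1 else 0)"
    by (rule mat_eqI[where m = 3 and n = 3])
      (auto simp: E_def cone_up_def all_less_3 poly_to_laurent_monom poly_to_laurent_const
        poly_to_laurent_zero h_def)
  have g: "gens E = [(0, 0), (0, - 2 * int k), (1, 0)]" and rk: "rk E = 3"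
    by (simp_all add: E_def cone_up_def)
  have c: "diff E \<in> carrier_mat 3 3" "\<phi> \<in> carrier_mat 1 3" "\<psi> \<in> carrier_mat 3 1" "H \<in> carrier_mat 3 3"
    by (simp_all add: d \<phi>_def \<psi>_def H_def)
  show "homotopy_equivalence laurent_grading (localize (cone_up n k)) (rank_one (0, 0)) \<phi>"
    unfolding E_def[symmetric]
  proof (rule homotopy_equivalence_rank_oneI[OF graded_ring_laurent])
    show "is_cplx laurent_grading E" unfolding E_def by (rule is_cplx_localize[OF is_cplx_cone_up])
    have one: "(1 :: int laurent) \<in> laurent_grading 0"
      by (rule graded_ring.one_mem[OF graded_ring_laurent])
    show "graded_map laurent_grading (0, 0) E (rank_one (0, 0)) \<phi>"
      unfolding graded_map_def rk all_less_3 by (auto simp: g \<phi>_def one)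
    show "graded_map laurent_grading (0, 0) (rank_one (0, 0)) E \<psi>"
      unfolding graded_map_def rk all_less_3
      by (auto simp: g \<psi>_def h_def one intro!: single_mem_laurent_grading)
    show "graded_map laurent_grading (- 1, 0) E E H"
      unfolding graded_map_def rk all_less_3
      by (auto simp: g H_def h_def intro!: single_mem_laurent_grading)
    show "\<phi> * diff E = 0\<^sub>m 1 (rk E)"
      unfolding rk
    proof (rule mat_eqI[OF mult_carrier_mat[OF c(2,1)] zero_carrier_mat])
      show "\<forall>i<1. \<forall>j<3. (\<phi> * diff E) $$ (i, j) = 0\<^sub>m 1 3 $$ (i, j)"
        by (simp del: index_mult_mat(1) add: all_less_3 mult_mat_entry[OF c(2,1)] sum_less_3)
          (simp add: \<phi>_def d)
    qed
    show "diff E * \<psi> = 0\<^sub>m (rk E) 1"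
      unfolding rk
    proof (rule mat_eqI[OF mult_carrier_mat[OF c(1,3)] zero_carrier_mat])
      show "\<forall>i<3. \<forall>j<1. (diff E * \<psi>) $$ (i, j) = 0\<^sub>m 3 1 $$ (i, j)"
        by (simp del: index_mult_mat(1) add: all_less_3 mult_mat_entry[OF c(1,3)] sum_less_3)
          (simp add: \<psi>_def d h_mult h_neg[symmetric])
    qed
    show "\<phi> * \<psi> = 1\<^sub>m 1"
    proof (rule mat_eqI[OF mult_carrier_mat[OF c(2,3)] one_carrier_mat])
      show "\<forall>i<1. \<forall>j<1. (\<phi> * \<psi>) $$ (i, j) = 1\<^sub>m 1 $$ (i, j)"
        by (simp del: index_mult_mat(1) add: mult_mat_entry[OF c(2,3)] sum_less_3)
          (simp add: \<phi>_def \<psi>_def)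
    qed
    have p: "\<psi> * \<phi> \<in> carrier_mat 3 3" "diff E * H \<in> carrier_mat 3 3" "H * diff E \<in> carrier_mat 3 3"
      using c by auto
    show "\<psi> * \<phi> - 1\<^sub>m (rk E) = diff E * H + H * diff E"
      unfolding rk
    proof (rule mat_eqI[where m = 3 and n = 3])
      show "\<forall>i<3. \<forall>j<3. (\<psi> * \<phi> - 1\<^sub>m 3) $$ (i, j) = (diff E * H + H * diff E) $$ (i, j)"
        using p c unfolding all_less_3
        by (simp del: index_mult_mat(1) add: mult_mat_entry[OF c(3,2)] mult_mat_entry[OF c(1,4)]
            mult_mat_entry[OF c(4,1)] sum_less_3)
          (simp add: \<psi>_def \<phi>_def H_def d h_mult h_neg h_one[symmetric])
    qed (use p in auto)
  qed
qed simp



lemma is_LEO_cone_down: "is_LEO (quotient_triple (cone_down n k))"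
proof (rule is_LEO_quotient_triple[OF is_cplx_cone_down, of 0])
  define E where "E = localize (cone_down n k)"
  \<comment> \<open>The same notation for multiples of \<open>h\<^sup>m\<^sup>k\<close>.\<close>
  define h where "h m a = Poly_Mapping.single (m * int k) (a :: int)" for m a
  have h_mult: "h m a * h m' a' = h (m + m') (a * a')" for m m' a a'
    by (simp add: h_def mult_single distrib_right)
  have h_neg: "- h m a = h m (- a)" for m a by (simp add: h_def single_uminus)
  have h_one: "h 0 1 = 1" by (simp add: h_def)
  define \<phi> where "\<phi> = mat 1 3 (\<lambda>(i, j). if j = 1 then 1 else if j = 2 then h (- 1) (- n) else 0)"
  define \<psi> where "\<psi> = mat 3 1 (\<lambda>(i, j). if i = 1 then 1 else 0 :: int laurent)"
  define H where "H = mat 3 3 (\<lambda>(i, j). if i = 0 \<and> j = 2 then h (- 1) (- 1) else 0)"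
  have d: "diff E = mat 3 3 (\<lambda>(i, j). if i = 1 \<and> j = 0 then h 0 n
      else if i = 2 \<and> j = 0 then h 1 1 else 0)"
    by (rule mat_eqI[where m = 3 and n = 3])
      (auto simp: E_def cone_down_def all_less_3 poly_to_laurent_monom poly_to_laurent_const
        poly_to_laurent_zero h_def)
  have g: "gens E = [(- 1, 0), (0, 0), (0, 2 * int k)]" and rk: "rk E = 3"
    by (simp_all add: E_def cone_down_def)
  have c: "diff E \<in> carrier_mat 3 3" "\<phi> \<in> carrier_mat 1 3" "\<psi> \<in> carrier_mat 3 1" "H \<in> carrier_mat 3 3"
    by (simp_all add: d \<phi>_def \<psi>_def H_def)
  show "homotopy_equivalence laurent_grading (localize (cone_down n k)) (rank_one (0, 0)) \<phi>"
    unfolding E_def[symmetric]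
  proof (rule homotopy_equivalence_rank_oneI[OF graded_ring_laurent])
    show "is_cplx laurent_grading E" unfolding E_def by (rule is_cplx_localize[OF is_cplx_cone_down])
    have one: "(1 :: int laurent) \<in> laurent_grading 0"
      by (rule graded_ring.one_mem[OF graded_ring_laurent])
    show "graded_map laurent_grading (0, 0) E (rank_one (0, 0)) \<phi>"
      unfolding graded_map_def rk all_less_3
      by       (auto simp: g \<phi>_def h_def one intro!: single_mem_laurent_grading)
    show "graded_map laurent_grading (0, 0) (rank_one (0, 0)) E \<psi>"
      unfolding graded_map_def rk all_less_3
      by (auto simp: g \<psi>_def one)
    show "graded_map laurent_grading (- 1, 0) E E H"
      unfolding graded_map_def rk all_less_3
      by (auto simp: g H_def h_def intro!: single_mem_laurent_grading)
    show "\<phi> * diff E = 0\<^sub>m 1 (rk E)"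
      unfolding rk
    proof (rule mat_eqI[OF mult_carrier_mat[OF c(2,1)] zero_carrier_mat])
      show "\<forall>i<1. \<forall>j<3. (\<phi> * diff E) $$ (i, j) = 0\<^sub>m 1 3 $$ (i, j)"
        by (simp del: index_mult_mat(1) add: all_less_3 mult_mat_entry[OF c(2,1)] sum_less_3)
          (simp add: \<phi>_def d h_mult h_neg[symmetric])
    qed
    show "diff E * \<psi> = 0\<^sub>m (rk E) 1"
      unfolding rk
    proof (rule mat_eqI[OF mult_carrier_mat[OF c(1,3)] zero_carrier_mat])
      show "\<forall>i<3. \<forall>j<1. (diff E * \<psi>) $$ (i, j) = 0\<^sub>m 3 1 $$ (i, j)"
        by (simp del: index_mult_mat(1) add: all_less_3 mult_mat_entry[OF c(1,3)] sum_less_3)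
          (simp add: \<psi>_def d)
    qed
    show "\<phi> * \<psi> = 1\<^sub>m 1"
    proof (rule mat_eqI[OF mult_carrier_mat[OF c(2,3)] one_carrier_mat])
      show "\<forall>i<1. \<forall>j<1. (\<phi> * \<psi>) $$ (i, j) = 1\<^sub>m 1 $$ (i, j)"
        by (simp del: index_mult_mat(1) add: mult_mat_entry[OF c(2,3)] sum_less_3)
          (simp add: \<phi>_def \<psi>_def)
    qed
    have p: "\<psi> * \<phi> \<in> carrier_mat 3 3" "diff E * H \<in> carrier_mat 3 3" "H * diff E \<in> carrier_mat 3 3"
      using c by auto
    show "\<psi> * \<phi> - 1\<^sub>m (rk E) = diff E * H + H * diff E"
      unfolding rk
    proof (rule mat_eqI[where m = 3 and n = 3])
      show "\<forall>i<3. \<forall>j<3. (\<psi> * \<phi> - 1\<^sub>m 3) $$ (i, j) = (diff E * H + H * diff E) $$ (i, j)"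
        using p c unfolding all_less_3
        by (simp del: index_mult_mat(1) add: mult_mat_entry[OF c(3,2)] mult_mat_entry[OF c(1,4)]
            mult_mat_entry[OF c(4,1)] sum_less_3)
          (simp add: \<psi>_def \<phi>_def H_def d h_mult h_neg h_one[symmetric])
    qed (use p in auto)
  qed
qed simp


lemma certificateI:
  assumes "cocycle_mod p M s z" "functional_mod p M s l" "\<not> p dvd (l * z) $$ (0, 0)"
  shows "certificate p M s"
  using assms by (auto simp: certificate_def)

lemma mod_zeroI:
  assumes "A \<in> carrier_mat m n" "\<forall>i<m. \<forall>j<n. p dvd A $$ (i, j)"
  shows "mod_zero p A"
  using assms by (auto simp: mod_zero_def)

lemma certificate_3I:
  fixes z l :: "int mat"
  assumes rk: "rk M = 3" and c: "diff M \<in> carrier_mat 3 3" "z \<in> carrier_mat 3 1" "l \<in> carrier_mat 1 3"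
    and z: "\<forall>j<3. z $$ (j, 0) \<noteq> 0 \<longrightarrow>
        fst (gens M ! j) = 0 \<and> s \<le> snd (gens M ! j) \<and> even (snd (gens M ! j) - s)"
    and l: "\<forall>j<3. \<not> p dvd l $$ (0, j) \<longrightarrow>
        fst (gens M ! j) = 0 \<and> snd (gens M ! j) \<le> s \<and> even (snd (gens M ! j) - s)"
    and dz: "\<forall>i<3. p dvd (\<Sum>k<3. diff M $$ (i, k) * z $$ (k, 0))"
    and ld: "\<forall>j<3. p dvd (\<Sum>k<3. l $$ (0, k) * diff M $$ (k, j))"
    and nd: "\<not> p dvd (\<Sum>k<3. l $$ (0, k) * z $$ (k, 0))"
  shows "certificate p M s"
proof (rule certificateI)
  have "mod_zero p (diff M * z)"
    by (rule mod_zeroI[OF mult_carrier_mat[OF c(1,2)]])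
      (use dz in \<open>simp del: index_mult_mat(1) add: mult_mat_entry[OF c(1,2)]\<close>)
  then show "cocycle_mod p M s z" using z c rk by (simp add: cocycle_mod_def)
  have "mod_zero p (l * diff M)"
    by (rule mod_zeroI[OF mult_carrier_mat[OF c(3,1)]])
      (use ld in \<open>simp del: index_mult_mat(1) add: mult_mat_entry[OF c(3,1)]\<close>)
  then show "functional_mod p M s l" using l c rk by (simp add: functional_mod_def)
  show "\<not> p dvd (l * z) $$ (0, 0)" using nd mult_mat_entry[OF c(3,2), of 0 0] by simp
qed

text \<open>Cocycle and functional are \<open>a\<close> and its dual if \<open>p\<close> divides \<open>n\<close>, and \<open>a - n b\<close> and the dual of \<open>b\<close>
  otherwise.\<close>

lemma certificate_cone_up:
  assumes p: "zero_or_prime p"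
  shows "certificate p (collapse (cone_up n k)) (if p dvd n then 0 else - 2 * int k)"
proof -
  define M where "M = collapse (cone_up n k)"
  have g: "gens M = [(0, 0), (0, - 2 * int k), (1, 0)]" and rk: "rk M = 3"
    by (simp_all add: M_def cone_up_def)
  have d: "diff M = mat 3 3 (\<lambda>(i, j). if i = 2 \<and> j = 0 then n else if i = 2 \<and> j = 1 then 1 else 0)"
    by (rule mat_eqI[where m = 3 and n = 3]) (auto simp: M_def cone_up_def all_less_3 poly_monom)
  show ?thesis
  proof (cases "p dvd n")
    case True
    have "certificate p M 0"
      by (rule certificate_3I[where z = "mat 3 1 (\<lambda>(i, j). if i = 0 then 1 else 0)"
            and l = "mat 1 3 (\<lambda>(i, j). if j = 0 then 1 else 0)"])
        (use True p zero_or_prime_not_dvd_one[OF p] in \<open>auto simp: rk g d all_less_3 sum_less_3\<close>)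
    with True show ?thesis by (simp add: M_def)
  next
    case False
    have "certificate p M (- 2 * int k)"
      by (rule certificate_3I[where z = "mat 3 1 (\<lambda>(i, j). if i = 0 then 1 else if i = 1 then - n else 0)"
            and l = "mat 1 3 (\<lambda>(i, j). if j = 1 then 1 else 0)"])
        (use False in \<open>auto simp: rk g d all_less_3 sum_less_3\<close>)
    with False show ?thesis by (simp add: M_def)
  qed
qed

text \<open>Cocycle and functional are \<open>y\<close> and its dual if \<open>p\<close> divides \<open>n\<close>; otherwise \<open>z\<close> and the functional with
  values \<open>1\<close> on \<open>y\<close> and \<open>-n\<close> on \<open>z\<close>, which kills the coboundary \<open>n y + z\<close>.\<close>

lemma certificate_cone_down:
  assumes p: "zero_or_prime p"
  shows "certificate p (collapse (cone_down n k)) (if p dvd n then 0 else 2 * int k)"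
proof -
  define M where "M = collapse (cone_down n k)"
  have g: "gens M = [(- 1, 0), (0, 0), (0, 2 * int k)]" and rk: "rk M = 3"
    by (simp_all add: M_def cone_down_def)
  have d: "diff M = mat 3 3 (\<lambda>(i, j). if i = 1 \<and> j = 0 then n else if i = 2 \<and> j = 0 then 1 else 0)"
    by (rule mat_eqI[where m = 3 and n = 3]) (auto simp: M_def cone_down_def all_less_3 poly_monom)
  show ?thesis
  proof (cases "p dvd n")
    case True
    have "certificate p M 0"
      by (rule certificate_3I[where z = "mat 3 1 (\<lambda>(i, j). if i = 1 then 1 else 0)"
            and l = "mat 1 3 (\<lambda>(i, j). if j = 1 then 1 else 0)"])
        (use True p zero_or_prime_not_dvd_one[OF p] in \<open>auto simp: rk g d all_less_3 sum_less_3\<close>)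
    with True show ?thesis by (simp add: M_def)
  next
    case False
    have "certificate p M (2 * int k)"
      by (rule certificate_3I[where z = "mat 3 1 (\<lambda>(i, j). if i = 2 then 1 else 0)"
            and l = "mat 1 3 (\<lambda>(i, j). if j = 1 then 1 else if j = 2 then - n else 0)"])
        (use False in \<open>auto simp: rk g d all_less_3 sum_less_3\<close>)
    with False show ?thesis by (simp add: M_def)
  qed
qed

lemma certificate_rank_one:
  assumes p: "zero_or_prime p"
  shows "certificate p (collapse (rank_one (0, q))) q"
proof -
  have e: "collapse (rank_one (0, q)) = rank_one (0, q)" by (rule base_change_rank_one[OF ring_hom_poly])
  show ?thesis unfolding e
  proof (rule certificateI)
    show "cocycle_mod p (rank_one (0, q)) q (1\<^sub>m 1)" "functional_mod p (rank_one (0, q)) q (1\<^sub>m 1)"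
      by (simp_all add: cocycle_mod_def functional_mod_def mod_zero_def)
    show "\<not> p dvd (1\<^sub>m 1 * 1\<^sub>m 1) $$ (0, 0)"
      using zero_or_prime_not_dvd_one[OF p] by simp
  qed
qed

lemma is_LEO_rank_one: "even q \<Longrightarrow> is_LEO (quotient_triple (rank_one (0, q)))"
proof (rule is_LEO_quotient_triple[OF is_cplx_rank_one])
  have e: "localize (rank_one (0, q)) = rank_one (0, q)"
    by (rule base_change_rank_one[OF ring_hom_poly_to_laurent])
  show "homotopy_equivalence laurent_grading (localize (rank_one (0, q))) (rank_one (0, q)) (1\<^sub>m 1)"
    unfolding e
    using graded_ring.homotopy_equivalence_one[OF graded_ring_laurent is_cplx_rank_one, of "(0, q)"] by simp
qed

text \<open>The value \<open>t p\<close> belongs to the prime field of characteristic \<open>p\<close>. All characteristics are recorded at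
  once, so that one construction controls the whole tuple.\<close>

definition realizes :: "triple \<Rightarrow> (int \<Rightarrow> int) \<Rightarrow> bool" where
  "realizes T t \<longleftrightarrow> is_LEO T \<and> (\<forall>p. zero_or_prime p \<longrightarrow> certificate p (collapse (fst (snd T))) (t p))"

lemma realizes_tensor:
  assumes T: "realizes T t" and T': "realizes T' t'"
  shows "realizes (tensor_triple T T') (\<lambda>p. t p + t' p)"
proof -
  obtain C D f C' D' f' where Teq: "T = (C, D, f)" "T' = (C', D', f')" by (cases T, cases T') auto
  have D: "is_cplx poly_grading D" "is_cplx poly_grading D'"
    using T T' by (simp_all add: realizes_def Teq is_LEO_def)
  have "certificate p (collapse (tensor D D')) (t p + t' p)" if p: "zero_or_prime p" for p
    unfolding collapse_tensor[OF D]
    by (rule certificate_tensor[OF p is_cplx_collapse[OF D(1)] is_cplx_collapse[OF D(2)]])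
      (use T T' p in \<open>auto simp: realizes_def Teq\<close>)
  then show ?thesis
    using is_LEO_tensor[of T T'] T T' by (simp add: realizes_def Teq tensor_triple_def)
qed

lemma realizes_cone: "\<exists>T. realizes T (\<lambda>p. if p dvd n then 0 else 2 * k)"
proof (cases "k \<ge> 0")
  case True
  have "realizes (quotient_triple (cone_down n (nat k))) (\<lambda>p. if p dvd n then 0 else 2 * int (nat k))"
    using is_LEO_cone_down certificate_cone_down unfolding realizes_def quotient_triple_def by auto
  moreover have "2 * int (nat k) = 2 * k" using True by simp
  ultimately show ?thesis by (intro exI[of _ "quotient_triple (cone_down n (nat k))"]) (simp only:)
next
  case False
  have "realizes (quotient_triple (cone_up n (nat (- k)))) (\<lambda>p. if p dvd n then 0 else - 2 * int (nat (- k)))"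
    using is_LEO_cone_up certificate_cone_up unfolding realizes_def quotient_triple_def by auto
  moreover have "- 2 * int (nat (- k)) = 2 * k" using False by simp
  ultimately show ?thesis by (intro exI[of _ "quotient_triple (cone_up n (nat (- k)))"]) (simp only:)
qed

lemma realizes_sum:
  assumes "finite S" "even q"
  shows "\<exists>T. realizes T (\<lambda>p. q + (\<Sum>m\<in>S. if p dvd n m then 0 else 2 * k m))"
  using assms(1)
proof (induction S rule: finite_induct)
  case empty
  have "realizes (quotient_triple (rank_one (0, q))) (\<lambda>p. q)"
    using is_LEO_rank_one[OF \<open>even q\<close>] certificate_rank_one by (simp add: realizes_def quotient_triple_def)
  then show ?case by (intro exI[of _ "quotient_triple (rank_one (0, q))"]) simp
next
  case (insert a S)
  then obtain T where T: "realizes T (\<lambda>p. q + (\<Sum>m\<in>S. if p dvd n m then 0 else 2 * k m))" by blast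
  obtain T' where T': "realizes T' (\<lambda>p. if p dvd n a then 0 else 2 * k a)" using realizes_cone by blast
  have "(\<lambda>p. q + (\<Sum>m\<in>S. if p dvd n m then 0 else 2 * k m) + (if p dvd n a then 0 else 2 * k a))
      = (\<lambda>p. q + (\<Sum>m\<in>insert a S. if p dvd n m then 0 else 2 * k m))"
    using insert.hyps by (simp add: add_ac)
  then show ?case using realizes_tensor[OF T T'] by (intro exI[of _ "tensor_triple T T'"]) simp
qed



section \<open>The tuple of invariants\<close>

definition nth_prime :: "nat \<Rightarrow> nat" where
  "nth_prime m = enumerate {p::nat. normalization_semidom_class.prime p} m"

lemma prime_nth_prime: "normalization_semidom_class.prime (nth_prime m)"
  using enumerate_in_set[OF primes_infinite, of m] by (simp add: nth_prime_def)

lemma inj_nth_prime: "inj nth_prime"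
  unfolding nth_prime_def[abs_def] using primes_infinite
  by (intro strict_mono_imp_inj_on strict_monoI enumerate_mono) auto

lemma prime_field_nth_prime: "prime_field (residue_ring (int (nth_prime m))) (int (nth_prime m))"
  by (rule prime_field_residue_ring[OF prime_nth_prime])

text \<open>The tuple of a representative, as opposed to that of a class.\<close>

definition s_tuple :: "triple \<Rightarrow> nat \<Rightarrow> int" where
  "s_tuple T n = (case n of
     0 \<Rightarrow> s_triple rat_field T
   | Suc m \<Rightarrow> s_triple (residue_ring (int (nth_prime m))) T - s_triple rat_field T)"

text \<open>The set \<open>U\<close> is kept arbitrary so that the lemma applies both to a class and to a product of classes,
  which is a union of classes.\<close>

lemma s_vec_eq:
  assumes "U \<noteq> {}" "\<And>A. A \<in> U \<Longrightarrow> s_tuple A = s_tuple T"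
  shows "s_vec U = s_tuple T"
proof -
  have s_inv: "s_inv F U = s_triple F T" if "\<And>A. A \<in> U \<Longrightarrow> s_triple F A = s_triple F T"
    for F :: "'a ring"
  proof -
    have "s_triple F ` U = {s_triple F T}" using assms(1) that by auto
    then show ?thesis by (simp add: s_inv_def)
  qed
  have rat: "s_triple rat_field A = s_triple rat_field T" if "A \<in> U" for A
    using fun_cong[OF assms(2)[OF that], of 0] by (simp add: s_tuple_def)
  have "s_triple (residue_ring (int (nth_prime m))) A = s_triple (residue_ring (int (nth_prime m))) T"
    if "A \<in> U" for A m
    using fun_cong[OF assms(2)[OF that], of "Suc m"] rat[OF that] by (simp add: s_tuple_def)
  then show ?thesis
    using rat by (intro ext) (simp add: s_vec_def s_tuple_def s_inv nth_prime_def[symmetric] split: nat.split)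
qed

lemma s_tuple_local_equiv: "(T, T') \<in> local_equiv \<Longrightarrow> s_tuple T = s_tuple T'"
  using s_triple_local_equiv[OF prime_field_rat] s_triple_local_equiv[OF prime_field_nth_prime]
  by (intro ext) (simp add: s_tuple_def split: nat.split)

lemma s_tuple_tensor:
  assumes "is_LEO T" "is_LEO T'"
  shows "s_tuple (tensor_triple T T') = (\<lambda>n. s_tuple T n + s_tuple T' n)"
  using s_triple_tensor[OF prime_field_rat assms] s_triple_tensor[OF prime_field_nth_prime assms]
  by (intro ext) (simp add: s_tuple_def split: nat.split)

text \<open>A certificate over \<open>\<rat>\<close> is valid for all primes that do not divide some integer \<open>N \<noteq> 0\<close>; for these the
  entry is the difference of two equal values.\<close>

lemma s_tuple_even_finite:
  assumes "is_LEO T"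
  shows "even (s_tuple T n)" "finite {n. s_tuple T n \<noteq> 0}"
proof -
  obtain C D f where T: "T = (C, D, f)" by (cases T) auto
  note LEO = assms[unfolded T]
  have even: "even (s_triple F T)" if F: "prime_field F p" for F :: "'a ring" and p
    using is_LEO_certificate[OF LEO prime_field.zero_or_prime[OF F]] prime_field.s_triple_eq[OF F LEO]
    by (auto simp: T)
  show "even (s_tuple T n)"
    using even[OF prime_field_rat] even[OF prime_field_nth_prime]
    by (simp add: s_tuple_def split: nat.split)
  have zero: "zero_or_prime 0" by (simp add: zero_or_prime_def)
  obtain s where s: "certificate 0 (collapse D) s" using is_LEO_certificate[OF LEO zero] by blast
  obtain N where "N \<noteq> 0" and N: "\<And>p. \<not> p dvd N \<Longrightarrow> certificate p (collapse D) s"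
    using certificate_zero_imp_finite_exceptions[OF s] by blast
  have "s_tuple T (Suc m) = 0" if "\<not> int (nth_prime m) dvd N" for m
    using prime_field.s_triple_eq[OF prime_field_rat LEO s]
      prime_field.s_triple_eq[OF prime_field_nth_prime LEO N[OF that]]
    by (simp add: s_tuple_def T)
  then have "{n. s_tuple T n \<noteq> 0} \<subseteq> insert 0 (Suc ` {m. int (nth_prime m) dvd N})"
    by (auto simp: image_iff) (metis not0_implies_Suc)
  moreover have "finite {m. int (nth_prime m) dvd N}"
  proof -
    have "finite {d. d dvd N}" using \<open>N \<noteq> 0\<close> by simp
    moreover have "inj (\<lambda>m. int (nth_prime m))" using inj_nth_prime by (auto simp: inj_on_def)
    ultimately show ?thesis using finite_vimageI[of "{d. d dvd N}" "\<lambda>m. int (nth_prime m)"]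
      by (simp add: vimage_def)
  qed
  ultimately show "finite {n. s_tuple T n \<noteq> 0}" by (meson finite_imageI finite_insert finite_subset)
qed

text \<open>The factor for the prime with index \<open>m\<close> has \<open>s = 0\<close> in that characteristic and \<open>s = - t (Suc m)\<close> in all
  others, so it raises the difference to \<open>s\<^sub>\<rat>\<close> by \<open>t (Suc m)\<close> at this prime only. The shift \<open>q\<close> compensates
  the sum of these values in characteristic 0.\<close>

lemma s_tuple_surj:
  assumes even: "\<And>n. even (t n)" and fin: "finite {n. t n \<noteq> (0 :: int)}"
  shows "\<exists>T. is_LEO T \<and> s_tuple T = t"
proof -
  define S where "S = {m. t (Suc m) \<noteq> 0}"
  have S: "finite S"
    using finite_vimageI[OF fin, of Suc] by (simp add: S_def vimage_def)
  define q where "q = t 0 + (\<Sum>m\<in>S. t (Suc m))"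
  have "even q" unfolding q_def using even by (simp add: dvd_sum)
  have ex: "\<exists>T. realizes T (\<lambda>p. q + (\<Sum>m\<in>S.
      if p dvd int (nth_prime m) then 0 else 2 * (- (t (Suc m) div 2))))"
    by (rule realizes_sum[OF S \<open>even q\<close>])
  have half: "2 * (- (t (Suc m) div 2)) = - t (Suc m)" for m using even[of "Suc m"] by simp
  define val where "val p = q - (\<Sum>m\<in>S. if p dvd int (nth_prime m) then 0 else t (Suc m))" for p
  have "(\<lambda>p. q + (\<Sum>m\<in>S. if p dvd int (nth_prime m) then 0 else 2 * (- (t (Suc m) div 2)))) = val"
    unfolding half val_def
    by (auto simp: fun_eq_iff sum_negf[symmetric] simp del: sum_negf intro!: sum.cong)
  with ex obtain T where T: "realizes T val" by (elim exE) (simp only:)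
  obtain C D f where Teq: "T = (C, D, f)" by (cases T) auto
  have LEO: "is_LEO (C, D, f)" and cert: "\<And>p. zero_or_prime p \<Longrightarrow> certificate p (collapse D) (val p)"
    using T by (simp_all add: realizes_def Teq)
  have s: "s_triple F T = val p" if F: "prime_field F p" for F :: "'a ring" and p
    using prime_field.s_triple_eq[OF F LEO cert[OF prime_field.zero_or_prime[OF F]]] by (simp add: Teq)
  have nonzero: "(nth_prime m = 0) = False" for m
    using prime_gt_0_nat[OF prime_nth_prime, of m] by simp
  have val_0: "val 0 = t 0" by (simp add: val_def q_def nonzero)
  have val_prime: "val (int (nth_prime m)) = t 0 + t (Suc m)" for m
  proof -
    have dvd: "nth_prime m dvd nth_prime l \<longleftrightarrow> l = m" for l
      using primes_dvd_imp_eq[OF prime_nth_prime prime_nth_prime] inj_nth_prime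
      by (auto simp: inj_on_def)
    have "(\<Sum>l\<in>S. t (Suc l)) - (\<Sum>l\<in>S. if l = m then 0 else t (Suc l))
        = (\<Sum>l\<in>S. if l = m then t (Suc m) else 0)"
      unfolding sum_subtractf[symmetric] by (rule sum.cong) auto
    also have "\<dots> = t (Suc m)" using S by (simp add: S_def)
    finally show ?thesis by (simp add: val_def q_def dvd)
  qed
  have "s_tuple T = t"
    by (rule ext) (simp add: s_tuple_def s[OF prime_field_rat] s[OF prime_field_nth_prime]
        val_0 val_prime split: nat.split)
  then show ?thesis using LEO by (auto simp: Teq)
qed

lemma even_integers_simps:
  "carrier even_integers = {n. even n}" "x \<otimes>\<^bsub>even_integers\<^esub> y = x + y" "\<one>\<^bsub>even_integers\<^esub> = 0"
  by (simp_all add: even_integers_def integer_group_def)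

lemma group_even_integers: "group even_integers"
proof (rule groupI)
  fix x assume "x \<in> carrier even_integers"
  then show "\<exists>y\<in>carrier even_integers. y \<otimes>\<^bsub>even_integers\<^esub> x = \<one>\<^bsub>even_integers\<^esub>"
    by (intro bexI[of _ "- x"]) (simp_all add: even_integers_simps)
qed (auto simp: even_integers_simps)

lemma carrier_target:
  "carrier (sum_group (UNIV :: nat set) (\<lambda>_. even_integers))
    = {t. (\<forall>n. even (t n)) \<and> finite {n. t n \<noteq> 0}}"
  using group_even_integers by (subst carrier_sum_group) (auto simp: even_integers_simps PiE_iff)

theorem proposition3p22:
  shows "s_vec \<in> epi LEO_group (sum_group (UNIV :: nat set) (\<lambda>_. even_integers))"
proof -
  let ?G = "sum_group (UNIV :: nat set) (\<lambda>_. even_integers)"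
  have s_class: "s_vec (local_equiv `` {T}) = s_tuple T" if "is_LEO T" for T
  proof (rule s_vec_eq)
    show "local_equiv `` {T} \<noteq> {}" using local_equiv_refl[OF that] by blast
    show "s_tuple A = s_tuple T" if "A \<in> local_equiv `` {T}" for A
      using s_tuple_local_equiv[of T A] that by simp
  qed
  have carrier: "U \<in> carrier LEO_group \<longleftrightarrow> (\<exists>T. is_LEO T \<and> U = local_equiv `` {T})" for U
    by (auto simp: LEO_group_def quotient_def)
  have "s_vec \<in> hom LEO_group ?G"
  proof (rule homI)
    fix U assume "U \<in> carrier LEO_group"
    then obtain T where T: "is_LEO T" and U: "U = local_equiv `` {T}" using carrier by blast
    show "s_vec U \<in> carrier ?G"
      unfolding U s_class[OF T] carrier_target using s_tuple_even_finite[OF T] by simp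
  next
    fix U V assume "U \<in> carrier LEO_group" "V \<in> carrier LEO_group"
    then obtain T T' where T: "is_LEO T" "is_LEO T'"
      and U: "U = local_equiv `` {T}" and V: "V = local_equiv `` {T'}" using carrier by metis
    let ?W = "U \<otimes>\<^bsub>LEO_group\<^esub> V"
    have W: "?W = (\<Union>A\<in>U. \<Union>B\<in>V. local_equiv `` {tensor_triple A B})"
      by (simp add: LEO_group_def)
    have TT': "is_LEO (tensor_triple T T')" by (rule is_LEO_tensor[OF T])
    have tuple: "s_tuple A = s_tuple (tensor_triple T T')" if A_in: "A \<in> ?W" for A
    proof -
      obtain B B' where B: "(T, B) \<in> local_equiv" "(T', B') \<in> local_equiv"
        and A: "(tensor_triple B B', A) \<in> local_equiv"
        using A_in unfolding W unfolding U V by blast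
      have "is_LEO B" "is_LEO B'" using B by (simp_all add: local_equiv_def)
      then show ?thesis
        using s_tuple_local_equiv[OF A] s_tuple_local_equiv[OF B(1)] s_tuple_local_equiv[OF B(2)]
          s_tuple_tensor[OF T] s_tuple_tensor[of B B'] by simp
    qed
    have "tensor_triple T T' \<in> ?W"
      unfolding W unfolding U V using T[THEN local_equiv_refl] local_equiv_refl[OF TT'] by blast
    then have "s_vec ?W = s_tuple (tensor_triple T T')"
      by (intro s_vec_eq tuple) blast+
    then show "s_vec ?W = s_vec U \<otimes>\<^bsub>?G\<^esub> s_vec V"
      unfolding U V s_class[OF T(1)] s_class[OF T(2)] s_tuple_tensor[OF T]
      by (simp add: even_integers_simps restrict_UNIV)
  qed
  moreover have "s_vec ` carrier LEO_group = carrier ?G"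
  proof
    show "s_vec ` carrier LEO_group \<subseteq> carrier ?G"
      using calculation by (auto simp: hom_def)
    show "carrier ?G \<subseteq> s_vec ` carrier LEO_group"
    proof
      fix t assume "t \<in> carrier ?G"
      then obtain T where T: "is_LEO T" "s_tuple T = t"
        using s_tuple_surj[of t] unfolding carrier_target by blast
      have "local_equiv `` {T} \<in> carrier LEO_group" using T(1) carrier by blast
      then show "t \<in> s_vec ` carrier LEO_group"
        using s_class[OF T(1)] T(2) by (metis imageI)
    qed
  qed
  ultimately show ?thesis by (simp add: epi_def)
qed


end
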